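(* Let $\alpha\ge\gamma$. A function $\mathbf u=(u_1,\dots,u_M):\mathbb T^N\to\mathbb R^M$ is a subsolution of (HJ$\alpha$) if and only if $$\mathbb E_{\mathbf a}\big[u_{\omega(0)}(x)-u_{\omega(\tau)}(y)\big]\le\mathbb E_{\mathbf a}\left[\int_0^\tau L_{\omega(s)}(x+\mathcal I(\Xi)(s),-\Xi(s))+\alpha\,ds\right]$$ for every pair of points $x,y\in\mathbb T^N$, every $\mathbf a\in\mathcal S$, every bounded stopping time $\tau$ and every $\Xi\in\mathcal K(\tau,y-x)$.
   Context: **System.** $\mathbb T^N=\mathbb R^N/\mathbb Z^N$ is the flat torus; $+,-$ also denote its group operations, and points of $\mathbb R^N$ are identified with their projections on $\mathbb T^N$ where needed. For $i\in\{1,\dots,M\}$, $H_i:\mathbb T^N\times\mathbb R^N\to\mathbb R$, $(x,p)\mapsto H_i(x,p)$, is continuous in both variables, convex in $p$ and superlinear in $p$. The Lagrangians are $L_i(x,q)=\max_{p\in\mathbb R^N}(p\cdot q-H_i(x,p))$. $\Lambda=(\Lambda_{ij})$ is an $M\times M$ real matrix with rows $\Lambda^1,\dots,\Lambda^M$ such that every non-diagonal entry is nonpositive, every row sums to $0$, and $\Lambda$ is irreducible (for every nonempty $I\subsetneq\{1,\dots,M\}$ there are $i\in I$, $j\notin I$ with $\Lambda_{ij}\neq0$). For $\alpha\in\mathbb R$, (HJ$\alpha$) is the system $H_i(x,Du_i)+\Lambda^i\cdot\mathbf u=\alpha$ on $\mathbb T^N$, $i=1,\dots,M$. A continuous $\mathbf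 u=(u_1,\dots,u_M):\mathbb T^N\to\mathbb R^M$ is a subsolution (resp. supersolution) of (HJ$\alpha$) if $H_i(x,D\psi(x))+\Lambda^i\cdot\mathbf u(x)\le\alpha$ (resp. $\ge\alpha$) for every $x\in\mathbb T^N$, $i$, and $\psi\in C^1(\mathbb T^N)$ such that $u_i-\psi$ attains a maximum (resp. minimum) at $x$; a solution is both. The critical value is $\gamma=\inf\{\alpha\in\mathbb R : \text{(HJ}\alpha)\text{ admits subsolutions}\}$. **Random setting.** $\mathcal D$ is the space of cadlag paths $\omega:[0,+\infty)\to\{1,\dots,M\}$; $\mathcal F$ is the $\sigma$-algebra generated by the evaluations $\omega\mapsto\omega(s)$, $s\ge0$, and $\mathcal F_t$ the one generated by those with $s\le t$. $\mathcal S\subset\mathbb R^M$ is the simplex of probability vectors (regarded as row vectors). For $\mathbf a\in\mathcal S$, $\mathbb P_{\mathbf a}$ is the unique probability measure on $(\mathcal D,\mathcal F)$ with $$\mathbb P_{\mathbf a}(\omega(t_1)=j_1,\dots,\omega(t_k)=j_k)=(\mathbf a e^{-t_1\Lambda})_{j_1}\prod_{l=2}^k\big(e^{-(t_l-t_{l-1})\Lambda}\big)_{j_{l-1}j_l}$$ for all $k\in\mathbb N$, $0\le t_1<\dots<t_k$ and indices $j_1,\dots,j_k$. $\mathbb E_{\mathbf a}$ is the expectation with respect to $\mathbb P_{\mathbf a}$. "Almost surely" (a.s.) means up to a set that is $\mathbb P_{\mathbf a}$-null for some, equivalently all, $\mathbf a\in\mathcal S$ with strictly positive components. A stopping time is a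 nonnegative random variable $\tau$ on $(\mathcal D,\mathcal F)$ with $\{\tau\le t\}\in\mathcal F_t$ for all $t\ge0$. **Controls.** $\mathcal D(0,+\infty;\mathbb R^N)$ is the space of cadlag paths $[0,+\infty)\to\mathbb R^N$ with the Skorohod metric and its Borel $\sigma$-algebra (generated by the evaluations). A control is a measurable map $\Xi:\mathcal D\to\mathcal D(0,+\infty;\mathbb R^N)$ such that (i) for every $t>0$ there is $R>0$ with $\sup_{[0,t]}|\Xi|<R$ a.s.; (ii) $\Xi$ is nonanticipating: for every $t>0$, $\omega_1=\omega_2$ in $[0,t]$ implies $\Xi(\omega_1)=\Xi(\omega_2)$ in $[0,t]$. For $\xi\in\mathcal D(0,+\infty;\mathbb R^N)$, $\mathcal I(\xi)(t)\in\mathbb T^N$ is the projection on $\mathbb T^N$ of $\int_0^t\xi\,ds$; $\mathcal I(\Xi)$ is defined $\omega$ by $\omega$. For a bounded stopping time $\tau$ and $x,y\in\mathbb T^N$, $\mathcal K(\tau,y-x)$ is the set of controls $\Xi$ with $\mathcal I(\Xi)(\tau)=y-x$ a.s. *)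

theory Defs
  imports "HOL-Probability.Probability"
begin

section \<open>The flat torus\<close>

definition torus_rel :: "real^'n \<Rightarrow> real^'n \<Rightarrow> bool" where
  "torus_rel x y \<longleftrightarrow> (\<forall>i. x $ i - y $ i \<in> \<int>)"

lemma torus_rel_refl: "torus_rel x x"
  by (simp add: torus_rel_def)

lemma torus_rel_uminus: "torus_rel x y \<Longrightarrow> torus_rel (- x) (- y)"
  unfolding torus_rel_def by (metis Ints_minus minus_diff_minus vector_uminus_component)

lemma torus_rel_add:
  assumes "torus_rel x y" "torus_rel x' y'" shows "torus_rel (x + x') (y + y')"
  unfolding torus_rel_def
proof
  fix i
  have "(x + x') $ i - (y + y') $ i = (x $ i - y $ i) + (x' $ i - y' $ i)" by simp
  then show "(x + x') $ i - (y + y') $ i \<in> \<int>"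
    using assms by (metis Ints_add torus_rel_def)
qed

lemma equivp_torus_rel: "equivp torus_rel"
proof (rule equivpI)
  show "reflp torus_rel" by (simp add: reflp_def torus_rel_refl)
  show "symp torus_rel"
    unfolding symp_def torus_rel_def by (metis Ints_minus minus_diff_eq)
  show "transp torus_rel"
  proof (rule transpI)
    fix x y z :: "real^'n" assume "torus_rel x y" "torus_rel y z"
    from torus_rel_add[OF this] show "torus_rel x z" by (simp add: torus_rel_def algebra_simps)
  qed
qed

quotient_type (overloaded) 'n torus = "real^'n" / torus_rel
  by (rule equivp_torus_rel)

lift_definition to_torus :: "real^'n \<Rightarrow> 'n torus" is "\<lambda>x. x" .

instantiation torus :: (finite) ab_group_add
begin

lift_definition zero_torus :: "'a torus" is 0 .

lift_definition plus_torus :: "'a torus \<Rightarrow> 'a torus \<Rightarrow> 'a torus" is "(+)"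
  by (rule torus_rel_add)

lift_definition uminus_torus :: "'a torus \<Rightarrow> 'a torus" is uminus
  by (rule torus_rel_uminus)

lift_definition minus_torus :: "'a torus \<Rightarrow> 'a torus \<Rightarrow> 'a torus" is "(-)"
  by (metis torus_rel_add torus_rel_uminus diff_conv_add_uminus)

instance
proof
  fix a b c :: "'a torus"
  show "a + b + c = a + (b + c)" by transfer (simp add: torus_rel_refl add.assoc)
  show "a + b = b + a" by transfer (simp add: torus_rel_refl add.commute)
  show "0 + a = a" by transfer (simp add: torus_rel_refl)
  show "- a + a = 0" by transfer (simp add: torus_rel_refl)
  show "a - b = a + - b" by transfer (simp add: torus_rel_refl)
qed

end

text \<open>The torus carries the quotient topology of \<open>\<real>\<^sup>N\<close>.\<close>

instantiation torus :: (finite) topological_space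
begin

definition open_torus :: "'a torus set \<Rightarrow> bool" where
  "open_torus U \<longleftrightarrow> open (to_torus -` U)"

instance
  by standard (auto simp: open_torus_def vimage_Int vimage_Union)

end

text \<open>\<open>\<psi>\<close> is of class \<open>C\<^sup>1\<close> on the torus, with gradient \<open>g\<close>.\<close>

definition C1_torus :: "('n::finite torus \<Rightarrow> real) \<Rightarrow> ('n torus \<Rightarrow> real^'n) \<Rightarrow> bool" where
  "C1_torus \<psi> g \<longleftrightarrow>
     (\<forall>z. GDERIV (\<lambda>w. \<psi> (to_torus w)) z :> g (to_torus z)) \<and> continuous_on UNIV g"


section \<open>The Hamilton--Jacobi system\<close>

definition superlinear :: "(real^'n \<Rightarrow> real) \<Rightarrow> bool" where
  "superlinear h \<longleftrightarrow> filterlim (\<lambda>p. h p / norm p) at_top at_infinity"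

text \<open>The supremum is attained for continuous superlinear \<open>H i x\<close>; see
  \<open>lagrangian_attained\<close> below.\<close>

definition lagrangian ::
  "('m \<Rightarrow> 'n::finite torus \<Rightarrow> real^'n \<Rightarrow> real) \<Rightarrow> 'm \<Rightarrow> 'n torus \<Rightarrow> real^'n \<Rightarrow> real" where
  "lagrangian H i x q = (SUP p. p \<bullet> q - H i x p)"

lemma lagrangian_attained:
  fixes H :: "'m \<Rightarrow> 'n::finite torus \<Rightarrow> real^'n \<Rightarrow> real"
  assumes cont: "continuous_on UNIV (H i x)" and sup: "superlinear (H i x)"
  shows "\<exists>p. lagrangian H i x q = p \<bullet> q - H i x p \<and>
             (\<forall>p'. p' \<bullet> q - H i x p' \<le> p \<bullet> q - H i x p)"
proof -
  define f where "f = (\<lambda>p. p \<bullet> q - H i x p)"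
  have "eventually (\<lambda>p. norm q + \<bar>f 0\<bar> + 1 \<le> H i x p / norm p) at_infinity"
    using sup unfolding superlinear_def filterlim_at_top by blast
  then obtain B where B: "norm p \<ge> B \<Longrightarrow> norm q + \<bar>f 0\<bar> + 1 \<le> H i x p / norm p" for p
    unfolding eventually_at_infinity by blast
  define R where "R = max B 1"
  have far: "f p \<le> f 0" if "norm p \<ge> R" for p
  proof -
    have p: "norm p \<ge> 1" "norm p \<ge> B" using that by (auto simp: R_def)
    have "(norm q + \<bar>f 0\<bar> + 1) * norm p \<le> H i x p"
      using B[OF p(2)] p(1) by (subst (asm) pos_le_divide_eq) auto
    moreover have "p \<bullet> q \<le> norm q * norm p"
      using norm_cauchy_schwarz[of p q] by (simp add: mult.commute)
    moreover have "\<bar>f 0\<bar> * 1 \<le> \<bar>f 0\<bar> * norm p" using p(1) by (intro mult_left_mono) auto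
    ultimately show ?thesis using p(1) by (simp add: f_def algebra_simps)
  qed
  have "continuous_on (cball 0 R) f"
    unfolding f_def using cont by (intro continuous_intros continuous_on_subset[OF cont]) auto
  moreover have "cball (0::real^'n) R \<noteq> {}" by (simp add: R_def)
  ultimately obtain p where p: "p \<in> cball 0 R" "\<And>y. y \<in> cball 0 R \<Longrightarrow> f y \<le> f p"
    using continuous_attains_sup[OF compact_cball] by metis
  have "f 0 \<le> f p" by (intro p(2)) (simp add: R_def)
  then have mx: "f y \<le> f p" for y
    using p(2)[of y] far[of y] by (cases "norm y \<le> R") auto
  have "lagrangian H i x q = f p"
    unfolding lagrangian_def using mx by (intro cSup_eq_maximum) (auto simp: f_def)
  then show ?thesis using mx by (auto simp: f_def)
qed

definition coupling_matrix :: "real^'m^'m \<Rightarrow> bool" where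
  "coupling_matrix \<Lambda> \<longleftrightarrow>
     (\<forall>i j. i \<noteq> j \<longrightarrow> \<Lambda> $ i $ j \<le> 0) \<and>
     (\<forall>i. (\<Sum>j\<in>UNIV. \<Lambda> $ i $ j) = 0) \<and>
     (\<forall>I. I \<noteq> {} \<and> I \<noteq> UNIV \<longrightarrow> (\<exists>i\<in>I. \<exists>j. j \<notin> I \<and> \<Lambda> $ i $ j \<noteq> 0))"

definition subsolution ::
  "('m \<Rightarrow> 'n::finite torus \<Rightarrow> real^'n \<Rightarrow> real) \<Rightarrow> real^'m^'m \<Rightarrow> real \<Rightarrow>
   ('n torus \<Rightarrow> real^'m) \<Rightarrow> bool" where
  "subsolution H \<Lambda> \<alpha> u \<longleftrightarrow>
     continuous_on UNIV u \<and>
     (\<forall>x i \<psi> g. C1_torus \<psi> g \<and> (\<forall>y. u y $ i - \<psi> y \<le> u x $ i - \<psi> x)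
        \<longrightarrow> H i x (g x) + \<Lambda> $ i \<bullet> u x \<le> \<alpha>)"

definition critical_value ::
  "('m \<Rightarrow> 'n::finite torus \<Rightarrow> real^'n \<Rightarrow> real) \<Rightarrow> real^'m^'m \<Rightarrow> real" where
  "critical_value H \<Lambda> = Inf {\<alpha>. \<exists>u. subsolution H \<Lambda> \<alpha> u}"


section \<open>Cadlag paths\<close>

text \<open>A path on \<open>[0,\<infinity>)\<close> is a function on \<open>\<real>\<close> that is \<open>undefined\<close> at negative times.\<close>

definition cadlag_paths :: "'a topology \<Rightarrow> (real \<Rightarrow> 'a) set" where
  "cadlag_paths X = {\<omega> \<in> extensional {0..}.
     (\<forall>t\<ge>0. limitin X \<omega> (\<omega> t) (at_right t)) \<and>
     (\<forall>t>0. \<exists>l. limitin X \<omega> l (at_left t))}"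

text \<open>The \<open>\<sigma>\<close>-algebra generated by the evaluations at the times in \<open>T\<close>, the value space
  carrying its Borel \<open>\<sigma>\<close>-algebra.\<close>

definition path_algebra :: "'a topology \<Rightarrow> real set \<Rightarrow> (real \<Rightarrow> 'a) measure" where
  "path_algebra X T = sigma (cadlag_paths X)
     {{\<omega> \<in> cadlag_paths X. \<omega> s \<in> A} | s A. s \<in> T \<and> openin X A}"

abbreviation index_paths :: "(real \<Rightarrow> 'm) set" where
  "index_paths \<equiv> cadlag_paths (discrete_topology UNIV)"

abbreviation index_algebra :: "real set \<Rightarrow> (real \<Rightarrow> 'm) measure" where
  "index_algebra \<equiv> path_algebra (discrete_topology UNIV)"


section \<open>The random setting\<close>

definition prob_simplex :: "(real^'m) set" where
  "prob_simplex = {a. (\<forall>i. 0 \<le> a $ i) \<and> (\<Sum>i\<in>UNIV. a $ i) = 1}"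

text \<open>The matrix exponential is spelled out because the library product on \<open>real^'m^'m\<close> is
  componentwise, so \<open>exp\<close> does not apply.\<close>

definition matrix_exp :: "real^'m^'m \<Rightarrow> real^'m^'m" where
  "matrix_exp A = (\<Sum>n. (1 / fact n) *\<^sub>R (((**) A ^^ n) (mat 1)))"

definition is_path_law ::
  "real^'m^'m \<Rightarrow> real^'m \<Rightarrow> (real \<Rightarrow> 'm) measure \<Rightarrow> bool" where
  "is_path_law \<Lambda> a P \<longleftrightarrow>
     prob_space P \<and> sets P = sets (index_algebra {0..}) \<and>
     (\<forall>k\<ge>1. \<forall>(t :: nat \<Rightarrow> real) (j :: nat \<Rightarrow> 'm).
        0 \<le> t 1 \<and> (\<forall>l\<in>{1..<k}. t l < t (l + 1)) \<longrightarrow>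
        measure P {\<omega> \<in> index_paths. \<forall>l\<in>{1..k}. \<omega> (t l) = j l} =
          (a v* matrix_exp ((- t 1) *\<^sub>R \<Lambda>)) $ j 1 *
          (\<Prod>l=2..k. matrix_exp ((- (t l - t (l - 1))) *\<^sub>R \<Lambda>) $ j (l - 1) $ j l))"

definition path_law :: "real^'m^'m \<Rightarrow> real^'m \<Rightarrow> (real \<Rightarrow> 'm) measure" where
  "path_law \<Lambda> a = (THE P. is_path_law \<Lambda> a P)"

definition almost_surely :: "real^'m^'m \<Rightarrow> ((real \<Rightarrow> 'm) \<Rightarrow> bool) \<Rightarrow> bool" where
  "almost_surely \<Lambda> Q \<longleftrightarrow>
     (\<forall>a\<in>prob_simplex. (\<forall>i. 0 < a $ i) \<longrightarrow> (AE \<omega> in path_law \<Lambda> a. Q \<omega>))"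

text \<open>For negative \<open>t\<close>, included in the library notion \<^const>\<open>stopping_time\<close>, the event
  \<open>\<tau> \<le> t\<close> is empty.\<close>

definition bounded_stopping_time :: "((real \<Rightarrow> 'm) \<Rightarrow> real) \<Rightarrow> bool" where
  "bounded_stopping_time \<tau> \<longleftrightarrow>
     \<tau> \<in> borel_measurable (index_algebra {0..}) \<and>
     (\<forall>\<omega>\<in>index_paths. 0 \<le> \<tau> \<omega>) \<and>
     stopping_time (\<lambda>t. index_algebra {0..t}) \<tau> \<and>
     (\<exists>T. \<forall>\<omega>\<in>index_paths. \<tau> \<omega> \<le> T)"


section \<open>Controls\<close>

definition control ::
  "real^'m^'m \<Rightarrow> ((real \<Rightarrow> 'm) \<Rightarrow> real \<Rightarrow> real^'n) \<Rightarrow> bool" where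
  "control \<Lambda> \<Xi> \<longleftrightarrow>
     \<Xi> \<in> measurable (index_algebra {0..}) (path_algebra euclidean {0..}) \<and>
     (\<forall>t>0. \<exists>R>0. almost_surely \<Lambda> (\<lambda>\<omega>. (SUP s\<in>{0..t}. norm (\<Xi> \<omega> s)) < R)) \<and>
     (\<forall>t>0. \<forall>\<omega>1\<in>index_paths. \<forall>\<omega>2\<in>index_paths.
        (\<forall>s\<in>{0..t}. \<omega>1 s = \<omega>2 s) \<longrightarrow> (\<forall>s\<in>{0..t}. \<Xi> \<omega>1 s = \<Xi> \<omega>2 s))"

definition torus_integral :: "(real \<Rightarrow> real^'n) \<Rightarrow> real \<Rightarrow> 'n torus" where
  "torus_integral \<xi> t = to_torus (LBINT s:{0..t}. \<xi> s)"

definition controls_to ::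
  "real^'m^'m \<Rightarrow> ((real \<Rightarrow> 'm) \<Rightarrow> real) \<Rightarrow> 'n torus \<Rightarrow>
   ((real \<Rightarrow> 'm) \<Rightarrow> real \<Rightarrow> real^'n) set" where
  "controls_to \<Lambda> \<tau> z =
     {\<Xi>. control \<Lambda> \<Xi> \<and> almost_surely \<Lambda> (\<lambda>\<omega>. torus_integral (\<Xi> \<omega>) (\<tau> \<omega>) = z)}"

end

theory Submission
  imports Defs
begin

text \<open>
  A subsolution loses along any trajectory at most what the running cost and the coupling pay
  for, and the coupling term is exactly compensated by the jumps of the chain.

  From subsolutions to the inequality.  For smooth \<open>u\<close> one would differentiate \<open>u\<^sub>i\<close> along a curve
  with velocity \<open>\<xi>\<close> and use Fenchel's inequality with \<open>p = D u\<^sub>i\<close> and \<open>q = - \<xi>\<close>.  For a continuous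
  viscosity subsolution this is replaced by a doubling of variables with a smooth periodic penalty
  (\<open>subsolution_along_curve_const\<close>, \<open>subsolution_along_curve\<close>): for a fixed state \<open>i\<close>, the decrease of
  \<open>u\<^sub>i\<close> along the curve is at most the integral of \<open>L\<^sub>i + \<alpha> - \<Lambda>\<^sup>i \<bullet> u\<close>.  During a time step of length
  \<open>h\<close> the state is frozen at its initial value.  By the Markov property (\<open>markov_expectation\<close>) the
  expected change of \<open>u\<close> caused by a change of state is \<open>- h * \<Lambda>\<^sup>i \<bullet> u\<close> up to \<open>o(h)\<close>, which cancels
  the coupling term, and the error of freezing is also \<open>o(h)\<close>, since the expected time away from the
  initial state is of order \<open>h\<^sup>2\<close> (\<open>step\<close>).  The steps are added up along a grid; the event that a
  stopping time exceeds a grid point is known at that point, and the rounded stopping times converge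
  from the right to the given one (\<open>subsolution_inequality\<close>).  The control is adapted because its
  value up to time \<open>t\<close> is a function of the path frozen at time \<open>t\<close> (\<open>measurable_curve\<close>).

  From the inequality to subsolutions.  Constant controls and deterministic times suffice
  (\<open>constant_control_inequality\<close>).  Joining points in a fixed time shows that \<open>u\<close> is bounded
  (\<open>val_bounded\<close>), joining them at unit speed that it is locally Lipschitz, hence continuous
  (\<open>val_lipschitz_locally\<close>).  At a point where \<open>u\<^sub>i - \<psi>\<close> is maximal, with \<open>q\<close> dual to
  \<open>p = D \<psi>\<close> (\<open>fenchel_attained\<close>), the control \<open>- q\<close> over a time \<open>t \<rightarrow> 0\<close> gives
  \<open>q \<bullet> p + \<Lambda>\<^sup>i \<bullet> u \<le> L\<^sub>i(x, q) + \<alpha>\<close>, which is the viscosity inequality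
  (\<open>viscosity_inequality\<close>).

  Both directions compute with \<open>path_law\<close>, defined as the unique law with given finite-dimensional
  distributions.  Uniqueness holds because cylinders generate the algebra (\<open>path_law_unique\<close>).  For
  existence the chain is built on a stream of independent exponential waiting times and random maps
  of the state space; conditioning on the first jump gives a renewal equation, equivalent to the
  backward equation solved by \<open>e\<^bsup>-t\<Lambda>\<^esup>\<close> (\<open>renewal_nn\<close>, \<open>shift_prob_semigroup\<close>,
  \<open>is_path_law_mixture\<close>).
\<close>

section \<open>Lifting from the torus to Euclidean space\<close>

lemma to_torus_eq_iff: "to_torus v = to_torus w \<longleftrightarrow> torus_rel v w"
  by transfer simp

lemma to_torus_add: "to_torus (v + w) = to_torus v + to_torus (w :: real^'n::finite)"
  by transfer (simp add: torus_rel_refl)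

lemma to_torus_rep: "to_torus (rep_torus z) = z"
  using Quotient_abs_rep[OF Quotient_torus] by (simp add: to_torus_def)

lemma continuous_torus_iff:
  fixes f :: "'n::finite torus \<Rightarrow> 'a::topological_space"
  shows "continuous_on UNIV f \<longleftrightarrow> continuous_on UNIV (\<lambda>v. f (to_torus v))"
  by (simp add: continuous_on_open_vimage open_torus_def vimage_def)

lemma continuous_to_torus: "continuous_on S (to_torus :: real^'n::finite \<Rightarrow> 'n torus)"
  using continuous_torus_iff[of "\<lambda>z :: 'n torus. z"] continuous_on_subset by auto

text \<open>The unit cube is a compact set of representatives; this is the form in which
  compactness of the torus enters.\<close>

lemma torus_lift_in_cube:
  fixes z :: "'n::finite torus"
  obtains v where "v \<in> cbox 0 1" "to_torus v = z"
proof
  let ?r = "rep_torus z"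
  let ?v = "(\<chi> i. frac (?r $ i)) :: real^'n"
  show "?v \<in> cbox 0 1" by (auto simp: mem_box_cart frac_ge_0 less_imp_le[OF frac_lt_1])
  have "torus_rel ?v ?r" by (auto simp: torus_rel_def frac_def)
  then show "to_torus ?v = z" using to_torus_rep[of z] by (metis to_torus_eq_iff)
qed

text \<open>The unit cube times \<open>K\<close> is compact; this bounds a Lagrangian over all positions at once.\<close>

lemma bounded_periodic:
  fixes f :: "'n::finite torus \<Rightarrow> 'b::topological_space \<Rightarrow> real"
  assumes "continuous_on UNIV (\<lambda>(v, q). f (to_torus v) q)" and "compact K"
  obtains C where "\<And>z q. q \<in> K \<Longrightarrow> \<bar>f z q\<bar> \<le> C"
proof -
  have "compact ((\<lambda>(v, q). f (to_torus v) q) ` (cbox 0 1 \<times> K))"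
    using assms(2)
    by (intro compact_continuous_image[OF continuous_on_subset[OF assms(1)]])
      (auto intro: compact_Times)
  from compact_imp_bounded[OF this]
  obtain C where C: "\<forall>y\<in>(\<lambda>(v, q). f (to_torus v) q) ` (cbox 0 1 \<times> K). norm y \<le> C"
    unfolding bounded_iff ..
  have "\<bar>f z q\<bar> \<le> C" if "q \<in> K" for z q
  proof -
    obtain v where "v \<in> cbox 0 1" "to_torus v = z" by (rule torus_lift_in_cube)
    then have "f z q \<in> (\<lambda>(v, q). f (to_torus v) q) ` (cbox 0 1 \<times> K)"
      using that by (intro image_eqI[of _ _ "(v, q)"]) auto
    then show ?thesis using C by auto
  qed
  then show thesis by (rule that)
qed

section \<open>The Lagrangian\<close>

text \<open>Superlinearity at \<open>x0\<close> gives growth on one large sphere.  By uniform continuity the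
  estimate on that sphere persists for nearby \<open>x\<close>, and convexity along the rays from the origin
  extends it to the outside of the sphere.\<close>

lemma convex_superlinear_locally_uniform:
  fixes F :: "real^'k::finite \<Rightarrow> real^'n::finite \<Rightarrow> real"
  assumes cont: "continuous_on UNIV (\<lambda>(x, p). F x p)"
    and conv: "\<And>x. convex_on UNIV (F x)"
    and sup: "superlinear (F x0)"
  obtains R d where "0 < d" "0 < R"
    "\<And>x p. dist x x0 < d \<Longrightarrow> norm p \<ge> R \<Longrightarrow> F x p - F x 0 \<ge> K * norm p"
proof -
  have "eventually (\<lambda>p. \<bar>K\<bar> + 1 + \<bar>F x0 0\<bar> \<le> F x0 p / norm p) at_infinity"
    using sup unfolding superlinear_def filterlim_at_top by blast
  then obtain B where B: "norm p \<ge> B \<Longrightarrow> \<bar>K\<bar> + 1 + \<bar>F x0 0\<bar> \<le> F x0 p / norm p" for p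
    unfolding eventually_at_infinity by blast
  define R where "R = max B 1"
  have R: "R \<ge> 1" "R \<ge> B" by (auto simp: R_def)
  have far: "F x0 p - F x0 0 \<ge> K * R + 1" if p: "norm p = R" for p
  proof -
    have "(\<bar>K\<bar> + 1 + \<bar>F x0 0\<bar>) * R \<le> F x0 p"
      using B[of p] p R by (simp add: pos_le_divide_eq)
    moreover have "\<bar>F x0 0\<bar> * 1 \<le> \<bar>F x0 0\<bar> * R"
      using R by (intro mult_left_mono) auto
    moreover have "K * R \<le> \<bar>K\<bar> * R"
      using R by (intro mult_right_mono) auto
    moreover have "(\<bar>K\<bar> + 1 + \<bar>F x0 0\<bar>) * R = \<bar>K\<bar> * R + R + \<bar>F x0 0\<bar> * R"
      by (simp add: algebra_simps)
    ultimately show ?thesis using R by linarith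
  qed
  have "uniformly_continuous_on (cball x0 1 \<times> cball 0 R) (\<lambda>(x, p). F x p)"
    by (rule compact_uniformly_continuous[OF continuous_on_subset[OF cont subset_UNIV]
          compact_Times[OF compact_cball compact_cball]])
  then obtain d0 where d0: "d0 > 0" "\<And>a b. a \<in> cball x0 1 \<times> cball 0 R \<Longrightarrow> b \<in> cball x0 1 \<times> cball 0 R
      \<Longrightarrow> dist b a < d0 \<Longrightarrow> dist (case b of (x,p) \<Rightarrow> F x p) (case a of (x,p) \<Rightarrow> F x p) < 1/2"
    by (rule uniformly_continuous_onE[of _ _ "1/2"]) (simp, blast)
  define d where "d = min d0 1"
  have near: "F x p \<ge> F x0 p - 1/2" "F x p \<le> F x0 p + 1/2" if "dist x x0 < d" "norm p \<le> R" for x p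
  proof -
    have "dist (F x p) (F x0 p) < 1/2"
      using d0(2)[of "(x0,p)" "(x,p)"] that by (auto simp: d_def dist_commute dist_Pair_Pair)
    then show "F x p \<ge> F x0 p - 1/2" "F x p \<le> F x0 p + 1/2"
      unfolding dist_real_def by linarith+
  qed
  have "F x p - F x 0 \<ge> K * norm p" if x: "dist x x0 < d" and p: "norm p \<ge> R" for x p
  proof -
    \<comment> \<open>The point of the sphere on the ray through \<open>p\<close>, a convex combination of \<open>p\<close> and \<open>0\<close>.\<close>
    define s where "s = R / norm p"
    have np: "norm p > 0" using p R by linarith
    have s: "0 < s" "s \<le> 1" using np p R by (auto simp: s_def)
    have "F x (s *\<^sub>R p + (1 - s) *\<^sub>R 0) \<le> s * F x p + (1 - s) * F x 0"
      using conv[of x] s unfolding convex_on_def by (metis UNIV_I add_diff_cancel_left' diff_ge_0_iff_ge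
          diff_add_cancel add.commute less_imp_le)
    then have 1: "F x (s *\<^sub>R p) - F x 0 \<le> s * (F x p - F x 0)" by (simp add: algebra_simps)
    have ns: "norm (s *\<^sub>R p) = R" using np R s by (simp add: s_def)
    have "K * R \<le> F x (s *\<^sub>R p) - F x 0"
      using far[OF ns] near(1)[OF x, of "s *\<^sub>R p"] near(2)[OF x, of 0] ns R by simp
    with 1 have "K * R \<le> s * (F x p - F x 0)" by linarith
    then have "K * R * norm p \<le> R * (F x p - F x 0)"
      using np by (simp add: s_def field_simps)
    then have "R * (K * norm p) \<le> R * (F x p - F x 0)" by (simp add: mult_ac)
    then show ?thesis using R by (simp add: mult_le_cancel_left)
  qed
  then show thesis using that[of d R] d0(1) R by (auto simp: d_def)
qed

locale hamiltonian =
  fixes H :: "'m::finite \<Rightarrow> 'n::finite torus \<Rightarrow> real^'n \<Rightarrow> real"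
  assumes H_cont: "\<And>i. continuous_on UNIV (\<lambda>(x, p). H i x p)"
    and H_conv: "\<And>i x. convex_on UNIV (H i x)"
    and H_super: "\<And>i x. superlinear (H i x)"
begin

lemma H_cont_lift: "continuous_on UNIV (\<lambda>(v, p). H i (to_torus v) p)"
proof -
  have "continuous_on UNIV ((\<lambda>(x, p). H i x p) \<circ> (\<lambda>vp. (to_torus (fst vp), snd vp)))"
    by (intro continuous_on_compose continuous_intros continuous_on_subset[OF H_cont]
        continuous_on_compose2[OF continuous_to_torus]) auto
  then show ?thesis by (simp add: comp_def case_prod_unfold)
qed

lemma H_cont_p: "continuous_on UNIV (H i x)"
proof -
  have "continuous_on UNIV ((\<lambda>(x, p). H i x p) \<circ> Pair x)"
    by (intro continuous_on_compose continuous_intros continuous_on_subset[OF H_cont]) auto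
  then show ?thesis by (simp add: comp_def)
qed

lemma fenchel: "p \<bullet> q \<le> H i x p + lagrangian H i x q"
  using lagrangian_attained[where H=H and i=i and x=x and q=q, OF H_cont_p H_super]
  by (smt (verit))

text \<open>A supporting hyperplane of the epigraph of \<open>H i x\<close> at \<open>p\<close> yields a velocity for which
  Fenchel's inequality is an equality.\<close>

lemma fenchel_attained: "\<exists>q. lagrangian H i x q = p \<bullet> q - H i x p"
proof -
  define T where "T = {z. H i x (fst z) < snd z}"
  have "convex T"
  proof (rule convexI)
    fix y z :: "(real^'n) \<times> real" and s t :: real
    assume yz: "y \<in> T" "z \<in> T" and st: "0 \<le> s" "0 \<le> t" "s + t = 1"
    have "H i x (s *\<^sub>R fst y + t *\<^sub>R fst z) \<le> s * H i x (fst y) + t * H i x (fst z)"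
      using H_conv[of i x] st unfolding convex_on_def by blast
    also have "\<dots> < s * snd y + t * snd z"
    proof (cases "s = 0")
      case True then show ?thesis using yz st by (auto simp: T_def)
    next
      case False
      then have "s * H i x (fst y) < s * snd y" using yz st by (auto simp: T_def)
      moreover have "t * H i x (fst z) \<le> t * snd z" using yz st
        by (auto simp: T_def intro!: mult_left_mono)
      ultimately show ?thesis by linarith
    qed
    finally show "s *\<^sub>R y + t *\<^sub>R z \<in> T" by (simp add: T_def)
  qed
  moreover have "(p, H i x p + 1) \<in> T" "(p, H i x p) \<notin> T" by (auto simp: T_def)
  ultimately obtain a b where ab: "a \<noteq> 0" "a \<bullet> (p, H i x p) \<le> b" "\<And>z. z \<in> T \<Longrightarrow> a \<bullet> z \<ge> b"
    using separating_hyperplane_sets[of "{(p, H i x p)}" T] by fastforce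
  obtain v \<beta> where a: "a = (v, \<beta>)" by (cases a)
  have key: "v \<bullet> p + \<beta> * H i x p \<le> v \<bullet> p' + \<beta> * t" if "H i x p' < t" for p' t
    using ab(2) ab(3)[of "(p', t)"] that by (simp add: a T_def)
  have b0: "\<beta> \<ge> 0" using key[of p "H i x p + 1"] by (simp add: algebra_simps)
  \<comment> \<open>A separating hyperplane is not vertical, since \<open>H i x\<close> is finite everywhere.\<close>
  have "\<beta> \<noteq> 0"
  proof
    assume z: "\<beta> = 0"
    have "v \<bullet> p \<le> v \<bullet> (p - v)" using key[of "p - v" "H i x (p - v) + 1"] z by simp
    then have "v = 0" by (simp add: inner_diff_right) (metis inner_eq_zero_iff inner_ge_zero order_antisym)
    then show False using ab(1) a z by (simp add: zero_prod_def)
  qed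
  with b0 have b: "\<beta> > 0" by simp
  define q where "q = (- 1 / \<beta>) *\<^sub>R v"
  have "H i x p' \<ge> H i x p + q \<bullet> (p' - p)" for p'
  proof (rule dense_ge)
    fix t assume "H i x p' < t"
    from key[OF this] have "\<beta> * H i x p + v \<bullet> (p - p') \<le> \<beta> * t" by (simp add: inner_diff_right)
    then have "H i x p + v \<bullet> (p - p') / \<beta> \<le> t" using b by (simp add: field_simps)
    then show "H i x p + q \<bullet> (p' - p) \<le> t"
      by (simp add: q_def inner_diff_right diff_divide_distrib)
  qed
  then have "p' \<bullet> q - H i x p' \<le> p \<bullet> q - H i x p" for p'
    by (simp add: inner_diff_right inner_commute algebra_simps)
  then have "lagrangian H i x q = p \<bullet> q - H i x p"
    unfolding lagrangian_def by (intro cSup_eq_maximum) auto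
  then show ?thesis by blast
qed

text \<open>Near a given point and velocity, superlinearity confines all maximisers \<open>p\<close> to one ball; on
  that ball the maximised function is uniformly continuous.\<close>

lemma lagrangian_continuous: "continuous_on UNIV (\<lambda>(v, q). lagrangian H i (to_torus v) q)"
proof -
  define F where "F v p = H i (to_torus v) p" for v p
  define L where "L v q = lagrangian H i (to_torus v) q" for v q
  have Fc: "continuous_on UNIV (\<lambda>(v, p). F v p)" unfolding F_def by (rule H_cont_lift)
  have att: "\<exists>p. L v q = p \<bullet> q - F v p \<and> (\<forall>p'. p' \<bullet> q - F v p' \<le> p \<bullet> q - F v p)" for v q
    using lagrangian_attained[where H=H and i=i and x="to_torus v" and q=q, OF H_cont_p H_super]
    unfolding F_def L_def by metis
  have "isCont (\<lambda>(v, q). L v q) (x0, q0)" for x0 q0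
    unfolding continuous_at_eps_delta
  proof (intro allI impI)
    fix e :: real assume e: "e > 0"
    \<comment> \<open>A growth rate above the norm of every velocity within distance \<open>1\<close> of \<open>q0\<close>: then no \<open>p\<close>
       outside a fixed ball does better than \<open>p = 0\<close>.\<close>
    define K where "K = norm q0 + 2"
    obtain R d where Rd: "0 < d" "0 < R"
      "\<And>x p. dist x x0 < d \<Longrightarrow> norm p \<ge> R \<Longrightarrow> F x p - F x 0 \<ge> K * norm p"
      using convex_superlinear_locally_uniform[OF Fc, of x0 K] H_conv H_super
      unfolding F_def by metis
    have arg: "norm p < R" if "dist v x0 < d" "norm q < K"
      "\<forall>p'. p' \<bullet> q - F v p' \<le> p \<bullet> q - F v p" for v q p
    proof (rule ccontr)
      assume "\<not> norm p < R"
      then have p: "norm p \<ge> R" by simp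
      have "0 \<bullet> q - F v 0 \<le> p \<bullet> q - F v p" using that by blast
      moreover have "p \<bullet> q \<le> norm p * norm q" by (rule norm_cauchy_schwarz)
      moreover have "norm p * norm q < norm p * K" using p Rd that by (intro mult_strict_left_mono) auto
      ultimately show False using Rd(3)[OF that(1) p] by (simp add: mult.commute)
    qed
    define C where "C = (cball x0 d \<times> cball q0 1) \<times> cball (0::real^'n) R"
    define g where "g = (\<lambda>z. snd z \<bullet> snd (fst z) - F (fst (fst z)) (snd z))"
    have gc: "continuous_on UNIV g"
      unfolding g_def
      by (intro continuous_intros continuous_on_compose2[OF Fc[unfolded case_prod_unfold],
            where f="\<lambda>z. (fst (fst z), snd z)", simplified])
    have "uniformly_continuous_on C g"
      unfolding C_def
      by (rule compact_uniformly_continuous[OF continuous_on_subset[OF gc subset_UNIV]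
            compact_Times[OF compact_Times[OF compact_cball compact_cball] compact_cball]])
    then obtain d0 where d0: "d0 > 0" "\<And>a b. a \<in> C \<Longrightarrow> b \<in> C \<Longrightarrow> dist b a < d0 \<Longrightarrow> dist (g b) (g a) < e"
      by (rule uniformly_continuous_onE[OF _ e]) blast
    define r where "r = min (min d0 d) 1"
    show "\<exists>r>0. \<forall>y. dist y (x0, q0) < r \<longrightarrow> dist (case y of (v, q) \<Rightarrow> L v q) (case (x0, q0) of (v, q) \<Rightarrow> L v q) < e"
    proof (intro exI conjI allI impI)
      show "r > 0" using d0 Rd by (auto simp: r_def)
      fix y assume y: "dist y (x0, q0) < r"
      obtain v q where yv: "y = (v, q)" by (cases y)
      have v: "dist v x0 < d" and q: "dist q q0 < 1"
        using y dist_fst_le[of y "(x0,q0)"] dist_snd_le[of y "(x0,q0)"] by (auto simp: yv r_def)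
      have nq: "norm q < K" using q norm_triangle_sub[of q q0] by (auto simp: dist_norm K_def)
      obtain p where p: "L v q = p \<bullet> q - F v p" "\<forall>p'. p' \<bullet> q - F v p' \<le> p \<bullet> q - F v p" using att by blast
      obtain p0 where p0: "L x0 q0 = p0 \<bullet> q0 - F x0 p0" "\<forall>p'. p' \<bullet> q0 - F x0 p' \<le> p0 \<bullet> q0 - F x0 p0"
        using att by blast
      have np: "norm p < R" "norm p0 < R"
        using arg[OF v nq p(2)] arg[OF _ _ p0(2)] Rd by (auto simp: K_def)
      have *: "\<bar>(p' \<bullet> q - F v p') - (p' \<bullet> q0 - F x0 p')\<bar> < e" if "norm p' < R" for p'
      proof -
        have "dist ((v,q),p') ((x0,q0),p') < d0"
          using y by (simp add: dist_Pair_Pair yv r_def)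
        then show ?thesis
          using d0(2)[of "((x0,q0),p')" "((v,q),p')"] that v q Rd
          by (auto simp: C_def g_def dist_real_def dist_commute)
      qed
      \<comment> \<open>Each of the two maximisers is a competitor in the other problem.\<close>
      have "p0 \<bullet> q - F v p0 \<le> L v q" "p \<bullet> q0 - F x0 p \<le> L x0 q0" using p p0 by auto
      with *[OF np(1)] *[OF np(2)] show "dist (case y of (v, q) \<Rightarrow> L v q) (case (x0, q0) of (v, q) \<Rightarrow> L v q) < e"
        by (simp add: yv dist_real_def p(1) p0(1))
    qed
  qed
  then show ?thesis unfolding L_def by (auto simp: continuous_on_eq_continuous_at)
qed

lemma lagrangian_bounded:
  obtains C where "\<And>i z q. norm q \<le> R \<Longrightarrow> \<bar>lagrangian H i z q\<bar> \<le> C"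
proof -
  have "\<exists>C. \<forall>z q. q \<in> cball 0 R \<longrightarrow> \<bar>lagrangian H i z q\<bar> \<le> C" for i
    using bounded_periodic[OF lagrangian_continuous compact_cball] by metis
  then obtain C where C: "\<And>i z q. q \<in> cball 0 R \<Longrightarrow> \<bar>lagrangian H i z q\<bar> \<le> C i" by metis
  have "\<bar>lagrangian H i z q\<bar> \<le> (\<Sum>i\<in>UNIV. \<bar>C i\<bar>)" if "norm q \<le> R" for i z q
  proof -
    have "\<bar>C i\<bar> \<le> (\<Sum>i\<in>UNIV. \<bar>C i\<bar>)" by (intro member_le_sum) auto
    then show ?thesis using C[of q i z] that by simp
  qed
  then show thesis by (rule that)
qed

end

section \<open>The matrix semigroup\<close>

text \<open>The powers in the form in which the series of \<open>matrix_exp\<close> contains them.\<close>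

definition matpow :: "real^'m^'m \<Rightarrow> nat \<Rightarrow> real^'m::finite^'m" where
  "matpow A n = ((**) A ^^ n) (mat 1)"

lemma matpow_0 [simp]: "matpow A 0 = mat 1"
  by (simp add: matpow_def)

lemma matpow_Suc: "matpow A (Suc n) = A ** matpow A n"
  by (simp add: matpow_def)

lemma matpow_Suc2: "matpow A (Suc n) = matpow A n ** A"
  by (induction n) (metis matpow_0 matpow_Suc matrix_mul_lid matrix_mul_rid, metis matpow_Suc matrix_mul_assoc)

lemma matpow_scale: "matpow (c *\<^sub>R A) n = c ^ n *\<^sub>R matpow A n"
proof (induction n)
  case (Suc n)
  have "(c *\<^sub>R A) ** (c ^ n *\<^sub>R matpow A n) = c ^ Suc n *\<^sub>R (A ** matpow A n)"
    by (simp add: vec_eq_iff matrix_matrix_mult_def sum_distrib_left mult_ac)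
  then show ?case by (simp only: matpow_Suc Suc)
qed simp

text \<open>Geometric growth of the entries makes the exponential series converge entry by entry.\<close>

lemma matpow_bound:
  obtains K where "\<And>n i j. \<bar>matpow A n $ i $ j\<bar> \<le> K ^ n"
proof -
  define K where "K = (\<Sum>i\<in>UNIV. \<Sum>j\<in>UNIV. \<bar>A $ i $ j\<bar>)"
  have row: "(\<Sum>j\<in>UNIV. \<bar>A $ i $ j\<bar>) \<le> K" for i
    unfolding K_def by (intro member_le_sum) (auto intro: sum_nonneg)
  have K0: "K \<ge> 0" unfolding K_def by (intro sum_nonneg) auto
  have "\<bar>matpow A n $ i $ j\<bar> \<le> K ^ n" for n i j
  proof (induction n arbitrary: i j)
    case 0 then show ?case by (simp add: mat_def)
  next
    case (Suc n)
    have "\<bar>matpow A (Suc n) $ i $ j\<bar> \<le> (\<Sum>k\<in>UNIV. \<bar>A $ i $ k\<bar> * \<bar>matpow A n $ k $ j\<bar>)"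
      by (simp add: matpow_Suc matrix_matrix_mult_def flip: abs_mult)
    also have "\<dots> \<le> (\<Sum>k\<in>UNIV. \<bar>A $ i $ k\<bar> * K ^ n)"
      by (intro sum_mono mult_left_mono Suc) auto
    also have "\<dots> \<le> K * K ^ n"
      unfolding sum_distrib_right[symmetric] by (intro mult_right_mono row zero_le_power K0)
    finally show ?case by simp
  qed
  then show thesis by (rule that)
qed

text \<open>The transition matrices \<open>e\<^bsup>-t\<Lambda>\<^esup>\<close> of the chain; its generator is \<open>-\<Lambda>\<close>.\<close>

definition chain_semigroup :: "real^'m^'m \<Rightarrow> real \<Rightarrow> real^'m::finite^'m" where
  "chain_semigroup \<Lambda> t = matrix_exp ((- t) *\<^sub>R \<Lambda>)"

text \<open>Entry by entry, the exponential is a real power series, so that termwise differentiation is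
  available.\<close>

lemma chain_semigroup_sums:
  "(\<lambda>n. (- 1) ^ n / fact n * matpow \<Lambda> n $ i $ j * t ^ n) sums (chain_semigroup \<Lambda> t $ i $ j)"
proof -
  obtain K where K: "\<And>n i j. \<bar>matpow \<Lambda> n $ i $ j\<bar> \<le> K ^ n"
    using matpow_bound[of \<Lambda>] by blast
  let ?f = "\<lambda>n. (1 / fact n) *\<^sub>R matpow ((- t) *\<^sub>R \<Lambda>) n"
  let ?c = "\<lambda>i j n. (- 1) ^ n / fact n * matpow \<Lambda> n $ i $ j * t ^ n"
  have f: "?f n $ i $ j = ?c i j n" for n i j
    by (simp only: matpow_scale) (simp add: power_minus[of t] field_simps)
  have sm: "summable (?c i j)" for i j
  proof (rule summable_comparison_test)
    show "summable (\<lambda>n. inverse (fact n) * (K * \<bar>t\<bar>) ^ n)" by (rule summable_exp)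
    show "\<exists>N. \<forall>n\<ge>N. norm (?c i j n) \<le> inverse (fact n) * (K * \<bar>t\<bar>) ^ n"
    proof (intro exI allI impI)
      fix n
      have "\<bar>matpow \<Lambda> n $ i $ j\<bar> * \<bar>t\<bar> ^ n / fact n \<le> K ^ n * \<bar>t\<bar> ^ n / fact n"
        by (intro divide_right_mono mult_right_mono K) auto
      then show "norm (?c i j n) \<le> inverse (fact n) * (K * \<bar>t\<bar>) ^ n"
        by (simp add: abs_mult power_abs power_mult_distrib field_simps)
    qed
  qed
  have "(\<lambda>n. ?f n $ i $ j) sums suminf (?c i j)" for i j
    unfolding f by (rule summable_sums[OF sm])
  then have "?f sums (\<chi> i j. suminf (?c i j))"
    unfolding sums_def by (intro vec_tendstoI) (simp only: sum_component vec_lambda_beta)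
  then have "chain_semigroup \<Lambda> t = (\<chi> i j. suminf (?c i j))"
    unfolding chain_semigroup_def matrix_exp_def matpow_def by (simp add: sums_iff)
  then show ?thesis using summable_sums[OF sm] by simp
qed

lemma chain_semigroup_0 [simp]: "chain_semigroup \<Lambda> 0 = mat 1"
proof -
  have "chain_semigroup \<Lambda> 0 $ i $ j = mat 1 $ i $ j" for i j
    using chain_semigroup_sums[of \<Lambda> i j 0] powser_sums_zero[of "\<lambda>n. (- 1) ^ n / fact n * matpow \<Lambda> n $ i $ j"]
    by (simp add: sums_unique2)
  then show ?thesis by (simp add: vec_eq_iff)
qed

lemma chain_semigroup_commute: "chain_semigroup \<Lambda> t ** \<Lambda> = \<Lambda> ** chain_semigroup \<Lambda> t"
proof -
  have "(\<lambda>n. \<Sum>k\<in>UNIV. \<Lambda> $ i $ k * ((- 1) ^ n / fact n * matpow \<Lambda> n $ k $ j * t ^ n))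
      sums ((\<Lambda> ** chain_semigroup \<Lambda> t) $ i $ j)" for i j
    unfolding matrix_matrix_mult_def by (simp only: vec_lambda_beta, intro sums_sum sums_mult chain_semigroup_sums)
  moreover have "(\<lambda>n. \<Sum>k\<in>UNIV. ((- 1) ^ n / fact n * matpow \<Lambda> n $ i $ k * t ^ n) * \<Lambda> $ k $ j)
      sums ((chain_semigroup \<Lambda> t ** \<Lambda>) $ i $ j)" for i j
    unfolding matrix_matrix_mult_def by (simp only: vec_lambda_beta, intro sums_sum sums_mult2 chain_semigroup_sums)
  moreover have "(\<Sum>k\<in>UNIV. \<Lambda> $ i $ k * ((- 1) ^ n / fact n * matpow \<Lambda> n $ k $ j * t ^ n)) =
     (\<Sum>k\<in>UNIV. ((- 1) ^ n / fact n * matpow \<Lambda> n $ i $ k * t ^ n) * \<Lambda> $ k $ j)" for n i j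
  proof -
    have "(\<Sum>k\<in>UNIV. \<Lambda> $ i $ k * ((- 1) ^ n / fact n * matpow \<Lambda> n $ k $ j * t ^ n)) =
       (- 1) ^ n / fact n * t ^ n * matpow \<Lambda> (Suc n) $ i $ j"
      by (simp add: matpow_Suc matrix_matrix_mult_def sum_distrib_left mult_ac)
    also have "\<dots> = (\<Sum>k\<in>UNIV. ((- 1) ^ n / fact n * matpow \<Lambda> n $ i $ k * t ^ n) * \<Lambda> $ k $ j)"
      by (simp add: matpow_Suc2 matrix_matrix_mult_def sum_distrib_left mult_ac)
    finally show ?thesis .
  qed
  ultimately have "(chain_semigroup \<Lambda> t ** \<Lambda>) $ i $ j = (\<Lambda> ** chain_semigroup \<Lambda> t) $ i $ j" for i j
    by (metis (no_types, lifting) sums_unique2 sums_cong)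
  then show ?thesis by (simp add: vec_eq_iff)
qed

lemma chain_semigroup_deriv:
  "((\<lambda>t. chain_semigroup \<Lambda> t $ i $ j) has_real_derivative - ((\<Lambda> ** chain_semigroup \<Lambda> t) $ i $ j)) (at t)"
proof -
  let ?c = "\<lambda>i j n. (- 1) ^ n / fact n * matpow \<Lambda> n $ i $ j"
  have s: "chain_semigroup \<Lambda> t $ i $ j = (\<Sum>n. ?c i j n * t ^ n)" for t i j
    using chain_semigroup_sums by (rule sums_unique)
  have "((\<lambda>t. \<Sum>n. ?c i j n * t ^ n) has_real_derivative (\<Sum>n. diffs (?c i j) n * t ^ n)) (at t)"
    by (rule termdiffs_strong_converges_everywhere) (use chain_semigroup_sums sums_summable in blast)
  moreover have "(\<Sum>n. diffs (?c i j) n * t ^ n) = - ((\<Lambda> ** chain_semigroup \<Lambda> t) $ i $ j)"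
  proof -
    have d: "diffs (?c i j) n * t ^ n = (\<Sum>k\<in>UNIV. - \<Lambda> $ i $ k * (?c k j n * t ^ n))" for n
    proof -
      have "diffs (?c i j) n = - ((- 1) ^ n / fact n * matpow \<Lambda> (Suc n) $ i $ j)"
        by (simp add: diffs_def)
      then show ?thesis
        by (simp add: matpow_Suc matrix_matrix_mult_def sum_distrib_left sum_negf mult_ac)
    qed
    have "(\<lambda>n. diffs (?c i j) n * t ^ n) sums (\<Sum>k\<in>UNIV. - \<Lambda> $ i $ k * chain_semigroup \<Lambda> t $ k $ j)"
      unfolding d by (intro sums_sum sums_mult chain_semigroup_sums)
    then show ?thesis by (simp add: sums_iff matrix_matrix_mult_def sum_negf)
  qed
  ultimately show ?thesis by (simp add: s)
qed

text \<open>For a solution of \<open>G' = - \<Lambda> G\<close>, the function \<open>s \<mapsto> e\<^bsup>-(t-s)\<Lambda>\<^esup> G s\<close> has derivative zero,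
  so that its values at \<open>0\<close> and \<open>t\<close> agree.\<close>

lemma backward_equation_unique:
  fixes G :: "'m::finite \<Rightarrow> real \<Rightarrow> real"
  assumes deriv: "\<And>i t. 0 \<le> t \<Longrightarrow>
      (G i has_real_derivative - (\<Sum>k\<in>UNIV. \<Lambda> $ i $ k * G k t)) (at t within {0..})"
    and t: "0 \<le> t"
  shows "G i t = (\<Sum>k\<in>UNIV. chain_semigroup \<Lambda> t $ i $ k * G k 0)"
proof -
  define \<Phi> where "\<Phi> s = (\<Sum>k\<in>UNIV. chain_semigroup \<Lambda> (t - s) $ i $ k * G k s)" for s
  have "(\<Phi> has_real_derivative 0) (at s within {0..t})" if s: "s \<in> {0..t}" for s
  proof -
    have E: "((\<lambda>s. chain_semigroup \<Lambda> (t - s) $ i $ k) has_real_derivative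
        (\<Lambda> ** chain_semigroup \<Lambda> (t - s)) $ i $ k) (at s within {0..t})" for k
    proof -
      have "((\<lambda>s. t - s) has_real_derivative - 1) (at s within {0..t})"
        by (auto intro!: derivative_eq_intros)
      from DERIV_chain2[OF chain_semigroup_deriv this] show ?thesis by simp
    qed
    have G: "(G k has_real_derivative - (\<Sum>l\<in>UNIV. \<Lambda> $ k $ l * G l s)) (at s within {0..t})" for k
      using s by (intro DERIV_subset[OF deriv]) auto
    have "(\<Phi> has_real_derivative (\<Sum>k\<in>UNIV. (\<Lambda> ** chain_semigroup \<Lambda> (t - s)) $ i $ k * G k s +
        chain_semigroup \<Lambda> (t - s) $ i $ k * - (\<Sum>l\<in>UNIV. \<Lambda> $ k $ l * G l s))) (at s within {0..t})"
      unfolding \<Phi>_def by (auto intro!: derivative_eq_intros E G simp: algebra_simps sum.distrib sum_negf sum_subtractf)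
    moreover have "(\<Sum>k\<in>UNIV. chain_semigroup \<Lambda> (t - s) $ i $ k * (\<Sum>l\<in>UNIV. \<Lambda> $ k $ l * G l s)) =
        (\<Sum>k\<in>UNIV. (chain_semigroup \<Lambda> (t - s) ** \<Lambda>) $ i $ k * G k s)"
      unfolding matrix_matrix_mult_def
      by (simp add: sum_distrib_left sum_distrib_right mult.assoc) (rule sum.swap)
    ultimately show ?thesis by (simp add: sum.distrib sum_negf sum_subtractf chain_semigroup_commute)
  qed
  then obtain c where "\<forall>s\<in>{0..t}. \<Phi> s = c"
    using has_field_derivative_zero_constant[of "{0..t}" \<Phi>] by auto
  then have "\<Phi> t = \<Phi> 0" using t by auto
  then show ?thesis by (simp add: \<Phi>_def mat_def if_distrib[of "\<lambda>x. x * _"] cong: if_cong)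
qed

text \<open>The derivative at \<open>0\<close>, made uniform over the finitely many entries.\<close>

lemma chain_semigroup_expansion:
  assumes "0 < e"
  obtains d where "0 < d" "\<And>h i j. 0 \<le> h \<Longrightarrow> h \<le> d \<Longrightarrow>
     \<bar>chain_semigroup \<Lambda> h $ i $ j - mat 1 $ i $ j + h * \<Lambda> $ i $ j\<bar> \<le> e * h"
proof -
  have "\<exists>d>0. \<forall>h. 0 \<le> h \<and> h \<le> d \<longrightarrow> \<bar>chain_semigroup \<Lambda> h $ i $ j - mat 1 $ i $ j + h * \<Lambda> $ i $ j\<bar> \<le> e * h" for i j
  proof -
    have "((\<lambda>h. (chain_semigroup \<Lambda> h $ i $ j - mat 1 $ i $ j) / h) \<longlongrightarrow> - \<Lambda> $ i $ j) (at 0)"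
      using chain_semigroup_deriv[of \<Lambda> i j 0] by (simp add: DERIV_def)
    from tendstoD[OF this assms] obtain d where d: "d > 0"
      "\<And>h. h \<noteq> 0 \<Longrightarrow> dist h 0 < d \<Longrightarrow> dist ((chain_semigroup \<Lambda> h $ i $ j - mat 1 $ i $ j) / h) (- \<Lambda> $ i $ j) < e"
      unfolding eventually_at by auto
    have "\<bar>chain_semigroup \<Lambda> h $ i $ j - mat 1 $ i $ j + h * \<Lambda> $ i $ j\<bar> \<le> e * h" if "0 \<le> h" "h \<le> d/2" for h
    proof (cases "h = 0")
      case False
      then have h: "h > 0" "dist h 0 < d" using that d(1) by auto
      have "\<bar>(chain_semigroup \<Lambda> h $ i $ j - mat 1 $ i $ j) / h + \<Lambda> $ i $ j\<bar> < e"
        using d(2)[of h] h by (simp add: dist_real_def)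
      then have "\<bar>(chain_semigroup \<Lambda> h $ i $ j - mat 1 $ i $ j) / h + \<Lambda> $ i $ j\<bar> * h \<le> e * h"
        using h by (intro mult_right_mono) auto
      moreover have "\<bar>(chain_semigroup \<Lambda> h $ i $ j - mat 1 $ i $ j) / h + \<Lambda> $ i $ j\<bar> * h =
         \<bar>((chain_semigroup \<Lambda> h $ i $ j - mat 1 $ i $ j) / h + \<Lambda> $ i $ j) * h\<bar>"
        using h by (simp add: abs_mult)
      ultimately show ?thesis using h by (simp add: field_simps)
    qed simp
    then show ?thesis using d(1) by (intro exI[of _ "d/2"]) auto
  qed
  then obtain d where d: "\<And>i j. d i j > 0" "\<And>i j h. 0 \<le> h \<Longrightarrow> h \<le> d i j \<Longrightarrow>
     \<bar>chain_semigroup \<Lambda> h $ i $ j - mat 1 $ i $ j + h * \<Lambda> $ i $ j\<bar> \<le> e * h"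
    by metis
  define D where "D = Min (range (\<lambda>(i, j). d i j))"
  have "D > 0" unfolding D_def using d(1) by (subst Min_gr_iff) auto
  moreover have "D \<le> d i j" for i j unfolding D_def by (intro Min_le) auto
  ultimately show thesis using d(2) by (intro that[of D]) (blast intro: order_trans)+
qed

section \<open>Cadlag paths\<close>

lemma cadlag_pathsD:
  assumes "\<omega> \<in> cadlag_paths X"
  shows "0 \<le> t \<Longrightarrow> limitin X \<omega> (\<omega> t) (at_right t)" "0 < t \<Longrightarrow> \<exists>l. limitin X \<omega> l (at_left t)"
  using assms unfolding cadlag_paths_def by blast+

lemma index_path_right_constant:
  assumes "\<omega> \<in> index_paths" "0 \<le> t"
  shows "eventually (\<lambda>s. \<omega> s = \<omega> t) (at_right t)"
  using assms by (auto simp: cadlag_paths_def limitin_def dest!: spec[of _ "{\<omega> t}"])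

lemma cadlag_right_limit:
  fixes \<xi> :: "real \<Rightarrow> 'a::topological_space"
  assumes "\<xi> \<in> cadlag_paths euclidean" "0 \<le> t"
  shows "(\<xi> \<longlongrightarrow> \<xi> t) (at_right t)"
  using assms by (auto simp: cadlag_paths_def)

lemma cadlag_left_limit:
  fixes \<xi> :: "real \<Rightarrow> 'a::topological_space"
  assumes "\<xi> \<in> cadlag_paths euclidean" "0 < t"
  obtains l where "(\<xi> \<longlongrightarrow> l) (at_left t)"
  using assms by (auto simp: cadlag_paths_def)

lemma cadlag_negative: "\<xi> \<in> cadlag_paths X \<Longrightarrow> s < 0 \<Longrightarrow> \<xi> s = undefined"
  by (auto simp: cadlag_paths_def extensional_def)

lemma space_path_algebra [simp]: "space (path_algebra X T) = cadlag_paths X"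
  by (simp add: path_algebra_def space_measure_of_conv)

lemma sets_path_algebra:
  "sets (path_algebra X T) =
     sigma_sets (cadlag_paths X) {{\<omega> \<in> cadlag_paths X. \<omega> s \<in> A} | s A. s \<in> T \<and> openin X A}"
  unfolding path_algebra_def by (rule sets_measure_of) auto

lemma path_algebra_generator:
  "s \<in> T \<Longrightarrow> openin X A \<Longrightarrow> {\<omega> \<in> cadlag_paths X. \<omega> s \<in> A} \<in> sets (path_algebra X T)"
  unfolding sets_path_algebra by (intro sigma_sets.Basic) auto

lemma path_algebra_mono: "S \<subseteq> T \<Longrightarrow> sets (path_algebra X S) \<subseteq> sets (path_algebra X T)"
  unfolding sets_path_algebra by (rule sigma_sets_mono') auto

lemma measurable_path_algebra_mono:
  "S \<subseteq> T \<Longrightarrow> f \<in> measurable (path_algebra X S) N \<Longrightarrow> f \<in> measurable (path_algebra X T) N"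
  using path_algebra_mono[of S T X] by (auto simp: measurable_def)

lemma measurable_index_eval:
  "s \<in> T \<Longrightarrow> (\<lambda>\<omega>. \<omega> s) \<in> measurable (index_algebra T :: (real \<Rightarrow> 'm::finite) measure) (count_space UNIV)"
  using path_algebra_generator[of s T "discrete_topology (UNIV :: 'm set)" "{a}" for a]
  by (auto simp: measurable_count_space_eq2 vimage_def Int_def conj_commute)

lemma measurable_cadlag_eval:
  "s \<in> T \<Longrightarrow> (\<lambda>\<xi>. \<xi> s) \<in> borel_measurable (path_algebra (euclidean :: 'a::topological_space topology) T)"
  using path_algebra_generator[of s T "euclidean :: 'a topology"]
  by (intro borel_measurableI) (auto simp: vimage_def Int_def conj_commute)

lemma measurable_into_index_algebra:
  fixes f :: "'w \<Rightarrow> real \<Rightarrow> 'm::finite"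
  assumes "\<And>w. w \<in> space M \<Longrightarrow> f w \<in> index_paths"
    and "\<And>s. s \<in> T \<Longrightarrow> (\<lambda>w. f w s) \<in> measurable M (count_space UNIV)"
  shows "f \<in> measurable M (index_algebra T)"
  unfolding path_algebra_def
proof (rule measurable_measure_of)
  show "f \<in> space M \<rightarrow> index_paths" using assms(1) by auto
  fix y assume "y \<in> {{\<omega> \<in> index_paths. \<omega> s \<in> A} |s A. s \<in> T \<and> openin (discrete_topology UNIV) (A :: 'm set)}"
  then obtain s A where y: "y = {\<omega> \<in> index_paths. \<omega> s \<in> A}" "s \<in> T" by blast
  have "f -` y \<inter> space M = (\<lambda>w. f w s) -` A \<inter> space M" using assms(1) y by auto
  also have "\<dots> \<in> sets M" by (rule measurable_sets[OF assms(2)[OF y(2)]]) auto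
  finally show "f -` y \<inter> space M \<in> sets M" .
qed auto

subsection \<open>Freezing and shifting a path\<close>

text \<open>The frozen path carries the information available at time \<open>t\<close>, the shifted path what comes
  afterwards.  The restriction to nonnegative times keeps both in the extensional path space.\<close>

definition frozen_at :: "real \<Rightarrow> (real \<Rightarrow> 'a) \<Rightarrow> real \<Rightarrow> 'a" where
  "frozen_at t \<omega> = restrict (\<lambda>s. \<omega> (min s t)) {0..}"

definition shifted_by :: "real \<Rightarrow> (real \<Rightarrow> 'a) \<Rightarrow> real \<Rightarrow> 'a" where
  "shifted_by t \<omega> = restrict (\<lambda>s. \<omega> (t + s)) {0..}"

lemma frozen_at_cadlag:
  assumes \<omega>: "\<omega> \<in> cadlag_paths X" and t: "0 \<le> t"
  shows "frozen_at t \<omega> \<in> cadlag_paths X"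
proof -
  have right: "limitin X \<omega> (\<omega> s) (at_right s)" if "0 \<le> s" for s
    by (rule cadlag_pathsD(1)[OF \<omega> that])
  have top: "\<omega> s \<in> topspace X" if "0 \<le> s" for s using right[OF that] by (rule limitin_topspace)
  have "limitin X (frozen_at t \<omega>) (frozen_at t \<omega> s) (at_right s)" if s: "0 \<le> s" for s
  proof (cases "s < t")
    case True
    have "eventually (\<lambda>r. \<omega> r = frozen_at t \<omega> r) (at_right s)"
      unfolding eventually_at_right_field using True s by (auto simp: frozen_at_def intro!: exI[of _ t])
    from limitin_transform_eventually[OF this right[OF s]] show ?thesis
      using True s by (simp add: frozen_at_def[of t \<omega>, THEN fun_cong, of s])
  next
    case False
    have "eventually (\<lambda>r. \<omega> t = frozen_at t \<omega> r) (at_right s)"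
      unfolding eventually_at_right_field using False s by (auto simp: frozen_at_def min_def intro!: exI[of _ "s+1"])
    from limitin_transform_eventually[OF this, of X "\<omega> t"]
    have "limitin X (frozen_at t \<omega>) (\<omega> t) (at_right s)" using t top by simp
    moreover have "frozen_at t \<omega> s = \<omega> t" using False s by (simp add: frozen_at_def)
    ultimately show ?thesis by simp
  qed
  moreover have "\<exists>l. limitin X (frozen_at t \<omega>) l (at_left s)" if s: "0 < s" for s
  proof (cases "s \<le> t")
    case True
    have ev: "eventually (\<lambda>r. \<omega> r = frozen_at t \<omega> r) (at_left s)"
      unfolding eventually_at_left_field using True s by (auto simp: frozen_at_def intro!: exI[of _ 0])
    obtain l where "limitin X \<omega> l (at_left s)" using cadlag_pathsD(2)[OF \<omega> s] ..
    from limitin_transform_eventually[OF ev this] show ?thesis ..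
  next
    case False
    have "eventually (\<lambda>r. \<omega> t = frozen_at t \<omega> r) (at_left s)"
      unfolding eventually_at_left_field using False t by (auto simp: frozen_at_def min_def intro!: exI[of _ t])
    from limitin_transform_eventually[OF this, of X "\<omega> t"] show ?thesis using t top by auto
  qed
  moreover have "frozen_at t \<omega> \<in> extensional {0..}" by (simp add: frozen_at_def)
  ultimately show ?thesis unfolding cadlag_paths_def by blast
qed

lemma shifted_by_cadlag:
  assumes \<omega>: "\<omega> \<in> cadlag_paths X" and t: "0 \<le> t"
  shows "shifted_by t \<omega> \<in> cadlag_paths X"
proof -
  have R: "eventually P (at_right s) \<longleftrightarrow> eventually (\<lambda>r. P (r - t)) (at_right (t + s))" for P and s :: real
    using filtermap_at_right_shift[of t "t + s"] by (metis add_diff_cancel_left' eventually_filtermap)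
  have L: "eventually P (at_left s) \<longleftrightarrow> eventually (\<lambda>r. P (r - t)) (at_left (t + s))" for P and s :: real
    using filtermap_at_left_shift[of t "t + s"] by (metis add_diff_cancel_left' eventually_filtermap)
  have "limitin X (shifted_by t \<omega>) (shifted_by t \<omega> s) (at_right s)" if s: "0 \<le> s" for s
  proof -
    have "limitin X \<omega> (\<omega> (t + s)) (at_right (t + s))" using s t by (intro cadlag_pathsD[OF \<omega>]) simp
    moreover have "eventually (\<lambda>r. r > t + s) (at_right (t + s))" by (rule eventually_at_right_less)
    moreover have "shifted_by t \<omega> (r - t) = \<omega> r" "shifted_by t \<omega> s = \<omega> (t + s)" if "r > t + s" for r
      using s that by (simp_all add: shifted_by_def)
    ultimately show ?thesis
      unfolding limitin_def R[of _ s] by (smt (verit) eventually_elim2 gt_ex)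
  qed
  moreover have "\<exists>l. limitin X (shifted_by t \<omega>) l (at_left s)" if s: "0 < s" for s
  proof -
    have "t + s > 0" using s t by simp
    then obtain l where "limitin X \<omega> l (at_left (t + s))" using cadlag_pathsD(2)[OF \<omega>] by blast
    moreover have "eventually (\<lambda>r. r > t) (at_left (t + s))"
      unfolding eventually_at_left_field using s by (intro exI[of _ t]) auto
    moreover have "shifted_by t \<omega> (r - t) = \<omega> r" if "r > t" for r
      using that by (simp add: shifted_by_def)
    ultimately have "limitin X (shifted_by t \<omega>) l (at_left s)"
      unfolding limitin_def L[of _ s] by (smt (verit) eventually_elim2)
    then show ?thesis ..
  qed
  moreover have "shifted_by t \<omega> \<in> extensional {0..}" by (simp add: shifted_by_def)
  ultimately show ?thesis unfolding cadlag_paths_def by blast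
qed

lemma measurable_frozen_at:
  assumes "0 \<le> t"
  shows "frozen_at t \<in> measurable (index_algebra {0..t}) (index_algebra {0..} :: (real \<Rightarrow> 'm::finite) measure)"
proof (rule measurable_into_index_algebra)
  show "frozen_at t w \<in> index_paths" if "w \<in> space (index_algebra {0..t})" for w :: "real \<Rightarrow> 'm"
    using that assms by (intro frozen_at_cadlag) simp_all
  show "(\<lambda>w. frozen_at t w s) \<in> measurable (index_algebra {0..t} :: (real \<Rightarrow> 'm) measure) (count_space UNIV)"
    if "s \<in> {0..}" for s
  proof -
    have eq: "(\<lambda>w :: real \<Rightarrow> 'm. frozen_at t w s) = (\<lambda>w. w (min s t))" using that by (simp add: frozen_at_def fun_eq_iff)
    show ?thesis unfolding eq by (rule measurable_index_eval) (use that assms in auto)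
  qed
qed

lemma measurable_shifted_by:
  assumes "0 \<le> t"
  shows "shifted_by t \<in> measurable (index_algebra {0..}) (index_algebra {0..} :: (real \<Rightarrow> 'm::finite) measure)"
proof (rule measurable_into_index_algebra)
  show "shifted_by t w \<in> index_paths" if "w \<in> space (index_algebra {0..})" for w :: "real \<Rightarrow> 'm"
    using that assms by (intro shifted_by_cadlag) simp_all
  show "(\<lambda>w. shifted_by t w s) \<in> measurable (index_algebra {0..} :: (real \<Rightarrow> 'm) measure) (count_space UNIV)"
    if "s \<in> {0..}" for s
  proof -
    have eq: "(\<lambda>w :: real \<Rightarrow> 'm. shifted_by t w s) = (\<lambda>w. w (t + s))" using that by (simp add: shifted_by_def fun_eq_iff)
    show ?thesis unfolding eq by (rule measurable_index_eval) (use that assms in auto)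
  qed
qed

subsection \<open>Joint measurability\<close>

text \<open>A right-continuous process is the pointwise limit of its values at the next dyadic time, and
  each of these approximations takes the values of countably many fixed-time evaluations.\<close>

lemma right_continuous_joint_measurable:
  fixes f :: "'w \<Rightarrow> real \<Rightarrow> 'b::metric_space"
  assumes meas: "\<And>s. 0 \<le> s \<Longrightarrow> (\<lambda>w. f w s) \<in> borel_measurable M"
    and right: "\<And>w s. w \<in> space M \<Longrightarrow> 0 \<le> s \<Longrightarrow> (f w \<longlongrightarrow> f w s) (at_right s)"
    and neg: "\<And>w s. w \<in> space M \<Longrightarrow> s < 0 \<Longrightarrow> f w s = c"
  shows "(\<lambda>(w, s). f w s) \<in> borel_measurable (M \<Otimes>\<^sub>M borel)"
proof -
  \<comment> \<open>The first point of the dyadic grid strictly after \<open>s\<close>.\<close>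
  define r where "r n s = (real (nat \<lfloor>2 ^ n * s\<rfloor>) + 1) / 2 ^ n" for n and s :: real
  define F where "F n z = (if snd z < 0 then c else f (fst z) (r n (snd z)))" for n and z :: "'w \<times> real"
  have "F n \<in> borel_measurable (M \<Otimes>\<^sub>M borel)" for n
  proof -
    have [measurable]: "(\<lambda>w. f w ((real k + 1) / 2 ^ n)) \<in> borel_measurable M" for k
      by (intro meas) auto
    have "(\<lambda>z. f (fst z) ((real (nat \<lfloor>(2::real) ^ n * snd z\<rfloor>) + 1) / 2 ^ n)) \<in> borel_measurable (M \<Otimes>\<^sub>M borel)"
      by (rule measurable_compose_countable[of "\<lambda>k z. f (fst z) ((real k + 1) / 2 ^ n)"]) measurable
    then show ?thesis unfolding F_def r_def by measurable
  qed
  moreover have "(\<lambda>n. F n z) \<longlonglongrightarrow> f (fst z) (snd z)" if z: "z \<in> space (M \<Otimes>\<^sub>M borel)" for z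
  proof (cases "snd z < 0")
    case True
    then show ?thesis using neg[of "fst z" "snd z"] z by (auto simp: F_def space_pair_measure)
  next
    case False
    let ?s = "snd z"
    have r: "r n ?s > ?s" "r n ?s \<le> ?s + (1/2) ^ n" for n
    proof -
      have e: "real (nat \<lfloor>2 ^ n * ?s\<rfloor>) = of_int \<lfloor>2 ^ n * ?s\<rfloor>" using False by simp
      have "2 ^ n * ?s < of_int \<lfloor>2 ^ n * ?s\<rfloor> + 1" "of_int \<lfloor>2 ^ n * ?s\<rfloor> \<le> 2 ^ n * ?s" by linarith+
      then show "r n ?s > ?s" "r n ?s \<le> ?s + (1/2) ^ n" unfolding r_def e by (simp_all add: field_simps)
    qed
    have "(\<lambda>n. ?s + (1/2) ^ n) \<longlonglongrightarrow> ?s + 0" by (intro tendsto_intros LIMSEQ_power_zero) auto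
    then have "(\<lambda>n. r n ?s) \<longlonglongrightarrow> ?s"
      by (intro tendsto_sandwich[of "\<lambda>_. ?s" "\<lambda>n. r n ?s" sequentially "\<lambda>n. ?s + (1/2) ^ n" ?s])
         (auto intro!: always_eventually less_imp_le[OF r(1)] r(2))
    then have "filterlim (\<lambda>n. r n ?s) (at_right ?s) sequentially"
      unfolding filterlim_at using r(1) by (auto intro!: always_eventually simp: less_imp_neq[symmetric] less_le)
    from filterlim_compose[OF right this] False z show ?thesis
      by (auto simp: F_def space_pair_measure not_less)
  qed
  ultimately have "(\<lambda>z. f (fst z) (snd z)) \<in> borel_measurable (M \<Otimes>\<^sub>M borel)"
    by (rule borel_measurable_LIMSEQ_metric)
  then show ?thesis by (simp add: case_prod_unfold)
qed

text \<open>The state space carries no metric, so the approximation is applied to the indicators of the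
  single states.\<close>

lemma measurable_index_eval_joint:
  "(\<lambda>(\<omega>, s). \<omega> s) \<in> measurable (index_algebra {0..} \<Otimes>\<^sub>M borel :: ((real \<Rightarrow> 'm::finite) \<times> real) measure) (count_space UNIV)"
proof -
  let ?M = "index_algebra {0..} :: (real \<Rightarrow> 'm) measure"
  have "(\<lambda>(\<omega>, s). indicator {j} (\<omega> s) :: real) \<in> borel_measurable (?M \<Otimes>\<^sub>M borel)" for j :: 'm
  proof (rule right_continuous_joint_measurable[where c="indicator {j} undefined"])
    fix s :: real assume "0 \<le> s"
    then have [measurable]: "(\<lambda>\<omega>. \<omega> s) \<in> measurable ?M (count_space UNIV)" by (intro measurable_index_eval) auto
    show "(\<lambda>\<omega>. indicator {j} (\<omega> s) :: real) \<in> borel_measurable ?M" by measurable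
  next
    fix \<omega> :: "real \<Rightarrow> 'm" and s :: real assume "\<omega> \<in> space ?M" "0 \<le> s"
    then have "eventually (\<lambda>r. \<omega> r = \<omega> s) (at_right s)" by (intro index_path_right_constant) auto
    then show "((\<lambda>r. indicator {j} (\<omega> r) :: real) \<longlongrightarrow> indicator {j} (\<omega> s)) (at_right s)"
      by (intro tendsto_eventually) (auto elim!: eventually_mono)
  qed (auto simp: cadlag_negative)
  note ind = measurable_sets[OF this, of "{1}"]
  have "(\<lambda>(\<omega>, s). \<omega> s) -` {j} \<inter> space (?M \<Otimes>\<^sub>M borel) \<in> sets (?M \<Otimes>\<^sub>M borel)" for j :: 'm
  proof -
    have eq: "(\<lambda>(\<omega>, s). \<omega> s) -` {j} = (\<lambda>(\<omega>, s). indicator {j} (\<omega> s) :: real) -` {1}"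
      by (auto simp: indicator_def split: if_splits)
    show ?thesis unfolding eq by (rule ind) simp
  qed
  then show ?thesis by (intro measurable_count_space_eq2[THEN iffD2]) auto
qed

lemma measurable_cadlag_eval_joint:
  "(\<lambda>(\<xi>, s). \<xi> s) \<in> borel_measurable (path_algebra (euclidean :: 'a::metric_space topology) {0..} \<Otimes>\<^sub>M borel)"
  by (rule right_continuous_joint_measurable[where c=undefined])
     (auto intro: measurable_cadlag_eval cadlag_right_limit cadlag_negative)

subsection \<open>The primitive of a cadlag path\<close>

lemma cadlag_measurable:
  fixes \<xi> :: "real \<Rightarrow> 'a::metric_space"
  assumes "\<xi> \<in> cadlag_paths euclidean"
  shows "\<xi> \<in> borel_measurable borel"
proof -
  have "(\<lambda>s. (\<xi>, s)) \<in> measurable borel (path_algebra euclidean {0..} \<Otimes>\<^sub>M borel)"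
    using assms by (intro measurable_Pair) auto
  from measurable_compose[OF this measurable_cadlag_eval_joint] show ?thesis by simp
qed

text \<open>The one-sided limits bound the path near every time, and bounds on adjacent intervals combine;
  Bolzano's bisection principle yields a bound on the whole interval.\<close>

lemma cadlag_bounded:
  fixes \<xi> :: "real \<Rightarrow> 'a::real_normed_vector"
  assumes \<xi>: "\<xi> \<in> cadlag_paths euclidean" and t: "0 \<le> t"
  obtains B where "\<And>s. s \<in> {0..t} \<Longrightarrow> norm (\<xi> s) \<le> B"
proof -
  define P where "P a b \<longleftrightarrow> (0 \<le> a \<longrightarrow> (\<exists>B. \<forall>s\<in>{a..b}. norm (\<xi> s) \<le> B))" for a b
  have "P 0 t"
  proof (rule Bolzano[where P=P, OF t])
    fix a b c assume "P a b" "P b c" "a \<le> b" "b \<le> c"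
    then show "P a c" unfolding P_def
    proof (intro impI)
      assume "0 \<le> a" "0 \<le> a \<longrightarrow> (\<exists>B. \<forall>s\<in>{a..b}. norm (\<xi> s) \<le> B)" "0 \<le> b \<longrightarrow> (\<exists>B. \<forall>s\<in>{b..c}. norm (\<xi> s) \<le> B)"
      moreover have "0 \<le> b" using \<open>0 \<le> a\<close> \<open>a \<le> b\<close> by simp
      ultimately obtain B1 B2 where B: "\<forall>s\<in>{a..b}. norm (\<xi> s) \<le> B1" "\<forall>s\<in>{b..c}. norm (\<xi> s) \<le> B2" by auto
      have "norm (\<xi> s) \<le> max B1 B2" if "s \<in> {a..c}" for s
        using that B by (cases "s \<le> b") (auto intro: max.coboundedI1 max.coboundedI2)
      then show "\<exists>B. \<forall>s\<in>{a..c}. norm (\<xi> s) \<le> B" by blast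
    qed
  next
    fix x assume x: "0 \<le> x" "x \<le> t"
    have "eventually (\<lambda>s. dist (\<xi> s) (\<xi> x) < 1) (at_right x)"
      using tendstoD[OF cadlag_right_limit[OF \<xi> x(1)], of 1] by simp
    then obtain d1 where d1: "d1 > x" "\<And>s. x < s \<Longrightarrow> s < d1 \<Longrightarrow> dist (\<xi> s) (\<xi> x) < 1"
      unfolding eventually_at_right_field by blast
    have "\<exists>l d2. d2 < x \<and> (\<forall>s. d2 < s \<and> s < x \<and> 0 \<le> s \<longrightarrow> dist (\<xi> s) l < 1)"
    proof (cases "x = 0")
      case True then show ?thesis by (intro exI[of _ 0] exI[of _ "-1"]) auto
    next
      case False
      then obtain l where "(\<xi> \<longlongrightarrow> l) (at_left x)" using cadlag_left_limit[OF \<xi>, of x] x by auto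
      from tendstoD[OF this, of 1] show ?thesis unfolding eventually_at_left_field by fastforce
    qed
    then obtain l d2 where d2: "d2 < x" "\<And>s. d2 < s \<Longrightarrow> s < x \<Longrightarrow> 0 \<le> s \<Longrightarrow> dist (\<xi> s) l < 1" by blast
    define B where "B = norm (\<xi> x) + norm l + 1"
    have nb: "norm (\<xi> s) \<le> B" if "0 \<le> s" "d2 < s" "s < d1" for s
    proof -
      consider "s < x" | "s = x" | "s > x" by linarith
      then show ?thesis
      proof cases
        case 1 then show ?thesis using d2(2)[of s] that norm_triangle_sub[of "\<xi> s" l] norm_ge_zero[of "\<xi> x"]
          unfolding B_def dist_norm by linarith
      next
        case 2 then show ?thesis by (simp add: B_def)
      next
        case 3 then show ?thesis using d1(2)[of s] that norm_triangle_sub[of "\<xi> s" "\<xi> x"] norm_ge_zero[of l]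
          unfolding B_def dist_norm by linarith
      qed
    qed
    show "\<exists>d>0. \<forall>a b. a \<le> x \<and> x \<le> b \<and> b - a < d \<longrightarrow> P a b"
      unfolding P_def using d1 d2
      by (intro exI[of _ "min (d1 - x) (x - d2)"]) (auto intro!: exI[of _ B] nb)
  qed
  then obtain B where "\<forall>s\<in>{0..t}. norm (\<xi> s) \<le> B" by (auto simp: P_def)
  then show thesis by (intro that) blast
qed

lemma cadlag_set_integrable:
  fixes \<xi> :: "real \<Rightarrow> 'a::euclidean_space"
  assumes \<xi>: "\<xi> \<in> cadlag_paths euclidean" and "0 \<le> a"
  shows "set_integrable lborel {a..b} \<xi>"
proof -
  have "0 \<le> max 0 b" by simp
  then obtain B where B: "\<And>s. s \<in> {0..max 0 b} \<Longrightarrow> norm (\<xi> s) \<le> B" using cadlag_bounded[OF \<xi>] by blast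
  have "\<xi> \<in> borel_measurable borel" by (rule cadlag_measurable[OF \<xi>])
  then show ?thesis unfolding set_integrable_def
    using B assms(2) by (intro integrableI_bounded_set_indicator[where B=B]) (auto simp: emeasure_lborel_Icc_eq)
qed

definition primitive :: "(real \<Rightarrow> real^'n) \<Rightarrow> real \<Rightarrow> real^'n::finite" where
  "primitive \<xi> t = (LBINT s:{0..t}. \<xi> s)"

context
  fixes \<xi> :: "real \<Rightarrow> real^'n::finite"
  assumes \<xi>: "\<xi> \<in> cadlag_paths euclidean"
begin

lemma cadlag_integrable_on: "0 \<le> a \<Longrightarrow> \<xi> integrable_on {a..b}"
  by (intro set_borel_integral_eq_integral cadlag_set_integrable \<xi>)

lemma primitive_eq: "primitive \<xi> t = integral {0..t} \<xi>"
  unfolding primitive_def by (intro set_borel_integral_eq_integral cadlag_set_integrable \<xi>) auto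

lemma primitive_add: "0 \<le> s \<Longrightarrow> s \<le> t \<Longrightarrow> primitive \<xi> t = primitive \<xi> s + integral {s..t} \<xi>"
  by (simp add: primitive_eq Henstock_Kurzweil_Integration.integral_combine cadlag_integrable_on)

lemma primitive_lipschitz:
  assumes "0 \<le> s" "s \<le> t" "\<And>r. r \<in> {s..t} \<Longrightarrow> norm (\<xi> r) \<le> B"
  shows "norm (primitive \<xi> t - primitive \<xi> s) \<le> B * (t - s)"
proof -
  have "norm (\<xi> s) \<le> B" using assms by auto
  then have "B \<ge> 0" using norm_ge_zero[of "\<xi> s"] by linarith
  then have "norm (integral {s..t} \<xi>) \<le> B * measure lborel (cbox s t)"
    using integrable_bound[of B \<xi> s t] assms cadlag_integrable_on[of s t] by simp
  then show ?thesis using assms(2) by (simp add: primitive_add[OF assms(1,2)])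
qed

text \<open>At a jump of the velocity the primitive has this one-sided derivative and no two-sided one.\<close>

lemma primitive_right_derivative:
  assumes "0 \<le> s"
  shows "(primitive \<xi> has_vector_derivative \<xi> s) (at s within {s..})"
proof -
  have c: "continuous (at s within {s..s+1} - {}) \<xi>"
  proof -
    have "(\<xi> \<longlongrightarrow> \<xi> s) (at_right s)" by (rule cadlag_right_limit[OF \<xi> assms])
    then have "(\<xi> \<longlongrightarrow> \<xi> s) (at s within {s..s+1})"
      by (simp add: at_within_Icc_at_right)
    then show ?thesis by (simp add: continuous_within)
  qed
  have mem: "s \<in> {s..s+1} - {}" by simp
  note integral_has_vector_derivative_continuous_at[OF cadlag_integrable_on[OF assms] mem finite.emptyI c]
  note d = has_vector_derivative_add[OF has_vector_derivative_const[of "primitive \<xi> s"] this[unfolded Diff_empty]]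
  have "(primitive \<xi> has_vector_derivative 0 + \<xi> s) (at s within {s..s+1})"
  proof (rule has_vector_derivative_transform[OF _ _ d])
    show "primitive \<xi> r = primitive \<xi> s + integral {s..r} \<xi>" if "r \<in> {s..s+1}" for r
      using that by (intro primitive_add assms) simp
  qed simp
  moreover have "at s within {s..s+1} = at s within {s..}"
    by (rule at_within_nhd[of _ "{..<s+1}"]) auto
  ultimately show ?thesis by simp
qed

lemma primitive_continuous: "continuous_on {0..t} (primitive \<xi>)"
  unfolding primitive_eq[abs_def] by (intro indefinite_integral_continuous_1 cadlag_integrable_on) simp

lemma primitive_0: "primitive \<xi> 0 = 0"
  by (simp add: primitive_eq)

end

section \<open>Subsolutions along curves\<close>

text \<open>A smooth periodic substitute for the squared distance on the torus, to be used as
  penalisation, and its gradient.\<close>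

definition torus_penalty :: "real^'n::finite \<Rightarrow> real" where
  "torus_penalty w = (\<Sum>j\<in>UNIV. 1 - cos (2 * pi * w $ j))"

definition torus_penalty_grad :: "real^'n::finite \<Rightarrow> real^'n" where
  "torus_penalty_grad w = (\<chi> j. 2 * pi * sin (2 * pi * w $ j))"

lemma torus_penalty_nonneg: "0 \<le> torus_penalty w"
  unfolding torus_penalty_def by (intro sum_nonneg) simp

lemma torus_penalty_eq_0: 
  assumes "torus_penalty (v - w) = 0" shows "to_torus v = to_torus w"
proof -
  have "cos (2 * pi * (v - w) $ j) = 1" for j
    using assms unfolding torus_penalty_def by (subst (asm) sum_nonneg_eq_0_iff) auto
  then have "\<exists>n::int. 2 * pi * (v - w) $ j = n * 2 * pi" for j by (simp only: cos_one_2pi_int)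
  then have "\<exists>n::int. v $ j - w $ j = n" for j by simp
  then show ?thesis unfolding to_torus_eq_iff torus_rel_def by (metis Ints_of_int)
qed

lemma torus_periodic:
  assumes "torus_rel v w"
  shows "torus_penalty (v - c) = torus_penalty (w - c)"
    and "torus_penalty_grad (v - c) = torus_penalty_grad (w - c)"
proof -
  have "\<exists>n::int. 2 * pi * (v - c) $ j = 2 * pi * (w - c) $ j + 2 * pi * n" for j
  proof -
    obtain n :: int where "v $ j - w $ j = n" using assms by (auto simp: torus_rel_def elim!: Ints_cases)
    then have "v $ j = w $ j + n" by simp
    then show ?thesis by (intro exI[of _ n]) (simp add: algebra_simps)
  qed
  then obtain n :: "'a \<Rightarrow> int" where n: "2 * pi * (v - c) $ j = 2 * pi * (w - c) $ j + 2 * pi * n j" for j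
    by metis
  have "cos (2 * pi * (v - c) $ j) = cos (2 * pi * (w - c) $ j)"
       "sin (2 * pi * (v - c) $ j) = sin (2 * pi * (w - c) $ j)" for j
    unfolding n by (simp_all add: cos_add sin_add cos_int_2pin sin_int_2pin)
  then show "torus_penalty (v - c) = torus_penalty (w - c)"
    and "torus_penalty_grad (v - c) = torus_penalty_grad (w - c)"
    unfolding torus_penalty_def torus_penalty_grad_def by simp_all
qed

lemma torus_penalty_deriv:
  "(torus_penalty has_derivative (\<lambda>h. h \<bullet> torus_penalty_grad w)) (at w within S)"
proof -
  have "(torus_penalty has_derivative (\<lambda>h. \<Sum>j\<in>UNIV. sin (2 * pi * w $ j) * (2 * pi * h $ j))) (at w within S)"
    unfolding torus_penalty_def[abs_def]
    by (rule derivative_eq_intros refl bounded_linear.has_derivative[OF bounded_linear_vec_nth] | simp add: mult_ac)+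
  moreover have "(\<Sum>j\<in>UNIV. sin (2 * pi * w $ j) * (2 * pi * h $ j)) = h \<bullet> torus_penalty_grad w" for h
    by (simp add: inner_vec_def torus_penalty_grad_def mult_ac)
  ultimately show ?thesis by simp
qed

lemma torus_penalty_continuous: "continuous_on S torus_penalty"
  unfolding torus_penalty_def[abs_def] by (intro continuous_intros)

lemma torus_penalty_grad_continuous: "continuous_on S torus_penalty_grad"
  unfolding torus_penalty_grad_def[abs_def] by (intro continuous_intros)

text \<open>By periodicity the values do not depend on the representatives, hence the smoothness of the
  trigonometric functions is inherited by the function on the torus.\<close>

lemma C1_torus_penalty:
  "C1_torus (\<lambda>z. k * torus_penalty (rep_torus z - c)) (\<lambda>z. k *\<^sub>R torus_penalty_grad (rep_torus z - c))"
proof -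
  have r: "torus_rel (rep_torus (to_torus v)) v" for v :: "real^'a"
    using to_torus_rep[of "to_torus v"] by (simp add: to_torus_eq_iff)
  note p = torus_periodic[OF r]
  have "((\<lambda>w. k * torus_penalty (w - c)) has_derivative (\<lambda>h. h \<bullet> (k *\<^sub>R torus_penalty_grad (z - c)))) (at z)" for z
  proof -
    have "((\<lambda>w. torus_penalty (w - c)) has_derivative (\<lambda>h. h \<bullet> torus_penalty_grad (z - c))) (at z)"
      by (rule has_derivative_compose[OF _ torus_penalty_deriv, where f="\<lambda>w. w - c", simplified])
         (auto intro!: derivative_eq_intros)
    then show ?thesis using has_derivative_mult_right[of _ _ _ k] by fastforce
  qed
  moreover have "continuous_on UNIV (\<lambda>v. k *\<^sub>R torus_penalty_grad (v - c))"
    by (intro continuous_intros continuous_on_compose2[OF torus_penalty_grad_continuous[of UNIV]]) auto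
  ultimately show ?thesis
    by (simp add: C1_torus_def continuous_torus_iff p gderiv_def)
qed

text \<open>The penalty serves as test function at a maximum point found in Euclidean space.\<close>

lemma (in hamiltonian) subsolution_penalty:
  assumes sub: "subsolution H \<Lambda> \<alpha> u"
    and max: "\<And>y. u (to_torus y) $ i - k * torus_penalty (y - c) \<le> u (to_torus y0) $ i - k * torus_penalty (y0 - c)"
  shows "H i (to_torus y0) (k *\<^sub>R torus_penalty_grad (y0 - c)) \<le> \<alpha> - \<Lambda> $ i \<bullet> u (to_torus y0)"
proof -
  have r: "torus_rel (rep_torus (to_torus v)) v" for v :: "real^'n"
    using to_torus_rep[of "to_torus v"] by (simp add: to_torus_eq_iff)
  note p = torus_periodic[OF r]
  have "u y $ i - k * torus_penalty (rep_torus y - c) \<le>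
      u (to_torus y0) $ i - k * torus_penalty (rep_torus (to_torus y0) - c)" for y
    using max[of "rep_torus y"] by (simp add: to_torus_rep p)
  then have "H i (to_torus y0) (k *\<^sub>R torus_penalty_grad (rep_torus (to_torus y0) - c)) + \<Lambda> $ i \<bullet> u (to_torus y0) \<le> \<alpha>"
    using sub C1_torus_penalty[of k c] unfolding subsolution_def by blast
  then show ?thesis by (simp add: p)
qed

text \<open>Doubling of variables: the state \<open>y\<close> and the time \<open>s\<close> of the curve are decoupled, with a
  penalisation forcing \<open>y\<close> towards the curve.  At a maximum, the viscosity inequality in \<open>y\<close> and
  the right derivative in \<open>s\<close> are linked through Fenchel's inequality.  The derivatives fall on the
  penalty alone, which is how a merely continuous subsolution and a velocity with jumps are
  handled.\<close>

lemma (in hamiltonian) subsolution_along_curve_const: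
  fixes u :: "'n torus \<Rightarrow> real^'m"
  assumes sub: "subsolution H \<Lambda> \<alpha> u"
    and \<xi>: "\<xi> \<in> cadlag_paths euclidean"
    and ab: "0 \<le> a" "a \<le> b"
    and R: "\<And>s. s \<in> {a..b} \<Longrightarrow> norm (\<xi> s) \<le> R"
    and c: "\<And>s. a \<le> s \<Longrightarrow> s < b \<Longrightarrow> lagrangian H i (to_torus (x0 + primitive \<xi> s)) (- \<xi> s)
        + (\<alpha> - \<Lambda> $ i \<bullet> u (to_torus (x0 + primitive \<xi> s))) \<le> c"
  shows "u (to_torus (x0 + primitive \<xi> a)) $ i - u (to_torus (x0 + primitive \<xi> b)) $ i \<le> c * (b - a)"
proof (rule ccontr)
  define \<gamma> where "\<gamma> s = x0 + primitive \<xi> s" for s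
  define w where "w y = u (to_torus y) $ i" for y
  define f where "f y = \<alpha> - \<Lambda> $ i \<bullet> u (to_torus y)" for y
  define L where "L y q = lagrangian H i (to_torus y) q" for y q
  assume "\<not> u (to_torus (x0 + primitive \<xi> a)) $ i - u (to_torus (x0 + primitive \<xi> b)) $ i \<le> c * (b - a)"
  then have neg: "w (\<gamma> a) - w (\<gamma> b) > c * (b - a)" by (simp add: w_def \<gamma>_def)
  then have "a \<noteq> b" by auto
  with ab have ab': "a < b" by simp
  have "(w (\<gamma> a) - w (\<gamma> b)) / (b - a) > c" using neg ab' by (simp add: pos_less_divide_eq)
  \<comment> \<open>The gap between \<open>c\<close> and \<open>c'\<close> is what the limit of the maximum points contradicts.\<close>
  then obtain c' where c': "c < c'" "c' < (w (\<gamma> a) - w (\<gamma> b)) / (b - a)" using dense by blast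
  then have neg': "w (\<gamma> a) > w (\<gamma> b) + c' * (b - a)" using ab' by (simp add: pos_less_divide_eq)
  have uc: "continuous_on UNIV (\<lambda>y. u (to_torus y))"
    using sub unfolding subsolution_def continuous_torus_iff by blast
  have wc: "continuous_on S w" for S unfolding w_def
    by (intro continuous_intros continuous_on_subset[OF uc]) auto
  have fc: "continuous_on S f" for S unfolding f_def
    by (intro continuous_intros continuous_on_subset[OF uc]) auto
  have \<gamma>c: "continuous_on {a..b} \<gamma>" unfolding \<gamma>_def
    using primitive_continuous[OF \<xi>, of b] ab
    by (intro continuous_intros) (auto elim: continuous_on_subset)
  define \<Phi> where "\<Phi> k z = w (fst z) + c' * (snd z - a) - real (Suc k) * torus_penalty (fst z - \<gamma> (snd z))"
    for k and z :: "(real^'n) \<times> real"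
  \<comment> \<open>Periodicity in \<open>y\<close> reduces the search for a maximum to a compact set.\<close>
  have \<Phi>_per: "\<Phi> k (y, s) = \<Phi> k (y', s)" if "to_torus y = to_torus y'" for k y y' s
    using that torus_periodic(1)[of y y' "\<gamma> s", folded to_torus_eq_iff] by (simp add: \<Phi>_def w_def)
  have "\<exists>y s. y \<in> cbox 0 1 \<and> s \<in> {a..b} \<and> (\<forall>y' s'. s' \<in> {a..b} \<longrightarrow> \<Phi> k (y', s') \<le> \<Phi> k (y, s))" for k
  proof -
    let ?K = "cbox (0 :: real^'n) 1 \<times> {a..b}"
    have "continuous_on ?K (\<Phi> k)"
      unfolding \<Phi>_def
      by (intro continuous_intros continuous_on_compose2[OF wc[of UNIV]]
          continuous_on_compose2[OF torus_penalty_continuous[of UNIV]] continuous_on_compose2[OF \<gamma>c]) auto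
    moreover have "compact ?K" by (intro compact_Times compact_cbox compact_Icc)
    moreover have "(0, a) \<in> ?K" using ab by (auto simp: mem_box_cart)
    ultimately obtain z where z: "z \<in> ?K" "\<And>z'. z' \<in> ?K \<Longrightarrow> \<Phi> k z' \<le> \<Phi> k z"
      using continuous_attains_sup[of ?K "\<Phi> k"] by blast
    have "\<Phi> k (y', s') \<le> \<Phi> k z" if "s' \<in> {a..b}" for y' s'
    proof -
      obtain v where "v \<in> cbox 0 1" "to_torus v = to_torus y'" by (rule torus_lift_in_cube)
      then show ?thesis using z(2)[of "(v, s')"] \<Phi>_per[of v y' k s'] that by auto
    qed
    then show ?thesis using z(1) by (intro exI[of _ "fst z"] exI[of _ "snd z"]) auto
  qed
  then obtain Y S where YS: "\<And>k. Y k \<in> cbox 0 1" "\<And>k. S k \<in> {a..b}"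
    and mx: "\<And>k y' s'. s' \<in> {a..b} \<Longrightarrow> \<Phi> k (y', s') \<le> \<Phi> k (Y k, S k)"
    by metis
  \<comment> \<open>Maximality in \<open>y\<close> gives the viscosity inequality with the gradient \<open>p\<close>, maximality in \<open>s\<close>
     gives \<open>c' + p \<bullet> \<xi> (S k) \<le> 0\<close>, and Fenchel's inequality eliminates \<open>p\<close>.\<close>
  have key: "c' \<le> f (Y k) + L (Y k) (- \<xi> (S k))" if Sk: "S k < b" for k
  proof -
    define p where "p = real (Suc k) *\<^sub>R torus_penalty_grad (Y k - \<gamma> (S k))"
    have S0: "0 \<le> S k" "a \<le> S k" using YS(2)[of k] ab by auto
    have "H i (to_torus (Y k)) p \<le> f (Y k)"
      unfolding p_def f_def using mx[OF YS(2), of k _ k]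
      by (intro subsolution_penalty[OF sub]) (simp add: \<Phi>_def w_def)
    moreover have "c' + p \<bullet> \<xi> (S k) \<le> 0"
    proof (rule ccontr)
      assume "\<not> c' + p \<bullet> \<xi> (S k) \<le> 0"
      then have pos: "0 < c' + p \<bullet> \<xi> (S k)" by simp
      define h where "h t = c' * (t - a) - real (Suc k) * torus_penalty (Y k - \<gamma> t)" for t
      have "((\<lambda>t. Y k - \<gamma> t) has_derivative (\<lambda>t. t *\<^sub>R (- \<xi> (S k)))) (at (S k) within {S k..})"
        using primitive_right_derivative[OF \<xi> S0(1)] unfolding \<gamma>_def has_vector_derivative_def
        by (auto intro!: derivative_eq_intros)
      from has_derivative_compose[OF this torus_penalty_deriv]
      have "((\<lambda>t. torus_penalty (Y k - \<gamma> t)) has_derivative (\<lambda>t. (t *\<^sub>R (- \<xi> (S k))) \<bullet> torus_penalty_grad (Y k - \<gamma> (S k)))) (at (S k) within {S k..})" .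
      then have "((\<lambda>t. torus_penalty (Y k - \<gamma> t)) has_real_derivative - (\<xi> (S k) \<bullet> torus_penalty_grad (Y k - \<gamma> (S k)))) (at (S k) within {S k..})"
        unfolding has_field_derivative_def by (rule has_derivative_eq_rhs) (simp add: fun_eq_iff)
      then have "(h has_real_derivative (c' + p \<bullet> \<xi> (S k))) (at (S k) within {S k..})"
        unfolding h_def p_def by (auto intro!: derivative_eq_intros simp: inner_commute)
      from has_real_derivative_pos_inc_right[OF this pos]
      obtain d where d: "d > 0" "\<And>e. e > 0 \<Longrightarrow> e < d \<Longrightarrow> h (S k) < h (S k + e)" by auto
      define e where "e = min (d / 2) (b - S k)"
      have e: "e > 0" "e < d" "S k + e \<in> {a..b}" using d(1) Sk S0 by (auto simp: e_def)
      have "\<Phi> k (Y k, S k + e) \<le> \<Phi> k (Y k, S k)" by (rule mx[OF e(3)])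
      then have "h (S k + e) \<le> h (S k)" by (simp add: \<Phi>_def h_def)
      then show False using d(2)[OF e(1,2)] by simp
    qed
    moreover have "p \<bullet> (- \<xi> (S k)) \<le> H i (to_torus (Y k)) p + L (Y k) (- \<xi> (S k))"
      unfolding L_def by (rule fenchel)
    ultimately show ?thesis by simp
  qed
  \<comment> \<open>Along a subsequence the maximum points converge, and so do the velocities there, although
     their limit \<open>q\<close> may differ from the velocity at the limit time.\<close>
  define Kc where "Kc = (cbox (0 :: real^'n) 1 \<times> {a..b}) \<times> cball (0 :: real^'n) R"
  have comp: "compact Kc" unfolding Kc_def by (rule compact_Times[OF compact_Times[OF compact_cbox compact_Icc] compact_cball])
  have mem: "\<forall>k. ((Y k, S k), \<xi> (S k)) \<in> Kc" using YS R by (auto simp: Kc_def)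
  obtain l r where lr: "l \<in> Kc" "strict_mono r" "((\<lambda>k. ((Y k, S k), \<xi> (S k))) \<circ> r) \<longlonglongrightarrow> l"
    by (rule seq_compactE[OF compact_imp_seq_compact[OF comp] mem])
  obtain y s q where l: "l = ((y, s), q)" by (metis surj_pair)
  have lim: "(\<lambda>k. Y (r k)) \<longlonglongrightarrow> y" "(\<lambda>k. S (r k)) \<longlonglongrightarrow> s" "(\<lambda>k. \<xi> (S (r k))) \<longlonglongrightarrow> q"
    using tendsto_fst[OF tendsto_fst[OF lr(3)]] tendsto_snd[OF tendsto_fst[OF lr(3)]] tendsto_snd[OF lr(3)]
    by (simp_all add: l comp_def)
  have s: "s \<in> {a..b}" using lr(1) by (simp add: l Kc_def)
  have \<gamma>lim: "(\<lambda>k. \<gamma> (S (r k))) \<longlonglongrightarrow> \<gamma> s"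
    by (rule continuous_on_tendsto_compose[OF \<gamma>c lim(2) s]) (simp add: YS(2) always_eventually del: atLeastAtMost_iff)
  have wlim: "(\<lambda>k. w (Y (r k)) + c' * (S (r k) - a)) \<longlonglongrightarrow> w y + c' * (s - a)"
    by (intro tendsto_intros lim continuous_on_tendsto_compose[OF wc[of UNIV] lim(1)]) auto
  have start: "real (Suc k) * torus_penalty (Y k - \<gamma> (S k)) \<le> w (Y k) + c' * (S k - a) - w (\<gamma> a)" for k
    using mx[of a k "\<gamma> a"] ab by (simp add: \<Phi>_def torus_penalty_def)
  have "torus_penalty (y - \<gamma> s) = 0"
  proof -
    have "(\<lambda>k. torus_penalty (Y (r k) - \<gamma> (S (r k)))) \<longlonglongrightarrow> torus_penalty (y - \<gamma> s)"
      by (intro continuous_on_tendsto_compose[OF torus_penalty_continuous[of UNIV]] tendsto_intros lim \<gamma>lim) auto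
    moreover have "(\<lambda>k. torus_penalty (Y (r k) - \<gamma> (S (r k)))) \<longlonglongrightarrow> 0"
    proof (rule tendsto_sandwich[of "\<lambda>_. 0"])
      have "(\<lambda>k. inverse (real (Suc (r k)))) \<longlonglongrightarrow> 0"
        using LIMSEQ_subseq_LIMSEQ[OF LIMSEQ_inverse_real_of_nat lr(2)] by (simp add: comp_def)
      from tendsto_mult[OF tendsto_diff[OF wlim tendsto_const] this]
      show "(\<lambda>k. (w (Y (r k)) + c' * (S (r k) - a) - w (\<gamma> a)) * inverse (real (Suc (r k)))) \<longlonglongrightarrow> 0" by simp
      show "\<forall>\<^sub>F k in sequentially. torus_penalty (Y (r k) - \<gamma> (S (r k))) \<le> (w (Y (r k)) + c' * (S (r k) - a) - w (\<gamma> a)) * inverse (real (Suc (r k)))"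
        using start by (intro always_eventually allI) (simp add: field_simps)
    qed (auto simp: torus_penalty_nonneg)
    ultimately show ?thesis by (rule LIMSEQ_unique)
  qed
  then have same: "to_torus y = to_torus (\<gamma> s)" by (rule torus_penalty_eq_0)
  \<comment> \<open>By the choice of \<open>c'\<close> the limit time is not \<open>b\<close>, so that \<open>key\<close> applies along the subsequence.\<close>
  have "w (\<gamma> a) \<le> w y + c' * (s - a)"
  proof (rule LIMSEQ_le_const[OF wlim])
    have "w (\<gamma> a) \<le> w (Y k) + c' * (S k - a)" for k
      using start[of k] torus_penalty_nonneg[of "Y k - \<gamma> (S k)"] by (smt (verit) mult_nonneg_nonneg of_nat_0_le_iff)
    then show "\<exists>N. \<forall>n\<ge>N. w (\<gamma> a) \<le> w (Y (r n)) + c' * (S (r n) - a)" by blast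
  qed
  then have "s \<noteq> b" using neg' same by (auto simp: w_def)
  then have "s < b" using s by auto
  from order_tendstoD(2)[OF lim(2) this] have ev: "\<forall>\<^sub>F k in sequentially. S (r k) < b" .
  have Lc: "continuous_on UNIV (\<lambda>z. L (fst z) (snd z))"
    using lagrangian_continuous[of i] by (simp add: L_def case_prod_unfold)
  have joint: "(\<lambda>k. f (X k) + L (X k) (- \<xi> (S (r k)))) \<longlonglongrightarrow> f x + L x (- q)" if "X \<longlonglongrightarrow> x" for X x
  proof -
    have "(\<lambda>k. L (fst (X k, - \<xi> (S (r k)))) (snd (X k, - \<xi> (S (r k))))) \<longlonglongrightarrow> L (fst (x, - q)) (snd (x, - q))"
      by (rule continuous_on_tendsto_compose[OF Lc]) (auto intro!: tendsto_intros that lim)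
    then show ?thesis
      by (intro tendsto_intros continuous_on_tendsto_compose[OF fc[of UNIV] that]) auto
  qed
  note 1 = joint[OF lim(1)] and 2 = joint[OF \<gamma>lim]
  have "c' \<le> f y + L y (- q)"
    by (rule tendsto_lowerbound[OF 1]) (use ev key in \<open>auto elim!: eventually_mono\<close>)
  moreover have "f (\<gamma> s) + L (\<gamma> s) (- q) \<le> c"
  proof (rule tendsto_upperbound[OF 2])
    show "\<forall>\<^sub>F k in sequentially. f (\<gamma> (S (r k))) + L (\<gamma> (S (r k))) (- \<xi> (S (r k))) \<le> c"
      using ev
    proof (rule eventually_mono)
      fix k assume "S (r k) < b"
      then show "f (\<gamma> (S (r k))) + L (\<gamma> (S (r k))) (- \<xi> (S (r k))) \<le> c"
        using c[of "S (r k)"] YS(2)[of "r k"] by (simp add: f_def L_def \<gamma>_def)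
    qed
  qed simp
  ultimately show False using same c'(1) by (simp add: f_def L_def)
qed

text \<open>On small intervals the running cost is nearly constant to the left and to the right of
  every time, because the velocity is cadlag; Bolzano's bisection principle glues the resulting
  estimates together.\<close>

lemma (in hamiltonian) subsolution_along_curve:
  fixes u :: "'n torus \<Rightarrow> real^'m" and x0 :: "real^'n" and i :: 'm
  assumes sub: "subsolution H \<Lambda> \<alpha> u"
    and \<xi>: "\<xi> \<in> cadlag_paths euclidean"
    and t: "0 \<le> t0" "t0 \<le> t1"
  defines "F \<equiv> \<lambda>s. lagrangian H i (to_torus (x0 + primitive \<xi> s)) (- \<xi> s)
        + (\<alpha> - \<Lambda> $ i \<bullet> u (to_torus (x0 + primitive \<xi> s)))"
  shows "set_integrable lborel {t0..t1} F"
    and "u (to_torus (x0 + primitive \<xi> t0)) $ i - u (to_torus (x0 + primitive \<xi> t1)) $ i \<le> (LBINT s:{t0..t1}. F s)"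
proof -
  define \<gamma> where "\<gamma> s = x0 + primitive \<xi> s" for s
  define w where "w s = u (to_torus (\<gamma> s)) $ i" for s
  have uc: "continuous_on UNIV (\<lambda>y. u (to_torus y))"
    using sub unfolding subsolution_def continuous_torus_iff by blast
  define G where "G z = lagrangian H i (to_torus (fst z)) (- snd z) + (\<alpha> - \<Lambda> $ i \<bullet> u (to_torus (fst z)))"
    for z :: "(real^'n) \<times> (real^'n)"
  have Gc: "continuous_on UNIV G"
    unfolding G_def
    by (intro continuous_intros continuous_on_compose2[OF uc]
        continuous_on_compose2[OF lagrangian_continuous[unfolded case_prod_unfold],
          where f="\<lambda>z. (fst z, - snd z)", simplified]) auto
  have FG: "F s = G (\<gamma> s, \<xi> s)" for s by (simp add: F_def G_def \<gamma>_def)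
  have \<gamma>c: "continuous_on {0..b} \<gamma>" for b unfolding \<gamma>_def
    by (intro continuous_intros primitive_continuous[OF \<xi>])
  have \<gamma>_right: "(\<gamma> \<longlongrightarrow> \<gamma> s) (at_right s)" if "0 \<le> s" for s
  proof -
    have "(\<gamma> \<longlongrightarrow> \<gamma> s) (at s within {0..s+1})" using \<gamma>c[of "s+1"] that by (simp add: continuous_on_def)
    then have "(\<gamma> \<longlongrightarrow> \<gamma> s) (at s within {s..s+1})" by (rule tendsto_within_subset) (use that in auto)
    then show ?thesis by (simp add: at_within_Icc_at_right)
  qed
  have \<gamma>_left: "(\<gamma> \<longlongrightarrow> \<gamma> s) (at_left s)" if "0 < s" for s
  proof -
    have "(\<gamma> \<longlongrightarrow> \<gamma> s) (at s within {0..s})" using \<gamma>c[of s] that by (simp add: continuous_on_def)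
    then show ?thesis using that by (simp add: at_within_Icc_at_left)
  qed
  have F_right: "(F \<longlongrightarrow> F s) (at_right s)" if "0 \<le> s" for s
    unfolding FG[abs_def]
    by (intro continuous_on_tendsto_compose[OF Gc] tendsto_Pair \<gamma>_right cadlag_right_limit[OF \<xi>] that) auto
  have F_left: "\<exists>l. (F \<longlongrightarrow> l) (at_left s)" if s: "0 < s" for s
  proof -
    obtain q where "(\<xi> \<longlongrightarrow> q) (at_left s)" by (rule cadlag_left_limit[OF \<xi> s])
    then have "(F \<longlongrightarrow> G (\<gamma> s, q)) (at_left s)"
      unfolding FG[abs_def]
      by (intro continuous_on_tendsto_compose[OF Gc] tendsto_Pair \<gamma>_left s) auto
    then show ?thesis ..
  qed
  define F0 where "F0 = restrict F {0..}"
  have F0: "F0 \<in> cadlag_paths euclidean"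
  proof -
    have "(F0 \<longlongrightarrow> F0 s) (at_right s)" if "0 \<le> s" for s
    proof -
      have "eventually (\<lambda>r. F r = F0 r) (at_right s)"
        unfolding eventually_at_right_field using that by (auto simp: F0_def intro!: exI[of _ "s+1"])
      then show ?thesis using F_right[OF that] that by (simp add: F0_def[THEN fun_cong, of s] tendsto_cong)
    qed
    moreover have "\<exists>l. (F0 \<longlongrightarrow> l) (at_left s)" if "0 < s" for s
    proof -
      have "eventually (\<lambda>r. F r = F0 r) (at_left s)"
        unfolding eventually_at_left_field using that by (auto simp: F0_def intro!: exI[of _ 0])
      then show ?thesis using F_left[OF that] by (simp add: tendsto_cong)
    qed
    ultimately show ?thesis by (simp add: cadlag_paths_def F0_def)
  qed
  have int: "set_integrable lborel {a..b} F" if "0 \<le> a" for a b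
  proof -
    have "set_integrable lborel {a..b} F \<longleftrightarrow> set_integrable lborel {a..b} F0"
      using that by (intro set_integrable_cong) (auto simp: F0_def)
    then show ?thesis using cadlag_set_integrable[OF F0 that] by simp
  qed
  then have int': "F integrable_on {a..b}" if "0 \<le> a" for a b
    using that by (intro set_borel_integral_eq_integral) auto
  show "set_integrable lborel {t0..t1} F" using int t by simp
  obtain R where R: "\<And>s. s \<in> {0..t1} \<Longrightarrow> norm (\<xi> s) \<le> R"
    using cadlag_bounded[OF \<xi>, of t1] t by auto
  \<comment> \<open>If the cost is within \<open>e\<close> of a constant \<open>l\<close>, the bound with the constant cost \<open>l + e\<close> exceeds
     the integral of the cost by at most \<open>2 * e * (b - a)\<close>.\<close>
  have piece: "w a - w b \<le> integral {a..b} F + 2 * e * (b - a)"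
    if ab: "0 \<le> a" "a \<le> b" "b \<le> t1" and e: "\<And>s. a < s \<Longrightarrow> s < b \<Longrightarrow> \<bar>F s - l\<bar> \<le> e" and ea: "a < b \<Longrightarrow> F a \<le> l + e"
    for a b e l
  proof -
    have "w a - w b \<le> (l + e) * (b - a)"
      unfolding w_def \<gamma>_def
    proof (rule subsolution_along_curve_const[OF sub \<xi> ab(1,2)])
      show "norm (\<xi> s) \<le> R" if "s \<in> {a..b}" for s using that ab by (intro R) auto
      fix s assume s: "a \<le> s" "s < b"
      have "F s \<le> l + e" using e[of s] ea s by (cases "s = a") auto
      then show "lagrangian H i (to_torus (x0 + primitive \<xi> s)) (- \<xi> s)
        + (\<alpha> - \<Lambda> $ i \<bullet> u (to_torus (x0 + primitive \<xi> s))) \<le> l + e" by (simp add: F_def)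
    qed
    moreover have "(l - e) * (b - a) \<le> integral {a..b} F"
    proof -
      have "integral {a<..<b} (\<lambda>_. l - e) \<le> integral {a<..<b} F"
      proof (rule integral_le)
        show "(\<lambda>_. l - e) integrable_on {a<..<b}"
          unfolding integrable_on_open_interval_real by (rule integrable_const_ivl)
        show "F integrable_on {a<..<b}" 
          unfolding integrable_on_open_interval_real by (rule int'[OF ab(1)])
        show "l - e \<le> F s" if "s \<in> {a<..<b}" for s using e[of s] that by auto
      qed
      then show ?thesis using ab by (simp add: mult.commute flip: integral_open_interval_real)
    qed
    ultimately show ?thesis by (simp add: algebra_simps)
  qed
  have main: "w t0 - w t1 \<le> integral {t0..t1} F + e * (t1 - t0)" if e: "e > 0" for e
  proof -
    define P where "P a b \<longleftrightarrow> (0 \<le> a \<and> b \<le> t1 \<longrightarrow> w a - w b \<le> integral {a..b} F + e * (b - a))" for a b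
    have "P t0 t1"
    proof (rule Bolzano[where P=P, OF t(2)])
      fix a b c assume P: "P a b" "P b c" and abc: "a \<le> b" "b \<le> c"
      show "P a c" unfolding P_def
      proof
        assume "0 \<le> a \<and> c \<le> t1"
        moreover from this have "integral {a..b} F + integral {b..c} F = integral {a..c} F"
          by (intro Henstock_Kurzweil_Integration.integral_combine abc int') auto
        ultimately show "w a - w c \<le> integral {a..c} F + e * (c - a)"
          using P abc unfolding P_def by (auto simp: algebra_simps)
      qed
    next
      fix x assume x: "t0 \<le> x" "x \<le> t1"
      then have x0: "0 \<le> x" using t by simp
      have "eventually (\<lambda>s. dist (F s) (F x) < e / 2) (at_right x)"
        using tendstoD[OF F_right[OF x0], of "e/2"] e by simp
      then obtain d1 where d1: "d1 > x" "\<And>s. x < s \<Longrightarrow> s < d1 \<Longrightarrow> dist (F s) (F x) < e/2"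
        unfolding eventually_at_right_field by blast
      have "\<exists>l d2. d2 < x \<and> (\<forall>s. d2 < s \<and> s < x \<and> 0 \<le> s \<longrightarrow> dist (F s) l < e/2)"
      proof (cases "x = 0")
        case True then show ?thesis by (intro exI[of _ 0] exI[of _ "-1"]) auto
      next
        case False
        then obtain l where "(F \<longlongrightarrow> l) (at_left x)" using F_left[of x] x0 by auto
        from tendstoD[OF this, of "e/2"] e show ?thesis unfolding eventually_at_left_field by fastforce
      qed
      then obtain l d2 where d2: "d2 < x" "\<And>s. d2 < s \<Longrightarrow> s < x \<Longrightarrow> 0 \<le> s \<Longrightarrow> dist (F s) l < e/2" by blast
      have "P a b" if ab: "a \<le> x" "x \<le> b" "b - a < min (d1 - x) (x - d2)" for a b
        unfolding P_def
      proof
        assume b: "0 \<le> a \<and> b \<le> t1"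
        have "w a - w x \<le> integral {a..x} F + 2 * (e/2) * (x - a)"
        proof (rule piece)
          have "\<bar>F s - l\<bar> \<le> e/2" if "a \<le> s" "s < x" for s
            using d2(2)[of s] that ab b by (simp add: dist_real_def)
          then show "\<bar>F s - l\<bar> \<le> e/2" if "a < s" "s < x" for s using that by simp
          show "F a \<le> l + e/2" if "a < x"
            using d2(2)[of a] that ab b unfolding dist_real_def by linarith
        qed (use ab b x in auto)
        moreover have "w x - w b \<le> integral {x..b} F + 2 * (e/2) * (b - x)"
        proof (rule piece)
          show "\<bar>F s - F x\<bar> \<le> e/2" if "x < s" "s < b" for s
            using d1(2)[of s] that ab by (simp add: dist_real_def)
        qed (use ab b x0 e in auto)
        moreover have "integral {a..x} F + integral {x..b} F = integral {a..b} F"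
          using ab b by (intro Henstock_Kurzweil_Integration.integral_combine int') auto
        ultimately show "w a - w b \<le> integral {a..b} F + e * (b - a)" by (simp add: algebra_simps)
      qed
      then show "\<exists>d>0. \<forall>a b. a \<le> x \<and> x \<le> b \<and> b - a < d \<longrightarrow> P a b"
        using d1(1) d2(1) by (intro exI[of _ "min (d1 - x) (x - d2)"]) auto
    qed
    then show ?thesis using t by (simp add: P_def)
  qed
  have "w t0 - w t1 \<le> integral {t0..t1} F"
  proof (rule field_le_epsilon)
    fix e :: real assume e: "e > 0"
    define d where "d = e / (t1 - t0 + 1)"
    have "d > 0" "d * (t1 - t0) \<le> e" using e t by (auto simp: d_def field_simps)
    then show "w t0 - w t1 \<le> integral {t0..t1} F + e" using main[of d] by linarith
  qed
  then show "u (to_torus (x0 + primitive \<xi> t0)) $ i - u (to_torus (x0 + primitive \<xi> t1)) $ i \<le> (LBINT s:{t0..t1}. F s)"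
    using set_borel_integral_eq_integral(2)[OF int[of t0 t1]] t by (simp add: w_def \<gamma>_def)
qed

section \<open>Uniqueness of path laws\<close>

definition cylinder :: "real set \<Rightarrow> (real \<Rightarrow> 'm) \<Rightarrow> (real \<Rightarrow> 'm) set" where
  "cylinder F j = {\<omega> \<in> index_paths. \<forall>s\<in>F. \<omega> s = j s}"

text \<open>All these cylinders record the state at a fixed time \<open>t0\<close>, which is the present in the Markov
  property.  An event at another time is a finite union of such cylinders, over the states at \<open>t0\<close>,
  so that the generated algebra is the full one if \<open>t0 \<in> T\<close>.\<close>

definition cylinders :: "real set \<Rightarrow> real \<Rightarrow> (real \<Rightarrow> 'm) set set" where
  "cylinders T t0 = insert index_paths (insert {} {cylinder F j | F j. finite F \<and> F \<subseteq> T \<and> t0 \<in> F})"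

lemma cylinder_sets:
  assumes "finite F" "F \<subseteq> T" "F \<noteq> {}"
  shows "cylinder F j \<in> sets (index_algebra T :: (real \<Rightarrow> 'm::finite) measure)"
proof -
  have "cylinder F j = (\<Inter>s\<in>F. {\<omega> \<in> index_paths. \<omega> s \<in> {j s}})" using assms by (auto simp: cylinder_def)
  also have "\<dots> \<in> sets (index_algebra T)"
    using assms by (intro sets.finite_INT path_algebra_generator) auto
  finally show ?thesis .
qed

lemma cylinders_Int_stable: "Int_stable (cylinders T t0)"
proof -
  have "cylinder F j \<inter> cylinder G k \<in> cylinders T t0"
    if "finite F" "F \<subseteq> T" "t0 \<in> F" "finite G" "G \<subseteq> T" for F j G and k :: "real \<Rightarrow> 'm"
  proof (cases "\<exists>s\<in>F \<inter> G. j s \<noteq> k s")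
    case True
    then have "cylinder F j \<inter> cylinder G k = {}" by (auto simp: cylinder_def)
    then show ?thesis by (simp add: cylinders_def)
  next
    case False
    then have "cylinder F j \<inter> cylinder G k = cylinder (F \<union> G) (\<lambda>s. if s \<in> F then j s else k s)"
      by (auto simp: cylinder_def)
    then show ?thesis using that unfolding cylinders_def by blast
  qed
  note meet = this
  have sub: "A \<subseteq> index_paths" if "A \<in> cylinders T t0" for A :: "(real \<Rightarrow> 'a) set"
    using that by (auto simp: cylinders_def cylinder_def)
  show ?thesis
  proof (rule Int_stableI)
    fix A B :: "(real \<Rightarrow> 'a) set" assume AB: "A \<in> cylinders T t0" "B \<in> cylinders T t0"
    show "A \<inter> B \<in> cylinders T t0"
    proof (cases "A = index_paths \<or> A = {} \<or> B = index_paths \<or> B = {}")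
      case True
      then show ?thesis using AB sub by (metis Int_absorb1 Int_absorb2 Int_empty_left Int_empty_right)
    next
      case False
      with AB obtain F j where F: "A = cylinder F j" "finite F" "F \<subseteq> T" "t0 \<in> F"
        unfolding cylinders_def by blast
      from False AB obtain G k where G: "B = cylinder G k" "finite G" "G \<subseteq> T" "t0 \<in> G"
        unfolding cylinders_def by blast
      show ?thesis unfolding F G by (rule meet[OF F(2,3,4) G(2,3)])
    qed
  qed
qed

lemma sets_index_algebra_cylinders:
  assumes t0: "t0 \<in> T"
  shows "sets (index_algebra T :: (real \<Rightarrow> 'm::finite) measure) = sigma_sets index_paths (cylinders T t0)"
proof
  let ?E = "cylinders T t0 :: (real \<Rightarrow> 'm) set set"
  have sub: "?E \<subseteq> Pow index_paths" by (auto simp: cylinders_def cylinder_def)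
  interpret S: sigma_algebra index_paths "sigma_sets index_paths ?E"
    by (rule sigma_algebra_sigma_sets[OF sub])
  show "sets (index_algebra T) \<subseteq> sigma_sets index_paths ?E"
    unfolding sets_path_algebra
  proof (rule sigma_sets_mono)
    show "{{\<omega> \<in> index_paths. \<omega> s \<in> A} |s A. s \<in> T \<and> openin (discrete_topology UNIV) A} \<subseteq> sigma_sets index_paths ?E"
    proof clarify
      fix s and A :: "'m set" assume s: "s \<in> T"
      let ?c = "\<lambda>(a, b). cylinder {s, t0} (\<lambda>r. if r = s then a else b)"
      have "{\<omega> \<in> index_paths. \<omega> s \<in> A} = (\<Union>z\<in>A \<times> UNIV. ?c z)"
        by (auto simp: cylinder_def split: if_splits)
      also have "\<dots> \<in> sigma_sets index_paths ?E"
        using s t0 by (intro S.finite_UN) (auto simp: cylinders_def intro!: sigma_sets.Basic)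
      finally show "{\<omega> \<in> index_paths. \<omega> s \<in> A} \<in> sigma_sets index_paths ?E" .
    qed
  qed
  show "sigma_sets index_paths ?E \<subseteq> sets (index_algebra T)"
  proof -
    have "?E \<subseteq> sets (index_algebra T)"
      using sets.top[of "index_algebra T :: (real \<Rightarrow> 'm) measure"]
      by (auto simp: cylinders_def intro!: cylinder_sets)
    from sets.sigma_sets_subset[OF this] show ?thesis by simp
  qed
qed

text \<open>A cylinder carries a finite set of times, whereas a path law is prescribed along increasing
  sequences of times with indices from \<open>1\<close>.\<close>

lemma cylinder_enumerate:
  assumes F: "finite F" "F \<noteq> {}" "F \<subseteq> {0..}"
  obtains k :: nat and t :: "nat \<Rightarrow> real" where "k \<ge> 1" "0 \<le> t 1" "\<forall>l\<in>{1..<k}. t l < t (l + 1)" "t ` {1..k} = F" "t k = Max F"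
    "\<And>j. cylinder F j = {\<omega> \<in> index_paths. \<forall>l\<in>{1..k}. \<omega> (t l) = j (t l)}"
proof -
  define ts where "ts = sorted_list_of_set F"
  define k where "k = card F"
  define t where "t l = ts ! (l - 1)" for l
  have len: "length ts = k" "set ts = F" "sorted ts" "distinct ts" using F(1) by (auto simp: ts_def k_def)
  have k1: "k \<ge> 1" using F by (simp add: k_def Suc_leI card_gt_0_iff)
  have img: "t ` {1..k} = F"
  proof -
    have "F = (\<lambda>n. ts ! n) ` {..<k}" unfolding len(1)[symmetric] len(2)[symmetric] set_conv_nth by blast
    moreover have "{1..k} = Suc ` {..<k}" by (simp add: image_Suc_lessThan)
    ultimately show ?thesis by (simp add: image_image t_def)
  qed
  have inc: "\<forall>l\<in>{1..<k}. t l < t (l + 1)"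
  proof
    fix l assume l: "l \<in> {1..<k}"
    then have "ts ! (l - 1) \<le> ts ! l" using len by (intro sorted_nth_mono) auto
    moreover have "ts ! (l - 1) \<noteq> ts ! l" using len l by (subst nth_eq_iff_index_eq) auto
    ultimately show "t l < t (l + 1)" by (simp add: t_def)
  qed
  have "t k = Max F"
  proof (rule Max_eqI[symmetric])
    fix y assume "y \<in> F"
    then obtain n where "n < k" "y = ts ! n" using len(1,2) by (metis in_set_conv_nth)
    note n = this
    show "y \<le> t k" unfolding t_def n(2)
      by (rule sorted_nth_mono[OF len(3)]) (use n(1) len(1) in linarith)+
  qed (use F img k1 in auto)
  moreover have "0 \<le> t 1" using img k1 F(3) by force
  moreover have "cylinder F j = {\<omega> \<in> index_paths. \<forall>l\<in>{1..k}. \<omega> (t l) = j (t l)}" for j :: "real \<Rightarrow> 'a"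
    unfolding cylinder_def img[symmetric] by auto
  ultimately show thesis using k1 inc img by (intro that[of k t])
qed

text \<open>Cylinders are stable under intersection and generate the algebra, and their probabilities are
  prescribed.\<close>

lemma path_law_unique:
  fixes P Q :: "(real \<Rightarrow> 'm::finite) measure"
  assumes P: "is_path_law \<Lambda> a P" and Q: "is_path_law \<Lambda> a Q"
  shows "P = Q"
proof -
  interpret P: prob_space P using P by (simp add: is_path_law_def)
  interpret Q: prob_space Q using Q by (simp add: is_path_law_def)
  have sets: "sets P = sets (index_algebra {0..})" "sets Q = sets (index_algebra {0..})"
    using P Q by (simp_all add: is_path_law_def)
  have space: "space P = index_paths" "space Q = index_paths"
    using sets_eq_imp_space_eq[OF sets(1)] sets_eq_imp_space_eq[OF sets(2)] by simp_all
  have E: "sets (index_algebra {0..} :: (real \<Rightarrow> 'm) measure) = sigma_sets index_paths (cylinders {0..} 0)"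
    by (rule sets_index_algebra_cylinders) simp
  show ?thesis
  proof (rule measure_eqI_generator_eq[OF cylinders_Int_stable[of "{0..}" 0]])
    show "sets P = sigma_sets index_paths (cylinders {0..} 0)" "sets Q = sigma_sets index_paths (cylinders {0..} 0)"
      using sets E by simp_all
    show "cylinders {0..} 0 \<subseteq> Pow (index_paths :: (real \<Rightarrow> 'm) set)" by (auto simp: cylinders_def cylinder_def)
    show "range (\<lambda>_::nat. index_paths) \<subseteq> cylinders {0..} 0" by (auto simp: cylinders_def)
    fix X :: "(real \<Rightarrow> 'm) set" assume "X \<in> cylinders {0..} 0"
    then consider "X = {}" | "X = index_paths" | F j where "finite F" "F \<subseteq> {0..}" "0 \<in> F" "X = cylinder F j"
      by (auto simp: cylinders_def)
    then show "emeasure P X = emeasure Q X"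
    proof cases
      case 1 then show ?thesis by simp
    next
      case 2 then show ?thesis using P.emeasure_space_1 Q.emeasure_space_1 space by simp
    next
      case 3
      then have "F \<noteq> {}" by auto
      obtain k :: nat and t :: "nat \<Rightarrow> real" where kt: "k \<ge> 1" "0 \<le> t 1"
        "\<forall>l\<in>{1..<k}. t l < t (l + 1)" "t ` {1..k} = F" "t k = Max F"
        "\<And>j :: real \<Rightarrow> 'm. cylinder F j = {\<omega> \<in> index_paths. \<forall>l\<in>{1..k}. \<omega> (t l) = j (t l)}"
        by (rule cylinder_enumerate[OF 3(1) \<open>F \<noteq> {}\<close> 3(2)]) blast
      have "measure P X = measure Q X"
        unfolding 3(4) kt(6) using P Q kt(1-3) unfolding is_path_law_def by simp
      then show ?thesis by (simp add: P.emeasure_eq_measure Q.emeasure_eq_measure)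
    qed
  qed (auto simp: P.emeasure_eq_measure)
qed

section \<open>Construction of the chain from its jumps\<close>

text \<open>A jump is recorded as a waiting time together with a map of the state space.  The map is
  applied to the current state, so that one stream of jumps drives the chain from every initial
  state.\<close>

type_synonym 'm jumps = "(real \<times> ('m \<Rightarrow> 'm)) stream"

primrec jump_time :: "nat \<Rightarrow> 'm jumps \<Rightarrow> real" where
  "jump_time 0 s = 0"
| "jump_time (Suc n) s = fst (shd s) + jump_time n (stl s)"

primrec state_after :: "nat \<Rightarrow> 'm \<Rightarrow> 'm jumps \<Rightarrow> 'm" where
  "state_after 0 i s = i"
| "state_after (Suc n) i s = state_after n (snd (shd s) i) (stl s)"

definition non_explosive :: "'m jumps \<Rightarrow> bool" where
  "non_explosive s \<longleftrightarrow> (\<forall>k. 0 \<le> fst (s !! k)) \<and> (\<forall>K::nat. \<exists>n. real K < jump_time n s)"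

definition jumps_before :: "'m jumps \<Rightarrow> real \<Rightarrow> nat" where
  "jumps_before s t = (LEAST n. t < jump_time (Suc n) s)"

text \<open>On explosive streams, which will form a null set, the path is constant; in this way every
  stream yields a cadlag path.\<close>

definition chain_path :: "'m \<Rightarrow> 'm jumps \<Rightarrow> real \<Rightarrow> 'm" where
  "chain_path i s = restrict (\<lambda>t. if non_explosive s then state_after (jumps_before s t) i s else i) {0..}"

lemma jump_time_sum: "jump_time n s = (\<Sum>k<n. fst (s !! k))"
  by (induction n arbitrary: s) (simp_all add: sum.lessThan_Suc_shift del: sum.lessThan_Suc)

lemma jump_time_mono: "non_explosive s \<Longrightarrow> m \<le> n \<Longrightarrow> jump_time m s \<le> jump_time n s"
  unfolding jump_time_sum by (intro sum_mono2) (auto simp: non_explosive_def)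

lemma jump_time_unbounded:
  assumes "non_explosive s" shows "\<exists>n. t < jump_time n s"
proof -
  obtain K :: nat where "t < real K" using reals_Archimedean2 by blast
  then show ?thesis using assms unfolding non_explosive_def by (meson less_trans)
qed

lemma jump_time_unbounded_Suc:
  assumes "non_explosive s" shows "\<exists>n. t < jump_time (Suc n) s"
proof -
  obtain n where "t < jump_time n s" using jump_time_unbounded[OF assms] by blast
  then show ?thesis using jump_time_mono[OF assms, of n "Suc n"] by (intro exI[of _ n]) simp
qed

lemma jumps_before_eq:
  assumes s: "non_explosive s" and t: "jump_time n s \<le> t" "t < jump_time (Suc n) s"
  shows "jumps_before s t = n"
  unfolding jumps_before_def
proof (rule Least_equality[of "\<lambda>n. t < jump_time (Suc n) s", OF t(2)])
  fix m assume m: "t < jump_time (Suc m) s"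
  show "n \<le> m"
  proof (rule ccontr)
    assume "\<not> n \<le> m"
    then have "jump_time (Suc m) s \<le> jump_time n s" by (intro jump_time_mono[OF s]) simp
    then show False using m t by simp
  qed
qed

lemma chain_path_step:
  assumes s: "non_explosive s" and t: "jump_time n s \<le> t" "t < jump_time (Suc n) s" "0 \<le> t"
  shows "chain_path i s t = state_after n i s"
  using jumps_before_eq[OF s t(1,2)] s t by (simp add: chain_path_def)

lemma chain_path_index_paths: "chain_path i s \<in> (index_paths :: (real \<Rightarrow> 'm) set)"
proof (cases "non_explosive s")
  case s: True
  \<comment> \<open>The path is constant from \<open>t\<close> to the next jump time after \<open>t\<close>, and from the last jump time
     strictly before \<open>t\<close> up to \<open>t\<close>.\<close>
  have right: "limitin (discrete_topology UNIV) (chain_path i s) (chain_path i s t) (at_right t)" if t: "0 \<le> t" for t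
  proof -
    let ?n = "jumps_before s t"
    have up: "t < jump_time (Suc ?n) s"
      unfolding jumps_before_def by (rule LeastI_ex[OF jump_time_unbounded_Suc[OF s]])
    have low: "jump_time ?n s \<le> t"
    proof (cases ?n)
      case 0 then show ?thesis using t by simp
    next
      case (Suc m)
      then have "m < (LEAST n. t < jump_time (Suc n) s)" by (simp add: jumps_before_def)
      from not_less_Least[OF this] show ?thesis using Suc by simp
    qed
    have "\<forall>\<^sub>F r in at_right t. chain_path i s r = chain_path i s t"
      unfolding eventually_at_right_field
    proof (intro exI conjI allI impI)
      fix r assume "t < r" "r < jump_time (Suc ?n) s"
      then show "chain_path i s r = chain_path i s t"
        using chain_path_step[OF s, of ?n r i] chain_path_step[OF s low up t, of i] low t by simp
    qed (rule up)
    then show ?thesis by (auto simp: limitin_def elim: eventually_mono)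
  qed
  have left: "\<exists>l. limitin (discrete_topology UNIV) (chain_path i s) l (at_left t)" if t: "0 < t" for t
  proof -
    define n where "n = (LEAST n. t \<le> jump_time (Suc n) s)"
    have ex: "\<exists>n. t \<le> jump_time (Suc n) s" using jump_time_unbounded_Suc[OF s, of t] less_imp_le by blast
    have up: "t \<le> jump_time (Suc n) s"
      unfolding n_def by (rule LeastI_ex[OF ex])
    have low: "jump_time n s < t"
    proof (cases n)
      case 0 then show ?thesis using t by simp
    next
      case (Suc m)
      then have "m < (LEAST n. t \<le> jump_time (Suc n) s)" by (simp add: n_def)
      from not_less_Least[OF this] show ?thesis using Suc by simp
    qed
    have n0: "0 \<le> jump_time n s" using jump_time_mono[OF s, of 0 n] by simp
    have "\<forall>\<^sub>F r in at_left t. chain_path i s r = state_after n i s"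
      unfolding eventually_at_left_field
    proof (intro exI conjI allI impI)
      fix r assume "jump_time n s < r" "r < t"
      then show "chain_path i s r = state_after n i s"
        using chain_path_step[OF s, of n r i] n0 up by simp
    qed (rule low)
    then have "limitin (discrete_topology UNIV) (chain_path i s) (state_after n i s) (at_left t)"
      by (auto simp: limitin_def elim: eventually_mono)
    then show ?thesis ..
  qed
  have "chain_path i s \<in> extensional {0..}" by (simp add: chain_path_def)
  then show ?thesis unfolding cadlag_paths_def using left right by blast
next
  case False
  then have eq: "chain_path i s = restrict (\<lambda>_. i) {0..}" by (simp add: chain_path_def)
  have ev: "\<forall>\<^sub>F r in at_right t. chain_path i s r = i" if "0 \<le> t" for t
    unfolding eventually_at_right_field eq using that by (intro exI[of _ "t+1"]) auto
  have ev': "\<forall>\<^sub>F r in at_left t. chain_path i s r = i" if "0 < t" for t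
    unfolding eventually_at_left_field eq using that by (intro exI[of _ 0]) auto
  have "limitin (discrete_topology UNIV) (chain_path i s) (chain_path i s t) (at_right t)" if "0 \<le> t" for t
  proof -
    have "chain_path i s t = i" using that by (simp add: eq)
    then show ?thesis using ev[OF that] by (auto simp: limitin_def elim: eventually_mono)
  qed
  moreover have "limitin (discrete_topology UNIV) (chain_path i s) i (at_left t)" if "0 < t" for t
    using ev'[OF that] by (auto simp: limitin_def elim: eventually_mono)
  moreover have "chain_path i s \<in> extensional {0..}" by (simp add: chain_path_def)
  ultimately show ?thesis unfolding cadlag_paths_def by blast
qed

text \<open>The chain restarts afresh after its first jump.\<close>

lemma non_explosive_Stream:
  assumes "0 \<le> fst x" "non_explosive X"
  shows "non_explosive (x ## X)"
proof -
  have "0 \<le> fst ((x ## X) !! k)" for k using assms by (cases k) (auto simp: non_explosive_def)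
  moreover have "\<exists>n. real K < jump_time n (x ## X)" for K :: nat
  proof -
    obtain n where "real K < jump_time n X" using assms(2) by (auto simp: non_explosive_def)
    then show ?thesis using assms(1) by (intro exI[of _ "Suc n"]) simp
  qed
  ultimately show ?thesis by (simp add: non_explosive_def)
qed

lemma chain_path_Stream:
  assumes x: "0 \<le> fst x" and X: "non_explosive X" and t: "0 \<le> t"
  shows "chain_path i (x ## X) t = (if t < fst x then i else chain_path (snd x i) X (t - fst x))"
proof -
  note xX = non_explosive_Stream[OF x X]
  show ?thesis
  proof (cases "t < fst x")
    case True
    then show ?thesis using chain_path_step[OF xX, of 0 t i] t by simp
  next
    case False
    obtain n where "t < jump_time (Suc n) (x ## X)" using jump_time_unbounded_Suc[OF xX] by blast
    moreover have "\<not> t < jump_time (Suc 0) (x ## X)" using False by simp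
    ultimately have "(LEAST n. t < jump_time (Suc n) (x ## X)) = Suc (LEAST m. t < jump_time (Suc (Suc m)) (x ## X))"
      by (rule Least_Suc)
    also have "(LEAST m. t < jump_time (Suc (Suc m)) (x ## X)) = (LEAST m. t - fst x < jump_time (Suc m) X)"
      by (rule arg_cong[where f=Least]) (auto simp: fun_eq_iff)
    finally have "jumps_before (x ## X) t = Suc (jumps_before X (t - fst x))" by (simp only: jumps_before_def)
    then show ?thesis using False t xX X by (simp add: chain_path_def)
  qed
qed

lemma chain_path_shift_before:
  assumes x: "0 \<le> t" "t < fst x" and X: "non_explosive X"
  shows "shifted_by t (chain_path i (x ## X)) = chain_path i ((fst x - t, snd x) ## X)"
proof
  fix r show "shifted_by t (chain_path i (x ## X)) r = chain_path i ((fst x - t, snd x) ## X) r"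
    using assms chain_path_Stream[of x X "t + r" i] chain_path_Stream[of "(fst x - t, snd x)" X r i]
    by (auto simp: shifted_by_def chain_path_def[of _ _ , THEN fun_cong, of _ _ r] algebra_simps)
qed

lemma chain_path_shift_after:
  assumes x: "0 \<le> fst x" "fst x \<le> t" and X: "non_explosive X"
  shows "shifted_by t (chain_path i (x ## X)) = shifted_by (t - fst x) (chain_path (snd x i) X)"
proof
  fix r show "shifted_by t (chain_path i (x ## X)) r = shifted_by (t - fst x) (chain_path (snd x i) X) r"
    using assms chain_path_Stream[of x X "t + r" i]
    by (auto simp: shifted_by_def algebra_simps)
qed

lemma shifted_by_0: "\<omega> \<in> cadlag_paths X \<Longrightarrow> shifted_by 0 \<omega> = \<omega>"
  by (auto simp: shifted_by_def cadlag_paths_def extensional_def)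

subsection \<open>The probability space of jumps\<close>

text \<open>Uniformisation: jumps, some of which leave the state unchanged, occur at one common rate, large
  enough for \<open>1 - \<Lambda> / rate\<close> to be a stochastic matrix; the summand \<open>1\<close> keeps the rate positive.  A
  jump map draws a successor of every state independently, which makes the jumps an independent,
  identically distributed stream without reference to the current state.\<close>

definition jump_rate :: "real^'m^'m \<Rightarrow> real" where
  "jump_rate \<Lambda> = 1 + (\<Sum>i\<in>UNIV. \<bar>\<Lambda> $ i $ i\<bar>)"

definition jump_kernel :: "real^'m^'m \<Rightarrow> 'm::finite \<Rightarrow> 'm pmf" where
  "jump_kernel \<Lambda> i = embed_pmf (\<lambda>j. mat 1 $ i $ j - \<Lambda> $ i $ j / jump_rate \<Lambda>)"

definition jump_map :: "real^'m^'m \<Rightarrow> ('m::finite \<Rightarrow> 'm) pmf" where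
  "jump_map \<Lambda> = Pi_pmf UNIV undefined (jump_kernel \<Lambda>)"

definition waiting_time :: "real^'m::finite^'m \<Rightarrow> real measure" where
  "waiting_time \<Lambda> = density lborel (exponential_density (jump_rate \<Lambda>))"

definition jump_measure :: "real^'m::finite^'m \<Rightarrow> (real \<times> ('m \<Rightarrow> 'm)) measure" where
  "jump_measure \<Lambda> = waiting_time \<Lambda> \<Otimes>\<^sub>M measure_pmf (jump_map \<Lambda>)"

locale coupling =
  fixes \<Lambda> :: "real^'m::finite^'m"
  assumes coupling: "coupling_matrix \<Lambda>"
begin

lemma off_diagonal: "i \<noteq> j \<Longrightarrow> \<Lambda> $ i $ j \<le> 0"
  and row_sum: "(\<Sum>j\<in>UNIV. \<Lambda> $ i $ j) = 0"
  using coupling by (auto simp: coupling_matrix_def)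

abbreviation "rate \<equiv> jump_rate \<Lambda>"

lemma rate_pos: "0 < rate"
  unfolding jump_rate_def by (intro add_pos_nonneg sum_nonneg) auto

lemma rate_diag: "\<Lambda> $ i $ i \<le> rate"
proof -
  have "\<bar>\<Lambda> $ i $ i\<bar> \<le> (\<Sum>i\<in>UNIV. \<bar>\<Lambda> $ i $ i\<bar>)" by (intro member_le_sum) auto
  then show ?thesis by (simp add: jump_rate_def)
qed

lemma pmf_jump_kernel: "pmf (jump_kernel \<Lambda> i) j = mat 1 $ i $ j - \<Lambda> $ i $ j / rate"
  unfolding jump_kernel_def
proof (rule pmf_embed_pmf)
  show nn: "0 \<le> mat 1 $ i $ j - \<Lambda> $ i $ j / rate" for j
  proof (cases "i = j")
    case True
    then show ?thesis using rate_diag[of i] rate_pos by (simp add: mat_def field_simps)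
  next
    case False
    then show ?thesis using off_diagonal[of i j] rate_pos by (simp add: mat_def divide_nonpos_pos)
  qed
  have "(\<Sum>j\<in>UNIV. mat 1 $ i $ j - \<Lambda> $ i $ j / rate) = 1"
    unfolding sum_subtractf sum_divide_distrib[symmetric] row_sum by (simp add: mat_def)
  then show "(\<integral>\<^sup>+j. ennreal (mat 1 $ i $ j - \<Lambda> $ i $ j / rate) \<partial>count_space UNIV) = 1"
    by (subst nn_integral_count_space_finite) (simp_all add: sum_ennreal[OF nn] del: sum_ennreal)
qed

lemma jump_map_marginal: "map_pmf (\<lambda>f. f i) (jump_map \<Lambda>) = jump_kernel \<Lambda> i"
  unfolding jump_map_def by (simp add: Pi_pmf_component)

lemma prob_waiting_time: "prob_space (waiting_time \<Lambda>)"
  unfolding waiting_time_def by (rule prob_space_exponential_density[OF rate_pos])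

lemma sets_waiting_time [measurable_cong, simp]: "sets (waiting_time \<Lambda>) = sets borel"
  and space_waiting_time [simp]: "space (waiting_time \<Lambda>) = UNIV"
  by (simp_all add: waiting_time_def)

lemma prob_jump_measure: "prob_space (jump_measure \<Lambda>)"
proof -
  interpret W: prob_space "waiting_time \<Lambda>" by (rule prob_waiting_time)
  interpret pair_prob_space "waiting_time \<Lambda>" "measure_pmf (jump_map \<Lambda>)" ..
  show ?thesis unfolding jump_measure_def by unfold_locales
qed

lemma sets_jump_measure [measurable_cong]: "sets (jump_measure \<Lambda>) = sets (borel \<Otimes>\<^sub>M count_space UNIV)"
  unfolding jump_measure_def by (intro sets_pair_measure_cong) simp_all

lemma space_jump_measure [simp]: "space (jump_measure \<Lambda>) = UNIV"
  by (simp add: jump_measure_def space_pair_measure)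

lemma nn_integral_jump_measure:
  assumes [measurable]: "f \<in> borel_measurable (borel \<Otimes>\<^sub>M count_space UNIV)"
  shows "(\<integral>\<^sup>+x. f x \<partial>jump_measure \<Lambda>) =
    (\<integral>\<^sup>+e. ennreal (exponential_density rate e) * (\<integral>\<^sup>+\<phi>. f (e, \<phi>) \<partial>jump_map \<Lambda>) \<partial>lborel)"
proof -
  have f: "f \<in> borel_measurable (borel \<Otimes>\<^sub>M measure_pmf (jump_map \<Lambda>))"
    using assms by (simp cong: measurable_cong_sets sets_pair_measure_cong)
  have g: "(\<lambda>e. \<integral>\<^sup>+\<phi>. f (e, \<phi>) \<partial>jump_map \<Lambda>) \<in> borel_measurable borel"
    by (rule measure_pmf.borel_measurable_nn_integral_fst[OF f])
  have "(\<integral>\<^sup>+x. f x \<partial>jump_measure \<Lambda>) = (\<integral>\<^sup>+e. (\<integral>\<^sup>+\<phi>. f (e, \<phi>) \<partial>jump_map \<Lambda>) \<partial>waiting_time \<Lambda>)"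
    unfolding jump_measure_def
    by (rule measure_pmf.nn_integral_fst[symmetric]) (use f in \<open>simp cong: measurable_cong_sets sets_pair_measure_cong\<close>)
  also have "\<dots> = (\<integral>\<^sup>+e. ennreal (exponential_density rate e) * (\<integral>\<^sup>+\<phi>. f (e, \<phi>) \<partial>jump_map \<Lambda>) \<partial>lborel)"
    unfolding waiting_time_def using g by (subst nn_integral_density) auto
  finally show ?thesis .
qed

abbreviation "jump_space \<equiv> stream_space (jump_measure \<Lambda>)"

lemma prob_jump_space: "prob_space jump_space"
  by (rule prob_space.prob_space_stream_space[OF prob_jump_measure])

lemma space_jump_space [simp]: "space jump_space = UNIV"
  by (simp add: space_stream_space streams_UNIV)

lemma measurable_fst_jump [measurable]: "fst \<in> borel_measurable (jump_measure \<Lambda>)"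
  by (simp cong: measurable_cong_sets add: sets_jump_measure[THEN measurable_cong_sets[OF _ refl]])

lemma measurable_snd_jump [measurable]: "snd \<in> measurable (jump_measure \<Lambda>) (count_space UNIV)"
  by (simp add: sets_jump_measure[THEN measurable_cong_sets[OF _ refl]])

lemma measurable_jump_time [measurable]: "jump_time n \<in> borel_measurable jump_space"
  unfolding jump_time_sum[abs_def] by measurable

lemma measurable_non_explosive [measurable]: "Measurable.pred jump_space non_explosive"
  unfolding non_explosive_def[abs_def] by measurable

lemma measurable_jumps_before [measurable]: "(\<lambda>s. jumps_before s t) \<in> measurable jump_space (count_space UNIV)"
  unfolding jumps_before_def by measurable

lemma measurable_state_after [measurable]: "state_after n i \<in> measurable jump_space (count_space UNIV)"
proof (induction n arbitrary: i)
  case 0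
  have "state_after 0 i = (\<lambda>s. i)" by auto
  then show ?case by simp
next
  case (Suc n)
  have [measurable]: "(\<lambda>s. state_after n j (stl s)) \<in> measurable jump_space (count_space UNIV)" for j
    by (rule measurable_compose[OF measurable_stl Suc])
  have "(\<lambda>s. snd (shd s)) \<in> measurable jump_space (count_space UNIV)" by measurable
  then have "(\<lambda>s. snd (shd s) i) \<in> measurable jump_space (count_space UNIV)"
    by (rule measurable_compose) simp
  from measurable_compose_countable[OF _ this, of "\<lambda>j s. state_after n j (stl s)"]
  show ?case by simp
qed

lemma measurable_chain_path: "chain_path i \<in> measurable jump_space (index_algebra {0..})"
proof (rule measurable_into_index_algebra)
  fix t :: real assume t: "t \<in> {0..}"
  have "(\<lambda>s. state_after (jumps_before s t) i s) \<in> measurable jump_space (count_space UNIV)"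
    by (rule measurable_compose_countable[where f="\<lambda>n s. state_after n i s"]) measurable
  then have "(\<lambda>s. if non_explosive s then state_after (jumps_before s t) i s else i) \<in> measurable jump_space (count_space UNIV)"
    by measurable
  then show "(\<lambda>s. chain_path i s t) \<in> measurable jump_space (count_space UNIV)"
    using t by (simp add: chain_path_def)
qed (rule chain_path_index_paths)

lemma waiting_event: "{e. P e} \<in> sets borel \<Longrightarrow> {x. P (fst x)} \<in> sets (jump_measure \<Lambda>)"
  using measurable_sets[OF measurable_fst_jump, of "{e. P e}"] by (simp add: vimage_def)

lemma AE_waiting_pos: "AE x in jump_measure \<Lambda>. 0 < fst x"
proof -
  have "emeasure (jump_measure \<Lambda>) {x \<in> space (jump_measure \<Lambda>). \<not> 0 < fst x} =
     (\<integral>\<^sup>+x. indicator {x. \<not> 0 < fst x} x \<partial>jump_measure \<Lambda>)"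
    by (subst nn_integral_indicator) (auto intro!: waiting_event)
  also have "\<dots> = (\<integral>\<^sup>+e. ennreal (exponential_density rate e) * (\<integral>\<^sup>+\<phi>. indicator {x. \<not> 0 < fst x} (e, \<phi>) \<partial>jump_map \<Lambda>) \<partial>lborel)"
    by (rule nn_integral_jump_measure) measurable
  also have "\<dots> = (\<integral>\<^sup>+e. 0 \<partial>(lborel :: real measure))"
  proof (rule nn_integral_cong_AE)
    have "AE e in lborel. e \<noteq> (0::real)" by (rule AE_lborel_singleton)
    then show "AE e in lborel. ennreal (exponential_density rate e) * (\<integral>\<^sup>+\<phi>. indicator {x. \<not> 0 < fst x} (e, \<phi> :: 'm \<Rightarrow> 'm) \<partial>jump_map \<Lambda>) = 0"
      by eventually_elim (auto simp: exponential_density_def)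
  qed
  finally show ?thesis by (subst AE_iff_measurable[OF _ refl]) (auto intro!: waiting_event)
qed

text \<open>By independence the Laplace transform of the \<open>n\<close>-th jump time decays geometrically, so that
  almost surely the jump times are unbounded.\<close>

lemma jump_time_laplace:
  "(\<integral>\<^sup>+s. ennreal (exp (- jump_time n s)) \<partial>jump_space) = ennreal (rate / (rate + 1)) ^ n"
proof (induction n)
  case 0
  interpret prob_space jump_space by (rule prob_jump_space)
  show ?case using emeasure_space_1 by simp
next
  case (Suc n)
  interpret J: prob_space "jump_measure \<Lambda>" by (rule prob_jump_measure)
  have "(\<integral>\<^sup>+s. ennreal (exp (- jump_time (Suc n) s)) \<partial>jump_space) =
      (\<integral>\<^sup>+x. \<integral>\<^sup>+X. ennreal (exp (- jump_time (Suc n) (x ## X))) \<partial>jump_space \<partial>jump_measure \<Lambda>)"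
    by (rule J.nn_integral_stream_space) measurable
  also have "\<dots> = (\<integral>\<^sup>+x. ennreal (exp (- fst x)) * (\<integral>\<^sup>+X. ennreal (exp (- jump_time n X)) \<partial>jump_space) \<partial>jump_measure \<Lambda>)"
    by (subst nn_integral_cmult[symmetric]) (auto simp: exp_diff exp_minus field_simps simp flip: ennreal_mult exp_add)
  also have "\<dots> = (\<integral>\<^sup>+x. ennreal (exp (- fst x)) \<partial>jump_measure \<Lambda>) * ennreal (rate / (rate + 1)) ^ n"
    by (subst nn_integral_multc) (simp_all add: Suc)
  also have "(\<integral>\<^sup>+x. ennreal (exp (- fst x)) \<partial>jump_measure \<Lambda>) =
     (\<integral>\<^sup>+e. ennreal (exponential_density rate e) * (\<integral>\<^sup>+\<phi>. ennreal (exp (- fst (e, \<phi> :: 'm \<Rightarrow> 'm))) \<partial>jump_map \<Lambda>) \<partial>lborel)"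
    by (rule nn_integral_jump_measure) measurable
  also have "\<dots> = (\<integral>\<^sup>+e. ennreal (rate / (rate + 1)) * ennreal (exponential_density (rate + 1) e) \<partial>lborel)"
  proof (intro nn_integral_cong)
    fix e :: real
    \<comment> \<open>The factor \<open>exp (- e)\<close> turns one exponential density into a multiple of another.\<close>
    have "exponential_density rate e * exp (- e) = rate / (rate + 1) * exponential_density (rate + 1) e"
      using rate_pos by (simp add: exponential_density_def field_simps flip: exp_add)
    then show "ennreal (exponential_density rate e) * (\<integral>\<^sup>+\<phi>. ennreal (exp (- fst (e, \<phi> :: 'm \<Rightarrow> 'm))) \<partial>jump_map \<Lambda>) =
        ennreal (rate / (rate + 1)) * ennreal (exponential_density (rate + 1) e)"
      using rate_pos by (simp add: measure_pmf.emeasure_space_1 exponential_density_nonneg flip: ennreal_mult)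
  qed
  also have "\<dots> = ennreal (rate / (rate + 1)) * emeasure (density lborel (exponential_density (rate + 1))) UNIV"
    by (subst nn_integral_cmult) (simp_all add: emeasure_density)
  also have "emeasure (density lborel (exponential_density (rate + 1))) UNIV = 1"
    using prob_space.emeasure_space_1[OF prob_space_exponential_density[of "rate + 1"]] rate_pos by simp
  finally show ?case by (simp add: mult_ac)
qed

lemma AE_non_explosive: "AE s in jump_space. non_explosive s"
proof -
  interpret J: prob_space "jump_measure \<Lambda>" by (rule prob_jump_measure)
  interpret S: prob_space jump_space by (rule prob_jump_space)
  have "AE s in jump_space. stream_all (\<lambda>x. 0 \<le> fst x) s"
    by (rule J.AE_stream_all) (use AE_waiting_pos in \<open>auto elim: eventually_mono\<close>)
  moreover have "AE s in jump_space. \<exists>n. real K < jump_time n s" for K :: nat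
  proof -
    define N :: "'m jumps set" where "N = {s. \<forall>n. jump_time n s \<le> real K}"
    have N [measurable]: "N \<in> sets jump_space"
    proof -
      have "{s \<in> space jump_space. \<forall>n. jump_time n s \<le> real K} \<in> sets jump_space" by measurable
      then show ?thesis by (simp add: N_def)
    qed
    have le: "emeasure jump_space N \<le> ennreal (exp (real K)) * ennreal ((rate / (rate + 1)) ^ n)" for n
    proof -
      have "emeasure jump_space N = (\<integral>\<^sup>+s. indicator N s \<partial>jump_space)" by simp
      also have "\<dots> \<le> (\<integral>\<^sup>+s. ennreal (exp (real K)) * ennreal (exp (- jump_time n s)) \<partial>jump_space)"
        by (intro nn_integral_mono) (auto simp: N_def indicator_def simp flip: ennreal_mult exp_add)
      also have "\<dots> = ennreal (exp (real K)) * ennreal (rate / (rate + 1)) ^ n"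
        by (subst nn_integral_cmult) (simp_all add: jump_time_laplace)
      finally show ?thesis using rate_pos by (simp add: ennreal_power)
    qed
    have "(\<lambda>n. exp (real K) * (rate / (rate + 1)) ^ n) \<longlonglongrightarrow> exp (real K) * 0"
      using rate_pos by (intro tendsto_intros LIMSEQ_power_zero) simp
    then have "(\<lambda>n. ennreal (exp (real K) * (rate / (rate + 1)) ^ n)) \<longlonglongrightarrow> ennreal 0"
      by (intro tendsto_ennrealI) simp
    then have "emeasure jump_space N \<le> 0"
      using le rate_pos by (intro LIMSEQ_le_const[of _ "0::ennreal"]) (auto simp: ennreal_mult)
    then have "AE s in jump_space. s \<notin> N" by (intro AE_not_in) (auto simp: null_sets_def)
    then show ?thesis by (auto simp: N_def not_le)
  qed
  ultimately show ?thesis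
    unfolding non_explosive_def stream_all_def AE_all_countable[symmetric]
    by (auto simp: AE_all_countable)
qed

subsection \<open>The Markov property at a fixed time\<close>

definition law_from :: "'m \<Rightarrow> (real \<Rightarrow> 'm) measure" where
  "law_from i = distr jump_space (index_algebra {0..}) (chain_path i)"

lemma sets_law_from [measurable_cong, simp]: "sets (law_from i) = sets (index_algebra {0..})"
  by (simp add: law_from_def)

lemma space_law_from [simp]: "space (law_from i) = index_paths"
  by (simp add: law_from_def)

lemma prob_law_from: "prob_space (law_from i)"
  unfolding law_from_def by (rule prob_space.prob_space_distr[OF prob_jump_space measurable_chain_path])

lemma law_from_start: "AE \<omega> in law_from i. \<omega> 0 = i"
proof -
  interpret J: prob_space "jump_measure \<Lambda>" by (rule prob_jump_measure)
  have "AE s in jump_space. stream_all (\<lambda>x. 0 < fst x) s"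
    by (rule J.AE_stream_all) (auto simp: AE_waiting_pos)
  with AE_non_explosive have "AE s in jump_space. chain_path i s 0 = i"
  proof eventually_elim
    fix s :: "'m jumps" assume s: "stream_all (\<lambda>x. 0 < fst x) s" "non_explosive s"
    then have "0 < fst (s !! 0)" unfolding stream_all_def by blast
    then show "chain_path i s 0 = i" using chain_path_step[OF s(2), of 0 0 i] by simp
  qed
  moreover have "{\<omega> \<in> space (law_from i). \<omega> 0 = i} \<in> sets (index_algebra {0..})"
    using path_algebra_generator[of 0 "{0..}" "discrete_topology UNIV" "{i}"] by simp
  ultimately show ?thesis
    unfolding law_from_def by (subst AE_distr_iff[OF measurable_chain_path]) auto
qed

end

context coupling
begin

abbreviation transition :: "real \<Rightarrow> 'm \<Rightarrow> 'm \<Rightarrow> real" where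
  "transition t i j \<equiv> chain_semigroup \<Lambda> t $ i $ j"

text \<open>The cut-off \<open>max 0\<close> gives a measurable function of \<open>t\<close> on the whole real line.\<close>

definition shift_prob :: "(real \<Rightarrow> 'm) set \<Rightarrow> 'm \<Rightarrow> real \<Rightarrow> real" where
  "shift_prob B i t = measure (law_from i) {\<omega> \<in> index_paths. shifted_by (max 0 t) \<omega> \<in> B}"

lemma shifted_event:
  fixes B :: "(real \<Rightarrow> 'm) set"
  assumes "B \<in> sets (index_algebra {0..})" "0 \<le> t"
  shows "{\<omega> \<in> index_paths. shifted_by t \<omega> \<in> B} \<in> sets (index_algebra {0..})"
  using measurable_sets[OF measurable_shifted_by[OF assms(2)] assms(1)]
  by (simp add: vimage_def Int_def conj_commute)

lemma shift_prob_jumps: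
  assumes B: "B \<in> sets (index_algebra {0..})"
  shows "shift_prob B i t = measure jump_space {s. shifted_by (max 0 t) (chain_path i s) \<in> B}"
  unfolding shift_prob_def law_from_def
  by (subst measure_distr[OF measurable_chain_path shifted_event[OF B]])
     (auto simp: vimage_def chain_path_index_paths)

lemma measurable_shift_joint:
  "(\<lambda>(\<omega>, t). shifted_by (max 0 t) \<omega>) \<in>
     measurable (index_algebra {0..} \<Otimes>\<^sub>M borel) (index_algebra {0..} :: (real \<Rightarrow> 'm) measure)"
proof (rule measurable_into_index_algebra)
  fix s :: real assume s: "s \<in> {0..}"
  have "(\<lambda>w. (fst w, max 0 (snd w) + s)) \<in> measurable (index_algebra {0..} \<Otimes>\<^sub>M borel) (index_algebra {0..} \<Otimes>\<^sub>M borel :: ((real \<Rightarrow> 'm) \<times> real) measure)"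
    by measurable
  from measurable_compose[OF this measurable_index_eval_joint]
  show "(\<lambda>w. (case w of (\<omega>, t) \<Rightarrow> shifted_by (max 0 t) \<omega>) s) \<in> measurable (index_algebra {0..} \<Otimes>\<^sub>M borel) (count_space (UNIV :: 'm set))"
    using s by (simp add: shifted_by_def case_prod_unfold)
qed (auto simp: space_pair_measure intro!: shifted_by_cadlag)

lemma measurable_shift_prob [measurable]:
  assumes B: "B \<in> sets (index_algebra {0..})"
  shows "shift_prob B i \<in> borel_measurable borel"
proof -
  interpret prob_space "law_from i" by (rule prob_law_from)
  have sw: "(\<lambda>(t, \<omega>). (\<omega>, t)) \<in> measurable (borel \<Otimes>\<^sub>M law_from i) (index_algebra {0..} \<Otimes>\<^sub>M borel)"
    by measurable
  have "{(t, \<omega>). \<omega> \<in> index_paths \<and> shifted_by (max 0 t) \<omega> \<in> B} \<in> sets (borel \<Otimes>\<^sub>M law_from i)"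
  proof -
    have "(\<lambda>z. case (case z of (t, \<omega>) \<Rightarrow> (\<omega>, t)) of (\<omega>, t) \<Rightarrow> shifted_by (max 0 t) \<omega>) -` B \<inter> space (borel \<Otimes>\<^sub>M law_from i) \<in> sets (borel \<Otimes>\<^sub>M law_from i)"
      by (rule measurable_sets[OF measurable_compose[OF sw measurable_shift_joint] B])
    also have "(\<lambda>z. case (case z of (t, \<omega>) \<Rightarrow> (\<omega>, t)) of (\<omega>, t) \<Rightarrow> shifted_by (max 0 t) \<omega>) -` B \<inter> space (borel \<Otimes>\<^sub>M law_from i)
       = {(t, \<omega>). \<omega> \<in> index_paths \<and> shifted_by (max 0 t) \<omega> \<in> B}"
      by (auto simp: space_pair_measure)
    finally show ?thesis .
  qed
  from measurable_emeasure_Pair[OF this]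
  have "(\<lambda>t. emeasure (law_from i) {\<omega> \<in> index_paths. shifted_by (max 0 t) \<omega> \<in> B}) \<in> borel_measurable borel"
    by (simp add: vimage_def)
  then show ?thesis unfolding shift_prob_def[abs_def] measure_def by measurable
qed

lemma shift_prob_bounds: "0 \<le> shift_prob B i t" "shift_prob B i t \<le> 1"
  using prob_space.prob_le_1[OF prob_law_from] by (simp_all add: shift_prob_def)

text \<open>Conditioning on the first jump.  If it happens at time \<open>e \<le> t\<close>, the path restarts from a
  state drawn from the kernel; otherwise the waiting time has no memory, which contributes the
  value at time \<open>0\<close>.\<close>

lemma renewal_nn:
  assumes B: "B \<in> sets (index_algebra {0..})" and t: "0 \<le> t"
  shows "ennreal (shift_prob B i t) = ennreal (exp (- rate * t)) * ennreal (shift_prob B i 0) +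
    (\<integral>\<^sup>+s. indicator {0..t} s * ennreal (rate * exp (- rate * (t - s)) * (\<Sum>j\<in>UNIV. pmf (jump_kernel \<Lambda> i) j * shift_prob B j s)) \<partial>lborel)"
proof -
  interpret J: prob_space "jump_measure \<Lambda>" by (rule prob_jump_measure)
  interpret S: prob_space jump_space by (rule prob_jump_space)
  have ev: "{s. shifted_by r (chain_path i s) \<in> B} \<in> sets jump_space" if "0 \<le> r" for r i
    using measurable_sets[OF measurable_compose[OF measurable_chain_path measurable_shifted_by[OF that]] B]
    by (simp add: vimage_def)
  define K where "K r x = measure jump_space {X. shifted_by r (chain_path i (x ## X)) \<in> B}" for r x
  have K_meas: "(\<lambda>x. ennreal (K r x)) \<in> borel_measurable (borel \<Otimes>\<^sub>M count_space UNIV)" if "0 \<le> r" for r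
  proof -
    have "(\<lambda>z. fst z ## snd z) \<in> measurable (jump_measure \<Lambda> \<Otimes>\<^sub>M jump_space) jump_space" by measurable
    from measurable_sets[OF this ev[OF that]]
    have "{z. shifted_by r (chain_path i (fst z ## snd z)) \<in> B} \<in> sets (jump_measure \<Lambda> \<Otimes>\<^sub>M jump_space)"
      by (simp add: vimage_def space_pair_measure)
    from S.measurable_emeasure_Pair[OF this]
    have "(\<lambda>x. emeasure jump_space {X. shifted_by r (chain_path i (x ## X)) \<in> B}) \<in> borel_measurable (jump_measure \<Lambda>)"
      by (simp add: vimage_def)
    then show ?thesis
      by (simp add: K_def S.emeasure_eq_measure sets_jump_measure[THEN measurable_cong_sets[OF _ refl]])
  qed
  have decomp: "ennreal (shift_prob B i r) =
      (\<integral>\<^sup>+e. ennreal (exponential_density rate e) * (\<integral>\<^sup>+\<phi>. ennreal (K r (e, \<phi>)) \<partial>jump_map \<Lambda>) \<partial>lborel)" if r: "0 \<le> r" for r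
  proof -
    have "ennreal (shift_prob B i r) = (\<integral>\<^sup>+x. ennreal (K r x) \<partial>jump_measure \<Lambda>)"
      using J.prob_stream_space[of "\<lambda>s. shifted_by r (chain_path i s) \<in> B"] ev[OF r] r
      by (simp add: shift_prob_jumps[OF B] K_def)
    then show ?thesis by (simp add: nn_integral_jump_measure[OF K_meas[OF r]])
  qed
  have before: "K t (e, \<phi>) = K 0 (e - t, \<phi>)" if "t < e" for e \<phi>
  proof -
    have 0: "shifted_by 0 (chain_path i (x ## X)) = chain_path i (x ## X)" for x X
      by (rule shifted_by_0[OF chain_path_index_paths])
    have "AE X in jump_space. (shifted_by t (chain_path i ((e, \<phi>) ## X)) \<in> B) = (shifted_by 0 (chain_path i ((e - t, \<phi>) ## X)) \<in> B)"
      using AE_non_explosive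
    proof eventually_elim
      case (elim X)
      then show ?case using chain_path_shift_before[OF t, of "(e, \<phi>)" X i] that by (simp add: 0)
    qed
    then have "AE X in jump_space. (X \<in> {X. shifted_by t (chain_path i ((e, \<phi>) ## X)) \<in> B}) =
        (X \<in> {X. shifted_by 0 (chain_path i ((e - t, \<phi>) ## X)) \<in> B})"
      by simp
    then show ?thesis unfolding K_def
    proof (rule S.finite_measure_eq_AE)
      have m: "(\<lambda>X. x ## X) \<in> measurable jump_space jump_space" for x
        by measurable
      show "{X. shifted_by t (chain_path i ((e, \<phi>) ## X)) \<in> B} \<in> S.events" "{X. shifted_by 0 (chain_path i ((e - t, \<phi>) ## X)) \<in> B} \<in> S.events"
        using measurable_sets[OF m ev[OF t]] measurable_sets[OF m ev[OF order_refl]] by (simp_all add: vimage_def)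
    qed
  qed
  have after: "K t (e, \<phi>) = shift_prob B (\<phi> i) (t - e)" if "0 \<le> e" "e \<le> t" for e \<phi>
  proof -
    have "AE X in jump_space. (shifted_by t (chain_path i ((e, \<phi>) ## X)) \<in> B) = (shifted_by (t - e) (chain_path (\<phi> i) X) \<in> B)"
      using AE_non_explosive
    proof eventually_elim
      case (elim X)
      then show ?case using chain_path_shift_after[of "(e, \<phi>)" t X i] that by simp
    qed
    then have "AE X in jump_space. (X \<in> {X. shifted_by t (chain_path i ((e, \<phi>) ## X)) \<in> B}) =
        (X \<in> {X. shifted_by (t - e) (chain_path (\<phi> i) X) \<in> B})"
      by simp
    then have "K t (e, \<phi>) = measure jump_space {X. shifted_by (t - e) (chain_path (\<phi> i) X) \<in> B}" unfolding K_def
    proof (rule S.finite_measure_eq_AE)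
      have m: "(\<lambda>X. x ## X) \<in> measurable jump_space jump_space" for x
        by measurable
      show "{X. shifted_by t (chain_path i ((e, \<phi>) ## X)) \<in> B} \<in> S.events"
        using measurable_sets[OF m ev[OF t]] by (simp add: vimage_def)
      show "{X. shifted_by (t - e) (chain_path (\<phi> i) X) \<in> B} \<in> S.events" using that by (intro ev) simp
    qed
    then show ?thesis using that by (simp add: shift_prob_jumps[OF B])
  qed
  define k where "k e = (\<integral>\<^sup>+\<phi>. ennreal (K 0 (e, \<phi>)) \<partial>jump_map \<Lambda>)" for e
  define q where "q s = (\<Sum>j\<in>UNIV. pmf (jump_kernel \<Lambda> i) j * shift_prob B j s)" for s
  have q0: "0 \<le> q s" for s unfolding q_def by (intro sum_nonneg mult_nonneg_nonneg shift_prob_bounds) auto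
  have q_meas [measurable]: "q \<in> borel_measurable borel" unfolding q_def using B by measurable
  have k_meas [measurable]: "k \<in> borel_measurable borel"
    unfolding k_def
    by (rule measure_pmf.borel_measurable_nn_integral_fst)
       (use K_meas[OF order_refl] in \<open>simp cong: measurable_cong_sets sets_pair_measure_cong\<close>)
  have kernel: "(\<integral>\<^sup>+\<phi>. ennreal (shift_prob B (\<phi> i) r) \<partial>jump_map \<Lambda>) = ennreal (q r)" for r
  proof -
    have "(\<integral>\<^sup>+\<phi>. ennreal (shift_prob B (\<phi> i) r) \<partial>jump_map \<Lambda>) = (\<integral>\<^sup>+j. ennreal (shift_prob B j r) \<partial>jump_kernel \<Lambda> i)"
      by (simp add: jump_map_marginal[symmetric] nn_integral_map_pmf)
    also have "\<dots> = (\<Sum>j\<in>UNIV. ennreal (shift_prob B j r) * ennreal (pmf (jump_kernel \<Lambda> i) j))"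
      by (subst nn_integral_measure_pmf_support[of UNIV]) auto
    also have "\<dots> = ennreal (q r)"
      unfolding q_def by (subst sum_ennreal[symmetric]) (auto simp: shift_prob_bounds ennreal_mult mult.commute)
    finally show ?thesis .
  qed
  have "ennreal (shift_prob B i t) = (\<integral>\<^sup>+e. indicator {0..t} e * ennreal (rate * exp (- rate * e) * q (t - e)) +
      indicator {t<..} e * (ennreal (rate * exp (- rate * e)) * k (e - t)) \<partial>lborel)"
    unfolding decomp[OF t]
  proof (intro nn_integral_cong)
    fix e :: real
    consider "e < 0" | "0 \<le> e" "e \<le> t" | "t < e" by linarith
    then show "ennreal (exponential_density rate e) * (\<integral>\<^sup>+\<phi>. ennreal (K t (e, \<phi>)) \<partial>jump_map \<Lambda>) =
       indicator {0..t} e * ennreal (rate * exp (- rate * e) * q (t - e)) + indicator {t<..} e * (ennreal (rate * exp (- rate * e)) * k (e - t))"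
    proof cases
      case 1 then show ?thesis using t by (simp add: exponential_density_def)
    next
      case 2
      then have "(\<integral>\<^sup>+\<phi>. ennreal (K t (e, \<phi>)) \<partial>jump_map \<Lambda>) = ennreal (q (t - e))"
        by (simp add: after kernel)
      then show ?thesis using 2 rate_pos q0 by (simp add: exponential_density_def mult.commute flip: ennreal_mult)
    next
      case 3
      then show ?thesis using t by (simp add: exponential_density_def before k_def mult.commute)
    qed
  qed
  also have "\<dots> = (\<integral>\<^sup>+e. indicator {0..t} e * ennreal (rate * exp (- rate * e) * q (t - e)) \<partial>lborel) +
      (\<integral>\<^sup>+e. indicator {t<..} e * (ennreal (rate * exp (- rate * e)) * k (e - t)) \<partial>lborel)"
    by (rule nn_integral_add) measurable
  \<comment> \<open>Memorylessness: the substitution of \<open>t + e\<close> for \<open>e\<close> splits off the factor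
     \<open>exp (- rate * t)\<close>.\<close>
  also have "(\<integral>\<^sup>+e. indicator {t<..} e * (ennreal (rate * exp (- rate * e)) * k (e - t)) \<partial>lborel) =
      (\<integral>\<^sup>+e. indicator {t<..} (t + 1 * e) * (ennreal (rate * exp (- rate * (t + 1 * e))) * k (t + 1 * e - t)) \<partial>lborel)"
    by (subst nn_integral_real_affine[of _ 1 t]) auto
  also have "\<dots> = (\<integral>\<^sup>+e. ennreal (exp (- rate * t)) * (ennreal (exponential_density rate e) * k e) \<partial>lborel)"
  proof (rule nn_integral_cong_AE)
    have "AE e in lborel. e \<noteq> (0::real)" by (rule AE_lborel_singleton)
    then show "AE e in lborel. indicator {t<..} (t + 1 * e) * (ennreal (rate * exp (- rate * (t + 1 * e))) * k (t + 1 * e - t)) =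
        ennreal (exp (- rate * t)) * (ennreal (exponential_density rate e) * k e)"
    proof eventually_elim
      fix e :: real assume "e \<noteq> 0"
      have "rate * exp (- rate * (t + 1 * e)) = exp (- rate * t) * (rate * exp (- e * rate))"
        by (simp add: algebra_simps flip: exp_add)
      then have "ennreal (rate * exp (- rate * (t + 1 * e))) = ennreal (exp (- rate * t)) * ennreal (rate * exp (- e * rate))"
        using rate_pos by (simp only: ennreal_mult' exp_ge_zero)
      then show "indicator {t<..} (t + 1 * e) * (ennreal (rate * exp (- rate * (t + 1 * e))) * k (t + 1 * e - t)) =
        ennreal (exp (- rate * t)) * (ennreal (exponential_density rate e) * k e)"
        using \<open>e \<noteq> 0\<close> by (simp add: exponential_density_def mult.assoc)
    qed
  qed
  also have "\<dots> = ennreal (exp (- rate * t)) * ennreal (shift_prob B i 0)"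
    by (subst nn_integral_cmult) (simp_all add: decomp[OF order_refl] k_def[symmetric])
  \<comment> \<open>The convolution written in terms of the remaining time \<open>s = t - e\<close>.\<close>
  also have "(\<integral>\<^sup>+e. indicator {0..t} e * ennreal (rate * exp (- rate * e) * q (t - e)) \<partial>lborel) =
     (\<integral>\<^sup>+s. indicator {0..t} (t + (-1) * s) * ennreal (rate * exp (- rate * (t + (-1) * s)) * q (t - (t + (-1) * s))) \<partial>lborel)"
    by (subst nn_integral_real_affine[of _ "-1" t]) auto
  also have "\<dots> = (\<integral>\<^sup>+s. indicator {0..t} s * ennreal (rate * exp (- rate * (t - s)) * q s) \<partial>lborel)"
    by (intro nn_integral_cong) (auto simp: indicator_def)
  finally show ?thesis by (simp add: q_def add.commute)
qed

text \<open>Multiplication by the integrating factor \<open>exp (rate * t)\<close> turns the convolution into an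
  indefinite integral, which can be differentiated.\<close>

lemma renewal:
  fixes i :: 'm
  assumes B: "B \<in> sets (index_algebra {0..})" and t: "0 \<le> t"
  defines "h \<equiv> \<lambda>s. rate * exp (rate * s) * (\<Sum>j\<in>UNIV. pmf (jump_kernel \<Lambda> i) j * shift_prob B j s)"
  shows "h integrable_on {0..t}"
    and "exp (rate * t) * shift_prob B i t = shift_prob B i 0 + integral {0..t} h"
proof -
  let ?q = "\<lambda>s. \<Sum>j\<in>UNIV. pmf (jump_kernel \<Lambda> i) j * shift_prob B j s"
  have q0: "0 \<le> ?q s" for s by (intro sum_nonneg mult_nonneg_nonneg shift_prob_bounds) auto
  have q1: "?q s \<le> real CARD('m)" for s
  proof -
    have "?q s \<le> (\<Sum>j\<in>(UNIV::'m set). 1)"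
      by (intro sum_mono mult_le_one shift_prob_bounds pmf_le_1)
    then show ?thesis by simp
  qed
  have h0: "0 \<le> h s" for s unfolding h_def using rate_pos q0 by simp
  have hm [measurable]: "h \<in> borel_measurable borel" unfolding h_def using B by measurable
  have int: "set_integrable lborel {0..t} h"
    unfolding set_integrable_def
  proof (rule integrableI_bounded_set_indicator[where B="rate * exp (rate * t) * real CARD('m)"])
    show "AE s in lborel. s \<in> {0..t} \<longrightarrow> norm (h s) \<le> rate * exp (rate * t) * real CARD('m)"
    proof (intro AE_I2 impI)
      fix s assume "s \<in> {0..t}"
      then have "h s \<le> rate * exp (rate * t) * real CARD('m)"
        unfolding h_def using rate_pos q0 q1 by (intro mult_mono) auto
      then show "norm (h s) \<le> rate * exp (rate * t) * real CARD('m)" using h0[of s] by simp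
    qed
  qed (auto simp: emeasure_lborel_Icc_eq)
  show "h integrable_on {0..t}" by (rule set_borel_integral_eq_integral[OF int])
  have "(\<integral>\<^sup>+s. indicator {0..t} s * ennreal (rate * exp (- rate * (t - s)) * ?q s) \<partial>lborel) =
     (\<integral>\<^sup>+s. ennreal (exp (- rate * t)) * ennreal (indicator {0..t} s *\<^sub>R h s) \<partial>lborel)"
  proof (intro nn_integral_cong)
    fix s :: real
    have "rate * exp (- rate * (t - s)) * ?q s = exp (- rate * t) * h s"
    proof -
      have "exp (- rate * (t - s)) = exp (- rate * t) * exp (rate * s)"
        by (simp add: algebra_simps flip: exp_add)
      then show ?thesis by (simp add: h_def)
    qed
    then show "indicator {0..t} s * ennreal (rate * exp (- rate * (t - s)) * ?q s) =
        ennreal (exp (- rate * t)) * ennreal (indicator {0..t} s *\<^sub>R h s)"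
      by (simp add: indicator_def ennreal_mult')
  qed
  also have "\<dots> = ennreal (exp (- rate * t)) * (\<integral>\<^sup>+s. ennreal (indicator {0..t} s *\<^sub>R h s) \<partial>lborel)"
    by (rule nn_integral_cmult) measurable
  also have "(\<integral>\<^sup>+s. ennreal (indicator {0..t} s *\<^sub>R h s) \<partial>lborel) = ennreal (LBINT s:{0..t}. h s)"
    unfolding set_lebesgue_integral_def using int h0
    by (intro nn_integral_eq_integral) (auto simp: set_integrable_def)
  also have "(LBINT s:{0..t}. h s) = integral {0..t} h" by (rule set_borel_integral_eq_integral[OF int])
  finally have "ennreal (shift_prob B i t) = ennreal (exp (- rate * t) * (shift_prob B i 0 + integral {0..t} h))"
    using renewal_nn[OF B t, of i] h0
    by (simp add: ennreal_mult' ennreal_plus shift_prob_bounds integral_nonneg \<open>h integrable_on {0..t}\<close> distrib_left)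
  then have "shift_prob B i t = exp (- rate * t) * (shift_prob B i 0 + integral {0..t} h)"
    using h0 by (subst (asm) ennreal_inj)
      (auto intro!: mult_nonneg_nonneg add_nonneg_nonneg shift_prob_bounds integral_nonneg \<open>h integrable_on {0..t}\<close>)
  then show "exp (rate * t) * shift_prob B i t = shift_prob B i 0 + integral {0..t} h"
    by (simp add: exp_minus field_simps)
qed

text \<open>Differentiating the renewal equation gives the backward equation \<open>G' = - \<Lambda> G\<close>.\<close>

lemma shift_prob_semigroup:
  assumes B: "B \<in> sets (index_algebra {0..})" and t: "0 \<le> t"
  shows "shift_prob B i t = (\<Sum>k\<in>UNIV. transition t i k * shift_prob B k 0)"
proof (rule backward_equation_unique[OF _ t])
  define h where "h i s = rate * exp (rate * s) * (\<Sum>j\<in>UNIV. pmf (jump_kernel \<Lambda> i) j * shift_prob B j s)" for i s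
  define I where "I i t = integral {0..t} (h i)" for i t
  have int: "h i integrable_on {0..t}" and eq: "0 \<le> t \<Longrightarrow> shift_prob B i t = exp (- rate * t) * (shift_prob B i 0 + I i t)" for i t
  proof -
    show "0 \<le> t \<Longrightarrow> shift_prob B i t = exp (- rate * t) * (shift_prob B i 0 + I i t)"
      using renewal(2)[OF B, of t i] by (simp add: h_def[abs_def] I_def exp_minus field_simps)
    show "h i integrable_on {0..t}"
      using renewal(1)[OF B, of t i] by (cases "0 \<le> t") (auto simp: h_def[abs_def])
  qed
  \<comment> \<open>Regularity is gained in two steps: indefinite integrals are continuous, hence so is the
     integrand \<open>h\<close>, hence its integral is differentiable.\<close>
  have cont: "continuous_on {0..b} (shift_prob B i)" for i b
  proof -
    have "continuous_on {0..b} (\<lambda>t. exp (- rate * t) * (shift_prob B i 0 + I i t))"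
      unfolding I_def by (intro continuous_intros indefinite_integral_continuous_1 int)
    then show ?thesis by (rule continuous_on_eq) (rule eq[symmetric], simp)
  qed
  have hcont: "continuous_on {0..b} (h i)" for i b
    unfolding h_def by (intro continuous_intros cont)
  fix i and t :: real assume t: "0 \<le> t"
  have "(I i has_real_derivative h i t) (at t within {0..t+1})"
    unfolding I_def using t by (intro integral_has_real_derivative hcont) auto
  moreover have "at t within {0..t+1} = at t within {0..}"
    by (rule at_within_nhd[of t "{..<t+1}"]) auto
  ultimately have "(I i has_real_derivative h i t) (at t within {0..})" by simp
  then have "((\<lambda>t. exp (- rate * t) * (shift_prob B i 0 + I i t)) has_real_derivative
      (- rate * exp (- rate * t)) * (shift_prob B i 0 + I i t) + exp (- rate * t) * h i t) (at t within {0..})"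
    by (auto intro!: derivative_eq_intros)
  then have "(shift_prob B i has_real_derivative
      (- rate * exp (- rate * t)) * (shift_prob B i 0 + I i t) + exp (- rate * t) * h i t) (at t within {0..})"
  proof (rule has_field_derivative_transform_within[of _ _ _ _ 1])
    show "exp (- rate * x) * (shift_prob B i 0 + I i x) = shift_prob B i x" if "x \<in> {0..}" for x
      using that by (intro eq[symmetric]) simp
  qed (use t in auto)
  moreover have "(- rate * exp (- rate * t)) * (shift_prob B i 0 + I i t) + exp (- rate * t) * h i t =
     - (\<Sum>k\<in>UNIV. \<Lambda> $ i $ k * shift_prob B k t)"
  proof -
    have "exp (- rate * t) * h i t = rate * (\<Sum>j\<in>UNIV. pmf (jump_kernel \<Lambda> i) j * shift_prob B j t)"
      by (simp add: h_def exp_minus)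
    also have "\<dots> = (\<Sum>j\<in>UNIV. rate * mat 1 $ i $ j * shift_prob B j t - \<Lambda> $ i $ j * shift_prob B j t)"
      unfolding sum_distrib_left pmf_jump_kernel
      by (intro sum.cong refl) (use rate_pos in \<open>simp add: field_simps\<close>)
    also have "\<dots> = rate * shift_prob B i t - (\<Sum>k\<in>UNIV. \<Lambda> $ i $ k * shift_prob B k t)"
      by (simp add: sum_subtractf mat_def if_distrib[of "\<lambda>x. _ * x * _"] if_distrib[of "\<lambda>x. x * _"] cong: if_cong)
    finally show ?thesis using eq[OF t, of i] by simp
  qed
  ultimately show "(shift_prob B i has_real_derivative - (\<Sum>k\<in>UNIV. \<Lambda> $ i $ k * shift_prob B k t)) (at t within {0..})"
    by simp
qed

lemma law_from_shift:
  assumes B: "B \<in> sets (index_algebra {0..})" and t: "0 \<le> t"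
  shows "measure (law_from i) {\<omega> \<in> index_paths. shifted_by t \<omega> \<in> B} =
    (\<Sum>k\<in>UNIV. transition t i k * measure (law_from k) B)"
proof -
  have "B \<subseteq> index_paths" using sets.sets_into_space[OF B] by simp
  then have "{\<omega> \<in> index_paths. shifted_by 0 \<omega> \<in> B} = B" using shifted_by_0 by fastforce
  then show ?thesis using shift_prob_semigroup[OF B t, of i] t by (simp add: shift_prob_def)
qed

lemma index_event:
  "s \<in> T \<Longrightarrow> {\<omega> \<in> index_paths. \<omega> s = j} \<in> sets (index_algebra T :: (real \<Rightarrow> 'm) measure)"
  using path_algebra_generator[of s T "discrete_topology UNIV" "{j}"] by simp

lemma law_from_at_0:
  assumes "B \<in> sets (index_algebra {0..})"
  shows "measure (law_from k) {\<omega> \<in> index_paths. \<omega> 0 = j \<and> \<omega> \<in> B} = (if k = j then measure (law_from k) B else 0)"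
proof -
  interpret prob_space "law_from k" by (rule prob_law_from)
  have sub: "B \<subseteq> index_paths" using sets.sets_into_space[OF assms] by simp
  have meas: "{\<omega> \<in> index_paths. \<omega> 0 = j \<and> \<omega> \<in> B} \<in> sets (index_algebra {0..})"
  proof -
    have "{\<omega> \<in> index_paths. \<omega> 0 = j} \<inter> B \<in> sets (index_algebra {0..})"
      by (intro sets.Int index_event assms) simp
    moreover have "{\<omega> \<in> index_paths. \<omega> 0 = j} \<inter> B = {\<omega> \<in> index_paths. \<omega> 0 = j \<and> \<omega> \<in> B}" by auto
    ultimately show ?thesis by simp
  qed
  show ?thesis
  proof (cases "k = j")
    case True
    have "measure (law_from k) {\<omega> \<in> index_paths. \<omega> 0 = j \<and> \<omega> \<in> B} = measure (law_from k) B"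
      by (rule finite_measure_eq_AE)
         (use law_from_start[of k] sub True meas assms in \<open>auto elim!: eventually_mono\<close>)
    then show ?thesis using True by simp
  next
    case False
    have "measure (law_from k) {\<omega> \<in> index_paths. \<omega> 0 = j \<and> \<omega> \<in> B} = measure (law_from k) {}"
      by (rule finite_measure_eq_AE)
         (use law_from_start[of k] False meas in \<open>auto elim!: eventually_mono\<close>)
    then show ?thesis using False by simp
  qed
qed

text \<open>Shifting by the first time splits off one transition; the remaining times are then counted
  from there.\<close>

lemma law_from_fdd:
  fixes k :: nat and t :: "nat \<Rightarrow> real" and j :: "nat \<Rightarrow> 'm"
  assumes "1 \<le> k" "0 \<le> t 1" "\<forall>l\<in>{1..<k}. t l < t (l + 1)"
  shows "measure (law_from i) {\<omega> \<in> index_paths. \<forall>l\<in>{1..k}. \<omega> (t l) = j l} =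
    transition (t 1) i (j 1) *
    (\<Prod>l=2..k. transition (t l - t (l - 1)) (j (l - 1)) (j l))"
  using assms
proof (induction k arbitrary: i t j rule: nat_induct_at_least)
  case base
  have B: "index_paths \<in> sets (index_algebra {0..} :: (real \<Rightarrow> 'm) measure)"
    using sets.top[of "index_algebra {0..} :: (real \<Rightarrow> 'm) measure"] by simp
  have e: "{\<omega> \<in> index_paths. \<forall>l\<in>{1..1}. \<omega> (t l) = j l} =
      {\<omega> \<in> index_paths. shifted_by (t 1) \<omega> \<in> {\<omega> \<in> index_paths. \<omega> 0 = j 1 \<and> \<omega> \<in> index_paths}}"
    using base by (auto simp: shifted_by_cadlag) (auto simp: shifted_by_def)
  have "{\<omega> \<in> index_paths. \<omega> 0 = j 1 \<and> \<omega> \<in> index_paths} \<in> sets (index_algebra {0..})"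
    using index_event[of 0 "{0..}" "j 1"] by (simp add: conj_commute cong: conj_cong)
  from law_from_shift[OF this base(1)]
  show ?case unfolding e
    using prob_space.prob_space[OF prob_law_from]
    by (simp add: law_from_at_0[OF B] if_distrib[of "\<lambda>x. _ * x"] cong: if_cong)
next
  case (Suc k)
  define t' where "t' l = t (l + 1) - t 1" for l
  define j' where "j' l = j (l + 1)" for l
  define B where "B = {\<omega> \<in> index_paths. \<forall>l\<in>{1..k}. \<omega> (t' l) = j' l}"
  have t1: "t 1 < t (l + 1)" if "l \<in> {1..k}" for l
    using that
  proof (induction l)
    case (Suc l)
    then have "l = 0 \<or> t 1 < t (l + 1)" by (cases l) auto
    moreover have "t (l + 1) < t (Suc l + 1)" using Suc.prems \<open>\<forall>l\<in>{1..<Suc k}. t l < t (l + 1)\<close> by simp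
    ultimately show ?case by auto
  qed simp
  have t'0: "0 < t' l" if "l \<in> {1..k}" for l using t1[OF that] by (simp add: t'_def)
  have B: "B \<in> sets (index_algebra {0..})"
  proof -
    have "B = (\<Inter>l\<in>{1..k}. {\<omega> \<in> index_paths. \<omega> (t' l) = j' l})" using Suc.hyps by (auto simp: B_def)
    also have "\<dots> \<in> sets (index_algebra {0..})"
      using Suc.hyps t'0 by (intro sets.finite_INT index_event) (auto intro: less_imp_le)
    finally show ?thesis .
  qed
  have split: "(\<forall>l\<in>{1..Suc k}. P l) \<longleftrightarrow> P 1 \<and> (\<forall>l\<in>{1..k}. P (l + 1))" for P :: "nat \<Rightarrow> bool"
  proof -
    have "P l" if h: "P 1" "\<forall>l\<in>{1..k}. P (l + 1)" and l: "l \<in> {1..Suc k}" for l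
    proof (cases "l = 1")
      case False
      then have "l - 1 \<in> {1..k}" using l by auto
      with h(2) have "P (l - 1 + 1)" by blast
      then show ?thesis using l by simp
    qed (use h in simp)
    then show ?thesis by auto
  qed
  have sh: "shifted_by (t 1) \<omega> 0 = \<omega> (t 1)" "l \<in> {1..k} \<Longrightarrow> shifted_by (t 1) \<omega> (t' l) = \<omega> (t (l + 1))" for \<omega> :: "real \<Rightarrow> 'm" and l
    using t'0[of l] by (auto simp: shifted_by_def t'_def)
  have e: "{\<omega> \<in> index_paths. \<forall>l\<in>{1..Suc k}. \<omega> (t l) = j l} =
      {\<omega> \<in> index_paths. shifted_by (t 1) \<omega> \<in> {\<omega> \<in> index_paths. \<omega> 0 = j 1 \<and> \<omega> \<in> B}}"
    unfolding split B_def using Suc.prems(1) by (auto simp: shifted_by_cadlag sh[simplified] j'_def)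
  have "{\<omega> \<in> index_paths. \<omega> 0 = j 1 \<and> \<omega> \<in> B} = {\<omega> \<in> index_paths. \<omega> 0 = j 1} \<inter> B" by auto
  also have "\<dots> \<in> sets (index_algebra {0..})" by (intro sets.Int index_event B) simp
  finally have "measure (law_from i) {\<omega> \<in> index_paths. \<forall>l\<in>{1..Suc k}. \<omega> (t l) = j l} =
      transition (t 1) i (j 1) * measure (law_from (j 1)) B"
    unfolding e by (subst law_from_shift[OF _ Suc.prems(1)])
      (simp_all add: law_from_at_0[OF B] if_distrib[of "\<lambda>x. _ * x"] cong: if_cong)
  also have "measure (law_from (j 1)) B = transition (t' 1) (j 1) (j' 1) *
    (\<Prod>l=2..k. transition (t' l - t' (l - 1)) (j' (l - 1)) (j' l))"
    unfolding B_def
  proof (rule Suc.IH)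
    show "0 \<le> t' 1" using t'0[of 1] Suc.hyps by simp
    show "\<forall>l\<in>{1..<k}. t' l < t' (l + 1)" using Suc.prems(2) by (simp add: t'_def)
  qed
  also have "\<dots> = (\<Prod>l=2..Suc k. transition (t l - t (l - 1)) (j (l - 1)) (j l))"
  proof -
    have "(\<Prod>l=2..Suc k. transition (t l - t (l - 1)) (j (l - 1)) (j l)) =
      (\<Prod>l=1..k. transition (t (Suc l) - t l) (j l) (j (Suc l)))"
      using prod.shift_bounds_cl_Suc_ivl[of "\<lambda>l. transition (t l - t (l - 1)) (j (l - 1)) (j l)" 1 k]
      by (simp add: numeral_2_eq_2)
    also have "\<dots> = transition (t 2 - t 1) (j 1) (j 2) * (\<Prod>l=2..k. transition (t (Suc l) - t l) (j l) (j (Suc l)))"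
      using Suc.hyps by (simp add: prod.atLeast_Suc_atMost numeral_2_eq_2)
    also have "(\<Prod>l=2..k. transition (t (Suc l) - t l) (j l) (j (Suc l))) =
        (\<Prod>l=2..k. transition (t' l - t' (l - 1)) (j' (l - 1)) (j' l))"
      by (intro prod.cong refl) (auto simp: t'_def j'_def)
    finally show ?thesis by (simp add: t'_def j'_def numeral_2_eq_2)
  qed
  finally show ?case .
qed

text \<open>The entries of the semigroup are probabilities of the chain; the power series hides their
  sign.\<close>

lemma chain_semigroup_nonneg:
  assumes "0 \<le> h" shows "0 \<le> transition h i j"
proof -
  have e: "{\<omega> \<in> index_paths. \<forall>l\<in>{1..1::nat}. \<omega> h = j} = {\<omega> \<in> index_paths. \<omega> h = j}" by auto
  have "measure (law_from i) {\<omega> \<in> index_paths. \<forall>l\<in>{1..1::nat}. \<omega> h = j} =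
      transition h i j * (\<Prod>l=2..1::nat. transition (h - h) j j)"
    using assms by (intro law_from_fdd[where t="\<lambda>_. h" and j="\<lambda>_. j"]) auto
  then have "transition h i j = measure (law_from i) {\<omega> \<in> index_paths. \<omega> h = j}"
    unfolding e by simp
  then show ?thesis by (simp only: measure_nonneg)
qed

lemma chain_semigroup_row_sum:
  assumes "0 \<le> h" shows "(\<Sum>j\<in>UNIV. transition h i j) = 1"
proof -
  have B: "index_paths \<in> sets (index_algebra {0..} :: (real \<Rightarrow> 'm) measure)"
    using sets.top[of "index_algebra {0..} :: (real \<Rightarrow> 'm) measure"] by simp
  have "{\<omega> \<in> index_paths. shifted_by h \<omega> \<in> index_paths} = (index_paths :: (real \<Rightarrow> 'm) set)"
    using assms by (auto simp: shifted_by_cadlag)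
  then show ?thesis using law_from_shift[OF B assms, of i] prob_space.prob_space[OF prob_law_from] by simp
qed

subsection \<open>Existence of path laws\<close>

definition mixture_law :: "real^'m \<Rightarrow> (real \<Rightarrow> 'm) measure" where
  "mixture_law a = measure_pmf (embed_pmf (\<lambda>i. a $ i)) \<bind> law_from"

lemma measurable_law_from: "law_from \<in> measurable (measure_pmf p) (subprob_algebra (index_algebra {0..}))"
  by (auto simp: space_subprob_algebra prob_law_from prob_space_imp_subprob_space)

lemma sets_mixture_law [simp]: "sets (mixture_law a) = sets (index_algebra {0..})"
  unfolding mixture_law_def by (rule sets_bind) auto

lemma prob_mixture_law: "prob_space (mixture_law a)"
  unfolding mixture_law_def
  by (rule measure_pmf.prob_space_bind[OF _ measurable_law_from]) (simp add: prob_law_from)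

lemma measure_mixture_law:
  assumes a: "a \<in> prob_simplex" and X: "X \<in> sets (index_algebra {0..})"
  shows "measure (mixture_law a) X = (\<Sum>i\<in>UNIV. a $ i * measure (law_from i) X)"
proof -
  have p: "pmf (embed_pmf (\<lambda>i. a $ i)) i = a $ i" for i
  proof (rule pmf_embed_pmf)
    show nn: "0 \<le> a $ i" for i using a by (simp add: prob_simplex_def)
    show "(\<integral>\<^sup>+i. ennreal (a $ i) \<partial>count_space UNIV) = 1"
      using a by (subst nn_integral_count_space_finite) (simp_all add: sum_ennreal[OF nn] prob_simplex_def del: sum_ennreal)
  qed
  show ?thesis
    unfolding mixture_law_def measure_pmf.measure_bind[OF measurable_law_from X]
    by (subst integral_measure_pmf[of UNIV]) (simp_all add: p)
qed

lemma is_path_law_mixture: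
  assumes a: "a \<in> prob_simplex"
  shows "is_path_law \<Lambda> a (mixture_law a)"
  unfolding is_path_law_def
proof (intro conjI allI impI)
  fix k :: nat and t :: "nat \<Rightarrow> real" and j :: "nat \<Rightarrow> 'm"
  assume k: "1 \<le> k" and t: "0 \<le> t 1 \<and> (\<forall>l\<in>{1..<k}. t l < t (l + 1))"
  have t0: "0 \<le> t l" if "l \<in> {1..k}" for l
    using that
  proof (induction l)
    case (Suc l)
    then show ?case using t by (cases l) (force intro: order_trans less_imp_le)+
  qed simp
  have X: "{\<omega> \<in> index_paths. \<forall>l\<in>{1..k}. \<omega> (t l) = j l} \<in> sets (index_algebra {0..})"
  proof -
    have "{\<omega> \<in> index_paths. \<forall>l\<in>{1..k}. \<omega> (t l) = j l} = (\<Inter>l\<in>{1..k}. {\<omega> \<in> index_paths. \<omega> (t l) = j l})" using k by auto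
    also have "\<dots> \<in> sets (index_algebra {0..})"
      using k t0 by (intro sets.finite_INT index_event) auto
    finally show ?thesis .
  qed
  show "measure (mixture_law a) {\<omega> \<in> index_paths. \<forall>l\<in>{1..k}. \<omega> (t l) = j l} =
        (a v* matrix_exp (- t 1 *\<^sub>R \<Lambda>)) $ j 1 *
        (\<Prod>l = 2..k. matrix_exp (- (t l - t (l - 1)) *\<^sub>R \<Lambda>) $ j (l - 1) $ j l)"
    unfolding measure_mixture_law[OF a X] chain_semigroup_def[symmetric]
    unfolding law_from_fdd[OF k conjunct1[OF t] conjunct2[OF t]]
    by (simp add: vector_matrix_mult_def sum_distrib_right mult_ac)
qed (simp_all add: prob_mixture_law)

lemma path_law_eq:
  assumes "a \<in> prob_simplex"
  shows "path_law \<Lambda> a = mixture_law a"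
  unfolding path_law_def
  by (rule the_equality) (auto intro: is_path_law_mixture path_law_unique assms)

end

section \<open>Expectations under a path law\<close>

locale chain = coupling \<Lambda> for \<Lambda> :: "real^'m::finite^'m" +
  fixes a :: "real^'m"
  assumes a: "a \<in> prob_simplex"
begin

abbreviation "P \<equiv> path_law \<Lambda> a"

lemma is_path_law: "is_path_law \<Lambda> a P"
  using is_path_law_mixture[OF a] path_law_eq[OF a] by simp

sublocale prob_space P
  using is_path_law by (simp add: is_path_law_def)

lemma sets_P [measurable_cong, simp]: "sets P = sets (index_algebra {0..})"
  using is_path_law by (simp add: is_path_law_def)

lemma space_P [simp]: "space P = index_paths"
  using sets_eq_imp_space_eq[OF sets_P] by simp

lemma prob_index_paths [simp]: "prob index_paths = 1"
  using prob_space by simp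

lemma fdd:
  fixes k :: nat and t :: "nat \<Rightarrow> real" and j :: "nat \<Rightarrow> 'm"
  assumes "1 \<le> k" "0 \<le> t 1" "\<forall>l\<in>{1..<k}. t l < t (l + 1)"
  shows "prob {\<omega> \<in> index_paths. \<forall>l\<in>{1..k}. \<omega> (t l) = j l} =
    (a v* chain_semigroup \<Lambda> (t 1)) $ j 1 * (\<Prod>l=2..k. transition (t l - t (l - 1)) (j (l - 1)) (j l))"
  using is_path_law assms unfolding is_path_law_def chain_semigroup_def by blast

lemma measurable_eval: "0 \<le> s \<Longrightarrow> (\<lambda>\<omega>. \<omega> s) \<in> measurable P (count_space UNIV)"
  using measurable_index_eval[of s "{0..}"] by (simp add: measurable_cong_sets[OF sets_P refl])

text \<open>A set that is null for one law with positive weights is null for the laws started at each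
  state, and hence for every law.\<close>

lemma almost_surely_AE:
  assumes "almost_surely \<Lambda> Q"
  shows "AE \<omega> in P. Q \<omega>"
proof -
  define b :: "real^'m" where "b = (\<chi> i. 1 / real CARD('m))"
  have b: "b \<in> prob_simplex" and b_pos: "\<And>i. 0 < b $ i" by (simp_all add: b_def prob_simplex_def)
  have "AE \<omega> in mixture_law b. Q \<omega>"
    using assms b b_pos unfolding almost_surely_def by (metis path_law_eq)
  then obtain N where N: "N \<in> null_sets (mixture_law b)" "{\<omega> \<in> space (mixture_law b). \<not> Q \<omega>} \<subseteq> N"
    by (rule AE_E) (auto simp: null_sets_def)
  have NS: "N \<in> sets (index_algebra {0..})" using N(1) by (simp add: null_sets_def)
  have "measure (mixture_law b) N = 0" using N(1) by (simp add: null_sets_def measure_def)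
  then have "(\<Sum>i\<in>UNIV. b $ i * measure (law_from i) N) = 0" by (simp add: measure_mixture_law[OF b NS])
  then have "b $ i * measure (law_from i) N = 0" for i
    using b_pos by (subst (asm) sum_nonneg_eq_0_iff) (auto intro!: mult_nonneg_nonneg less_imp_le[OF b_pos])
  then have "measure (law_from i) N = 0" for i using b_pos[of i] by (metis mult_eq_0_iff less_irrefl)
  then have "prob N = 0" by (simp add: path_law_eq[OF a] measure_mixture_law[OF a NS])
  then have null: "N \<in> null_sets P" using NS by (auto simp: null_sets_def emeasure_eq_measure)
  have "space (mixture_law b) = index_paths" using sets_eq_imp_space_eq[OF sets_mixture_law] by simp
  then have "{\<omega> \<in> space P. \<not> Q \<omega>} \<subseteq> N" using N(2) by simp
  from AE_I'[OF null this] show ?thesis .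
qed

subsection \<open>The Markov property\<close>

text \<open>Both sides are finite measures in \<open>A\<close>.  They agree on the cylinders among whose times is the
  present \<open>t\<close>, because there the finite-dimensional distribution factors, and these cylinders
  generate the events known at time \<open>t\<close>.\<close>

lemma markov_event:
  assumes t: "0 \<le> t" and h: "0 < h" and A: "A \<in> sets (index_algebra {0..t})"
  shows "emeasure P (A \<inter> {\<omega> \<in> index_paths. \<omega> (t + h) = j}) = (\<integral>\<^sup>+\<omega>. ennreal (transition h (\<omega> t) j) * indicator A \<omega> \<partial>P)"
proof -
  have t': "(\<lambda>\<omega>. \<omega> t) \<in> measurable P (count_space UNIV)" by (rule measurable_eval[OF t])
  have [measurable]: "(\<lambda>\<omega>. ennreal (transition h (\<omega> t) j)) \<in> borel_measurable P"
    by (rule measurable_compose[OF t']) simp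
  have th: "{\<omega> \<in> index_paths. \<omega> (t + h) = j} \<in> sets P"
    using t h index_event[of "t + h" "{0..}" j] by simp
  define F where "F = (index_algebra {0..t} :: (real \<Rightarrow> 'm) measure)"
  have sub: "sets F \<subseteq> sets P" using path_algebra_mono[of "{0..t}" "{0..}"] t by (auto simp: F_def)
  have id: "(\<lambda>\<omega>. \<omega>) \<in> measurable P F"
    using sub by (auto simp: measurable_def F_def)
  define N1 where "N1 = distr (density P (indicator {\<omega> \<in> index_paths. \<omega> (t + h) = j})) F (\<lambda>\<omega>. \<omega>)"
  define N2 where "N2 = distr (density P (\<lambda>\<omega>. ennreal (transition h (\<omega> t) j))) F (\<lambda>\<omega>. \<omega>)"
  have id': "(\<lambda>\<omega>. \<omega>) \<in> measurable (density P f) F" for f using id by (simp cong: measurable_cong_sets)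
  have N1: "emeasure N1 X = emeasure P (X \<inter> {\<omega> \<in> index_paths. \<omega> (t + h) = j})" if X: "X \<in> sets F" for X
  proof -
    have XP: "X \<in> sets P" using sub X by blast
    have "X \<subseteq> space P" using sets.sets_into_space[OF XP] .
    then have "emeasure N1 X = emeasure (density P (indicator {\<omega> \<in> index_paths. \<omega> (t + h) = j})) X"
      unfolding N1_def by (subst emeasure_distr[OF id' X]) (simp add: vimage_def Int_absorb2)
    also have "\<dots> = (\<integral>\<^sup>+\<omega>. indicator {\<omega> \<in> index_paths. \<omega> (t + h) = j} \<omega> * indicator X \<omega> \<partial>P)"
      by (rule emeasure_density[OF borel_measurable_indicator[OF th] XP])
    also have "\<dots> = (\<integral>\<^sup>+\<omega>. indicator (X \<inter> {\<omega> \<in> index_paths. \<omega> (t + h) = j}) \<omega> \<partial>P)"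
      by (intro nn_integral_cong) (auto simp: indicator_def)
    also have "\<dots> = emeasure P (X \<inter> {\<omega> \<in> index_paths. \<omega> (t + h) = j})" using XP th by simp
    finally show ?thesis .
  qed
  have N2: "emeasure N2 X = (\<integral>\<^sup>+\<omega>. ennreal (transition h (\<omega> t) j) * indicator X \<omega> \<partial>P)" if X: "X \<in> sets F" for X
  proof -
    have XP: "X \<in> sets P" using sub X by blast
    have "X \<subseteq> space P" using sets.sets_into_space[OF XP] .
    then have "emeasure N2 X = emeasure (density P (\<lambda>\<omega>. ennreal (transition h (\<omega> t) j))) X"
      unfolding N2_def by (subst emeasure_distr[OF id' X]) (simp add: vimage_def Int_absorb2)
    then show ?thesis using XP by (simp add: emeasure_density)
  qed
  have cyl: "emeasure N1 (cylinder G jj) = emeasure N2 (cylinder G jj)"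
    if G: "finite G" "G \<subseteq> {0..t}" "t \<in> G" for G and jj :: "real \<Rightarrow> 'm"
  proof -
    have cS: "cylinder G jj \<in> sets F" unfolding F_def using G by (intro cylinder_sets) auto
    have G': "G \<noteq> {}" "G \<subseteq> {0..}" using G t by auto
    obtain k :: nat and tt :: "nat \<Rightarrow> real" where kt: "k \<ge> 1" "0 \<le> tt 1"
        "\<forall>l\<in>{1..<k}. tt l < tt (l + 1)" "tt ` {1..k} = G" "tt k = Max G"
        "\<And>j :: real \<Rightarrow> 'm. cylinder G j = {\<omega> \<in> index_paths. \<forall>l\<in>{1..k}. \<omega> (tt l) = j (tt l)}"
      by (rule cylinder_enumerate[OF G(1) G']) blast
    have ttk: "tt k = t" unfolding kt(5) using G by (intro Max_eqI) auto
    define t2 where "t2 = tt(Suc k := t + h)"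
    define j2 where "j2 = (\<lambda>l. jj (tt l))(Suc k := j)"
    have "cylinder G jj \<inter> {\<omega> \<in> index_paths. \<omega> (t + h) = j} = {\<omega> \<in> index_paths. \<forall>l\<in>{1..Suc k}. \<omega> (t2 l) = j2 l}"
    proof -
      have "{1..Suc k} = insert (Suc k) {1..k}" by auto
      then show ?thesis unfolding kt(6) t2_def j2_def by auto
    qed
    then have "prob (cylinder G jj \<inter> {\<omega> \<in> index_paths. \<omega> (t + h) = j}) = prob {\<omega> \<in> index_paths. \<forall>l\<in>{1..Suc k}. \<omega> (t2 l) = j2 l}"
      by simp
    also have "\<dots> = (a v* chain_semigroup \<Lambda> (t2 1)) $ j2 1 *
         (\<Prod>l=2..Suc k. transition (t2 l - t2 (l - 1)) (j2 (l - 1)) (j2 l))"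
      using kt(1,2,3) h ttk by (intro fdd) (auto simp: t2_def less_Suc_eq)
    also have "(\<Prod>l=2..Suc k. transition (t2 l - t2 (l - 1)) (j2 (l - 1)) (j2 l)) =
        (\<Prod>l=2..k. transition (tt l - tt (l - 1)) (jj (tt (l - 1))) (jj (tt l))) * transition h (jj t) j"
    proof -
      have "(\<Prod>l=2..Suc k. transition (t2 l - t2 (l - 1)) (j2 (l - 1)) (j2 l)) =
         (\<Prod>l=2..k. transition (t2 l - t2 (l - 1)) (j2 (l - 1)) (j2 l)) * transition (t2 (Suc k) - t2 k) (j2 k) (j2 (Suc k))"
        using kt(1) by (subst prod.nat_ivl_Suc') (auto simp: mult.commute)
      also have "(\<Prod>l=2..k. transition (t2 l - t2 (l - 1)) (j2 (l - 1)) (j2 l)) =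
         (\<Prod>l=2..k. transition (tt l - tt (l - 1)) (jj (tt (l - 1))) (jj (tt l)))"
        by (intro prod.cong refl) (auto simp: t2_def j2_def)
      finally show ?thesis using kt(1) by (simp add: t2_def j2_def ttk)
    qed
    also have "(a v* chain_semigroup \<Lambda> (t2 1)) $ j2 1 * ((\<Prod>l=2..k. transition (tt l - tt (l - 1)) (jj (tt (l - 1))) (jj (tt l))) * transition h (jj t) j)
       = prob (cylinder G jj) * transition h (jj t) j"
      unfolding kt(6) using kt(1) by (subst fdd[OF kt(1,2,3)]) (auto simp: t2_def j2_def)
    finally have 1: "prob (cylinder G jj \<inter> {\<omega> \<in> index_paths. \<omega> (t + h) = j}) = prob (cylinder G jj) * transition h (jj t) j" .
    have "emeasure N2 (cylinder G jj) = (\<integral>\<^sup>+\<omega>. ennreal (transition h (jj t) j) * indicator (cylinder G jj) \<omega> \<partial>P)"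
      unfolding N2[OF cS] by (intro nn_integral_cong) (use G in \<open>auto simp: cylinder_def indicator_def\<close>)
    also have "\<dots> = ennreal (transition h (jj t) j) * emeasure P (cylinder G jj)"
      using sub cS by (intro nn_integral_cmult_indicator) auto
    also have "\<dots> = ennreal (prob (cylinder G jj) * transition h (jj t) j)"
      by (simp add: emeasure_eq_measure ennreal_mult' mult.commute)
    finally show ?thesis unfolding N1[OF cS] by (simp add: emeasure_eq_measure 1)
  qed
  \<comment> \<open>The whole path space is the disjoint union of the cylinders at the single time \<open>t\<close>.\<close>
  have whole: "emeasure N index_paths = (\<Sum>m\<in>UNIV. emeasure N (cylinder {t} (\<lambda>_. m)))" if "sets N = sets F" for N
  proof -
    have "(\<Union>m\<in>(UNIV :: 'm set). cylinder {t} (\<lambda>_. m)) = index_paths" by (auto simp: cylinder_def)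
    then show ?thesis using t
      by (subst sum_emeasure) (auto simp: that F_def disjoint_family_on_def intro!: cylinder_sets, auto simp: cylinder_def)
  qed
  have "N1 = N2"
  proof (rule measure_eqI_generator_eq[OF cylinders_Int_stable[of "{0..t}" t]])
    show "cylinders {0..t} t \<subseteq> Pow (index_paths :: (real \<Rightarrow> 'm) set)" by (auto simp: cylinders_def cylinder_def)
    show "sets N1 = sigma_sets index_paths (cylinders {0..t} t)" "sets N2 = sigma_sets index_paths (cylinders {0..t} t)"
      using t by (simp_all add: N1_def N2_def F_def sets_index_algebra_cylinders)
    show "range (\<lambda>_::nat. index_paths) \<subseteq> cylinders {0..t} t" by (auto simp: cylinders_def)
    show "emeasure N1 index_paths \<noteq> \<infinity>"
      using sets.top[of F] by (subst N1) (auto simp: F_def emeasure_eq_measure)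
    fix X :: "(real \<Rightarrow> 'm) set" assume "X \<in> cylinders {0..t} t"
    then consider "X = {}" | "X = index_paths" | G jj where "finite G" "G \<subseteq> {0..t}" "t \<in> G" "X = cylinder G jj"
      by (auto simp: cylinders_def)
    then show "emeasure N1 X = emeasure N2 X"
    proof cases
      case 2
      show ?thesis unfolding 2 using t by (subst (1 2) whole) (auto simp: N1_def N2_def intro!: sum.cong cyl[unfolded N1_def N2_def])
    next
      case 3 then show ?thesis by (simp add: cyl)
    qed simp
  qed auto
  then show ?thesis using N1[of A] N2[of A] A by (simp add: F_def)
qed

text \<open>The Markov property in the form used for the dynamics: a payoff chosen with the information
  available at time \<open>t\<close> and evaluated at the state at time \<open>t + h\<close>.\<close>

lemma markov_expectation:
  assumes t: "0 \<le> t" and h: "0 < h"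
    and Y: "\<And>j. Y j \<in> borel_measurable (index_algebra {0..t})"
    and bound: "\<And>j \<omega>. \<omega> \<in> index_paths \<Longrightarrow> \<bar>Y j \<omega>\<bar> \<le> K"
  shows "integrable P (\<lambda>\<omega>. Y (\<omega> (t + h)) \<omega>)"
    and "integrable P (\<lambda>\<omega>. \<Sum>j\<in>UNIV. transition h (\<omega> t) j * Y j \<omega>)"
    and "expectation (\<lambda>\<omega>. Y (\<omega> (t + h)) \<omega>) = expectation (\<lambda>\<omega>. \<Sum>j\<in>UNIV. transition h (\<omega> t) j * Y j \<omega>)"
proof -
  have tm: "(\<lambda>\<omega>. \<omega> t) \<in> measurable P (count_space UNIV)" "(\<lambda>\<omega>. \<omega> (t + h)) \<in> measurable P (count_space UNIV)"
    using t h by (auto intro!: measurable_eval)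
  define F where "F = (index_algebra {0..t} :: (real \<Rightarrow> 'm) measure)"
  have sub: "sets F \<subseteq> sets P" using path_algebra_mono[of "{0..t}" "{0..}"] t by (auto simp: F_def)
  have id: "(\<lambda>\<omega>. \<omega>) \<in> measurable P F"
    using sub by (auto simp: measurable_def F_def)
  have YP [measurable]: "Y j \<in> borel_measurable P" for j
    using measurable_compose[OF id, of "Y j" borel] Y by (simp add: F_def)
  have Em [measurable]: "(\<lambda>\<omega>. transition h (\<omega> t) j) \<in> borel_measurable P" for j
    by (rule measurable_compose[OF tm(1)]) simp
  have Im [measurable]: "(\<lambda>\<omega>. indicator {j} (\<omega> (t + h)) :: real) \<in> borel_measurable P" for j
    by (rule measurable_compose[OF tm(2)]) simp
  have E01: "0 \<le> transition h i j" "transition h i j \<le> 1" for i j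
  proof -
    show "0 \<le> transition h i j" using h by (intro chain_semigroup_nonneg) simp
    have "transition h i j \<le> (\<Sum>j\<in>UNIV. transition h i j)"
      using h by (intro member_le_sum chain_semigroup_nonneg) auto
    then show "transition h i j \<le> 1" using h by (simp add: chain_semigroup_row_sum)
  qed
  have int1: "integrable P (\<lambda>\<omega>. indicator {j} (\<omega> (t + h)) * Y j \<omega>)" for j
  proof (rule integrable_const_bound[where B=K])
    show "AE \<omega> in P. norm (indicator {j} (\<omega> (t + h)) * Y j \<omega>) \<le> K"
    proof (rule AE_I2)
      fix \<omega> assume "\<omega> \<in> space P"
      then have "\<bar>Y j \<omega>\<bar> \<le> K" using bound by simp
      then show "norm (indicator {j} (\<omega> (t + h)) * Y j \<omega>) \<le> K" by (auto simp: indicator_def)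
    qed
  qed (rule borel_measurable_times[OF Im YP])
  have int2: "integrable P (\<lambda>\<omega>. transition h (\<omega> t) j * Y j \<omega>)" for j
  proof (rule integrable_const_bound[where B=K])
    show "AE \<omega> in P. norm (transition h (\<omega> t) j * Y j \<omega>) \<le> K"
    proof (rule AE_I2)
      fix \<omega> assume "\<omega> \<in> space P"
      then have "\<bar>transition h (\<omega> t) j\<bar> * \<bar>Y j \<omega>\<bar> \<le> 1 * K"
        using E01 bound[of \<omega> j] by (intro mult_mono) auto
      then show "norm (transition h (\<omega> t) j * Y j \<omega>) \<le> K" by (simp add: abs_mult)
    qed
  qed measurable
  have eq: "expectation (\<lambda>\<omega>. indicator {j} (\<omega> (t + h)) * Y j \<omega>) = expectation (\<lambda>\<omega>. transition h (\<omega> t) j * Y j \<omega>)" for j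
  proof -
    define N1 where "N1 = distr (density P (\<lambda>\<omega>. ennreal (indicator {j} (\<omega> (t + h))))) F (\<lambda>\<omega>. \<omega>)"
    define N2 where "N2 = distr (density P (\<lambda>\<omega>. ennreal (transition h (\<omega> t) j))) F (\<lambda>\<omega>. \<omega>)"
    have id': "(\<lambda>\<omega>. \<omega>) \<in> measurable (density P f) F" for f using id by (simp cong: measurable_cong_sets)
    have "N1 = N2"
    proof (rule measure_eqI)
      fix X assume "X \<in> sets N1"
      then have X: "X \<in> sets F" by (simp add: N1_def)
      then have XP: "X \<in> sets P" using sub by blast
      have XS: "X \<subseteq> space P" using sets.sets_into_space[OF XP] .
      have th: "{\<omega> \<in> index_paths. \<omega> (t + h) = j} \<in> sets P"
        using t h index_event[of "t + h" "{0..}" j] by simp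
      have "emeasure N1 X = (\<integral>\<^sup>+\<omega>. ennreal (indicator {j} (\<omega> (t + h))) * indicator X \<omega> \<partial>P)"
        unfolding N1_def using XS XP by (subst emeasure_distr[OF id' X]) (simp add: vimage_def Int_absorb2 emeasure_density)
      also have "\<dots> = (\<integral>\<^sup>+\<omega>. indicator (X \<inter> {\<omega> \<in> index_paths. \<omega> (t + h) = j}) \<omega> \<partial>P)"
        by (intro nn_integral_cong) (auto simp: indicator_def)
      also have "\<dots> = emeasure P (X \<inter> {\<omega> \<in> index_paths. \<omega> (t + h) = j})" using XP th by simp
      also have "\<dots> = (\<integral>\<^sup>+\<omega>. ennreal (transition h (\<omega> t) j) * indicator X \<omega> \<partial>P)"
        using X by (intro markov_event t h) (simp add: F_def)
      also have "\<dots> = emeasure N2 X"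
        unfolding N2_def using XS XP by (subst emeasure_distr[OF id' X]) (simp add: vimage_def Int_absorb2 emeasure_density)
      finally show "emeasure N1 X = emeasure N2 X" .
    qed (simp add: N1_def N2_def)
    moreover have "integral\<^sup>L N1 (Y j) = expectation (\<lambda>\<omega>. indicator {j} (\<omega> (t + h)) * Y j \<omega>)"
      unfolding N1_def using Y by (subst integral_distr[OF id']) (simp_all add: F_def integral_density)
    moreover have "integral\<^sup>L N2 (Y j) = expectation (\<lambda>\<omega>. transition h (\<omega> t) j * Y j \<omega>)"
      unfolding N2_def using Y E01 by (subst integral_distr[OF id']) (simp_all add: F_def integral_density)
    ultimately show ?thesis by simp
  qed
  have dec: "Y (\<omega> (t + h)) \<omega> = (\<Sum>j\<in>UNIV. indicator {j} (\<omega> (t + h)) * Y j \<omega>)" for \<omega>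
    by (simp add: indicator_def if_distrib[of "\<lambda>x. x * _"] of_bool_def cong: if_cong)
  show "integrable P (\<lambda>\<omega>. Y (\<omega> (t + h)) \<omega>)" unfolding dec by (intro Bochner_Integration.integrable_sum int1)
  show "integrable P (\<lambda>\<omega>. \<Sum>j\<in>UNIV. transition h (\<omega> t) j * Y j \<omega>)"
    by (intro Bochner_Integration.integrable_sum int2)
  show "expectation (\<lambda>\<omega>. Y (\<omega> (t + h)) \<omega>) = expectation (\<lambda>\<omega>. \<Sum>j\<in>UNIV. transition h (\<omega> t) j * Y j \<omega>)"
  proof -
    have "expectation (\<lambda>\<omega>. Y (\<omega> (t + h)) \<omega>) = (\<Sum>j\<in>UNIV. expectation (\<lambda>\<omega>. indicator {j} (\<omega> (t + h)) * Y j \<omega>))"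
      unfolding dec by (rule Bochner_Integration.integral_sum[OF int1])
    also have "\<dots> = (\<Sum>j\<in>UNIV. expectation (\<lambda>\<omega>. transition h (\<omega> t) j * Y j \<omega>))" by (simp only: eq)
    also have "\<dots> = expectation (\<lambda>\<omega>. \<Sum>j\<in>UNIV. transition h (\<omega> t) j * Y j \<omega>)"
      by (rule Bochner_Integration.integral_sum[OF int2, symmetric])
    finally show ?thesis .
  qed
qed

text \<open>The probability of being in the same state after time \<open>h\<close> is a diagonal entry of the
  semigroup, hence \<open>1 - O(h)\<close>.\<close>

lemma markov_change:
  obtains C where "0 \<le> C" "\<And>t r. 0 \<le> t \<Longrightarrow> t \<le> r \<Longrightarrow> prob {\<omega> \<in> index_paths. \<omega> r \<noteq> \<omega> t} \<le> C * (r - t)"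
proof -
  obtain d where d: "0 < d" "\<And>h i j. 0 \<le> h \<Longrightarrow> h \<le> d \<Longrightarrow>
     \<bar>transition h i j - mat 1 $ i $ j + h * \<Lambda> $ i $ j\<bar> \<le> 1 * h"
    using chain_semigroup_expansion[of 1 \<Lambda>] by auto
  \<comment> \<open>For \<open>h \<le> d\<close> the expansion at \<open>0\<close> gives the slope \<open>rate + 1\<close>; for \<open>h > d\<close> the trivial
     bound \<open>1\<close> is at most \<open>h / d\<close>.\<close>
  define C where "C = max (rate + 1) (1 / d)"
  have C: "0 \<le> C" using d(1) by (simp add: C_def le_max_iff_disj)
  have diag: "1 - transition h i i \<le> C * h" if h: "0 \<le> h" for h i
  proof (cases "h \<le> d")
    case True
    have "1 - transition h i i \<le> h * \<Lambda> $ i $ i + h"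
      using d(2)[OF h True, of i i] by (simp add: mat_def)
    also have "\<dots> \<le> (rate + 1) * h" using rate_diag[of i] h by (simp add: algebra_simps mult_left_mono)
    also have "\<dots> \<le> C * h" using h by (intro mult_right_mono) (auto simp: C_def)
    finally show ?thesis .
  next
    case False
    have "1 - transition h i i \<le> 1" using chain_semigroup_nonneg[OF h] by simp
    also have "\<dots> \<le> 1 / d * h" using False d(1) by (simp add: field_simps)
    also have "\<dots> \<le> C * h" using h by (intro mult_right_mono) (auto simp: C_def)
    finally show ?thesis .
  qed
  have "prob {\<omega> \<in> index_paths. \<omega> r \<noteq> \<omega> t} \<le> C * (r - t)" if t: "0 \<le> t" and r: "t \<le> r" for t r
  proof (cases "r = t")
    case False
    define h where "h = r - t"
    have h: "0 < h" "r = t + h" using False r by (auto simp: h_def)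
    define Y where "Y j \<omega> = (indicator {j} (\<omega> t) :: real)" for j :: 'm and \<omega> :: "real \<Rightarrow> 'm"
    have Y: "Y j \<in> borel_measurable (index_algebra {0..t})" for j
      unfolding Y_def[abs_def] by (rule measurable_compose[OF measurable_index_eval]) (use t in simp_all)
    have Yb: "\<bar>Y j \<omega>\<bar> \<le> 1" for j \<omega> by (simp add: Y_def indicator_def)
    note M = markov_expectation[OF t h(1), of Y 1, OF Y Yb]
    have "prob {\<omega> \<in> index_paths. \<omega> r \<noteq> \<omega> t} = expectation (\<lambda>\<omega>. indicator {\<omega> \<in> index_paths. \<omega> r \<noteq> \<omega> t} \<omega>)"
      unfolding Bochner_Integration.integral_indicator by (rule arg_cong[where f=prob]) auto
    also have "\<dots> = expectation (\<lambda>\<omega>. 1 - Y (\<omega> (t + h)) \<omega>)"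
      by (intro Bochner_Integration.integral_cong) (auto simp: Y_def indicator_def h(2))
    also have "\<dots> = 1 - expectation (\<lambda>\<omega>. \<Sum>j\<in>UNIV. transition h (\<omega> t) j * Y j \<omega>)"
      using M by (simp add: prob_space)
    also have "\<dots> = expectation (\<lambda>\<omega>. 1 - (\<Sum>j\<in>UNIV. transition h (\<omega> t) j * Y j \<omega>))"
      using M by (simp add: prob_space)
    also have "\<dots> \<le> expectation (\<lambda>\<omega>. C * h)"
    proof (intro integral_mono)
      fix \<omega>
      have "(\<Sum>j\<in>UNIV. transition h (\<omega> t) j * Y j \<omega>) = transition h (\<omega> t) (\<omega> t)"
        by (simp add: Y_def indicator_def if_distrib[of "\<lambda>x. _ * x"] of_bool_def cong: if_cong)
      then show "1 - (\<Sum>j\<in>UNIV. transition h (\<omega> t) j * Y j \<omega>) \<le> C * h"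
        using diag[of h "\<omega> t"] h by simp
    qed (use M in auto)
    finally show ?thesis by (simp add: prob_space h_def)
  qed simp
  then show thesis using C by (intro that)
qed

lemma measurable_time_away:
  assumes t: "0 \<le> t"
  shows "(\<lambda>(\<omega>, s). indicator {t..r} s * of_bool (\<omega> s \<noteq> \<omega> t) :: real) \<in> borel_measurable (P \<Otimes>\<^sub>M lborel)"
proof -
  have j: "(\<lambda>z. fst z (snd z)) \<in> measurable (P \<Otimes>\<^sub>M lborel) (count_space UNIV)"
  proof -
    have "(\<lambda>(\<omega>, s). \<omega> s) \<in> measurable (P \<Otimes>\<^sub>M lborel) (count_space (UNIV :: 'm set))"
      using measurable_index_eval_joint[where 'm='m]
      by (simp cong: measurable_cong_sets sets_pair_measure_cong)
    then show ?thesis by (simp add: case_prod_unfold)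
  qed
  have k: "(\<lambda>z. fst z t) \<in> measurable (P \<Otimes>\<^sub>M lborel) (count_space UNIV)"
    by (rule measurable_compose[OF measurable_fst measurable_eval[OF t]])
  have "(\<lambda>z. if fst z (snd z) \<noteq> fst z t then 1 else 0 :: real) \<in> borel_measurable (P \<Otimes>\<^sub>M lborel)"
    using j k by measurable
  moreover have "(\<lambda>z. indicator {t..r} (snd z) :: real) \<in> borel_measurable (P \<Otimes>\<^sub>M lborel)" by measurable
  ultimately have "(\<lambda>z. (if fst z (snd z) \<noteq> fst z t then 1 else 0) * indicator {t..r} (snd z) :: real) \<in> borel_measurable (P \<Otimes>\<^sub>M lborel)"
    by (rule borel_measurable_times)
  then show ?thesis by (simp add: case_prod_unfold of_bool_def mult.commute)
qed

text \<open>By Fubini's theorem the expected time spent away from the state at time \<open>t\<close> is the integral of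
  probabilities of order \<open>h\<close> over an interval of length \<open>h\<close>.\<close>

lemma expected_time_away:
  obtains C where "0 \<le> C"
    "\<And>t h. 0 \<le> t \<Longrightarrow> 0 \<le> h \<Longrightarrow> prob {\<omega> \<in> index_paths. \<omega> (t + h) \<noteq> \<omega> t} \<le> C * h"
    "\<And>t h. 0 \<le> t \<Longrightarrow> 0 \<le> h \<Longrightarrow> integrable P (\<lambda>\<omega>. LBINT s:{t..t+h}. of_bool (\<omega> s \<noteq> \<omega> t) :: real)"
    "\<And>t h. 0 \<le> t \<Longrightarrow> 0 \<le> h \<Longrightarrow> expectation (\<lambda>\<omega>. LBINT s:{t..t+h}. of_bool (\<omega> s \<noteq> \<omega> t)) \<le> C * h * h"
proof -
  obtain C where C: "0 \<le> C" "\<And>t r. 0 \<le> t \<Longrightarrow> t \<le> r \<Longrightarrow> prob {\<omega> \<in> index_paths. \<omega> r \<noteq> \<omega> t} \<le> C * (r - t)"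
    using markov_change by blast
  interpret pair_sigma_finite P lborel ..
  have main: "integrable P (\<lambda>\<omega>. LBINT s:{t..t+h}. of_bool (\<omega> s \<noteq> \<omega> t) :: real) \<and>
      expectation (\<lambda>\<omega>. LBINT s:{t..t+h}. of_bool (\<omega> s \<noteq> \<omega> t)) \<le> C * h * h"
    if t: "0 \<le> t" and h: "0 \<le> h" for t h
  proof -
    define f where "f \<omega> s = (indicator {t..t+h} s * of_bool (\<omega> s \<noteq> \<omega> t) :: real)" for \<omega> :: "real \<Rightarrow> 'm" and s
    have int: "integrable (P \<Otimes>\<^sub>M lborel) (case_prod f)"
    proof (rule integrableI_bounded_set[where A="index_paths \<times> {t..t+h}" and B=1])
      show "index_paths \<times> {t..t+h} \<in> sets (P \<Otimes>\<^sub>M lborel)"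
        using sets.top[of P] by (intro pair_measureI) auto
      show "case_prod f \<in> borel_measurable (P \<Otimes>\<^sub>M lborel)"
      proof -
        have "case_prod f = (\<lambda>(\<omega>, s). indicator {t..t+h} s * of_bool (\<omega> s \<noteq> \<omega> t))"
          by (auto simp: f_def fun_eq_iff)
        then show ?thesis using measurable_time_away[OF t, of "t+h"] by (simp only:)
      qed
      have "emeasure (P \<Otimes>\<^sub>M lborel) (index_paths \<times> {t..t+h}) = emeasure P index_paths * emeasure lborel {t..t+h}"
        using sets.top[of P] by (intro lborel.emeasure_pair_measure_Times) auto
      then show "emeasure (P \<Otimes>\<^sub>M lborel) (index_paths \<times> {t..t+h}) < \<infinity>"
        using h by (simp add: emeasure_eq_measure)
    qed (auto simp: f_def indicator_def space_pair_measure intro!: AE_I2)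
    have eq: "(LBINT s:{t..t+h}. of_bool (\<omega> s \<noteq> \<omega> t)) = (\<integral>s. f \<omega> s \<partial>lborel)" for \<omega> :: "real \<Rightarrow> 'm"
      by (simp add: f_def set_lebesgue_integral_def)
    have "integrable P (\<lambda>\<omega>. \<integral>s. f \<omega> s \<partial>lborel)"
      using integrable_fst[OF int] by simp
    moreover have "expectation (\<lambda>\<omega>. \<integral>s. f \<omega> s \<partial>lborel) \<le> C * h * h"
    proof -
      have "expectation (\<lambda>\<omega>. \<integral>s. f \<omega> s \<partial>lborel) = (\<integral>s. expectation (\<lambda>\<omega>. f \<omega> s) \<partial>lborel)"
        by (rule Fubini_integral[OF int, symmetric])
      also have "\<dots> \<le> (\<integral>s. indicator {t..t+h} s * (C * h) \<partial>lborel)"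
      proof (rule integral_mono)
        show "integrable lborel (\<lambda>s. expectation (\<lambda>\<omega>. f \<omega> s))" using integrable_snd[OF int] by simp
        show "integrable lborel (\<lambda>s. indicator {t..t+h} s * (C * h))"
          using h by (intro integrable_mult_left integrable_real_indicator) (auto simp: emeasure_lborel_Icc_eq)
        fix s
        show "expectation (\<lambda>\<omega>. f \<omega> s) \<le> indicator {t..t+h} s * (C * h)"
        proof (cases "s \<in> {t..t+h}")
          case True
          have "expectation (\<lambda>\<omega>. f \<omega> s) = expectation (\<lambda>\<omega>. indicator {\<omega> \<in> index_paths. \<omega> s \<noteq> \<omega> t} \<omega>)"
            using True by (intro Bochner_Integration.integral_cong) (auto simp: f_def indicator_def)
          also have "\<dots> = prob {\<omega> \<in> index_paths. \<omega> s \<noteq> \<omega> t}"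
            unfolding Bochner_Integration.integral_indicator by (rule arg_cong[where f="measure P"]) auto
          also have "\<dots> \<le> C * (s - t)" using True t by (intro C(2)) auto
          also have "\<dots> \<le> C * h" using True C(1) by (intro mult_left_mono) auto
          finally show ?thesis using True by simp
        qed (simp add: f_def)
      qed
      also have "\<dots> = C * h * h" using h by simp
      finally show ?thesis .
    qed
    ultimately show ?thesis unfolding eq by blast
  qed
  show thesis
  proof (rule that[OF C(1)])
    show "prob {\<omega> \<in> index_paths. \<omega> (t + h) \<noteq> \<omega> t} \<le> C * h" if "0 \<le> t" "0 \<le> h" for t h
      using C(2)[of t "t+h"] that by simp
  qed (use main in blast)+
qed

end

section \<open>The subsolution inequality along controlled curves\<close>

locale controlled = hamiltonian H + chain \<Lambda> a
  for H :: "'m::finite \<Rightarrow> 'n::finite torus \<Rightarrow> real^'n \<Rightarrow> real" and \<Lambda> :: "real^'m^'m" and a :: "real^'m" +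
  fixes \<Xi> :: "(real \<Rightarrow> 'm) \<Rightarrow> real \<Rightarrow> real^'n" and x0 :: "real^'n" and \<alpha> :: real
  assumes control: "control \<Lambda> \<Xi>"
begin

text \<open>The controlled trajectory, lifted to Euclidean space.\<close>

definition curve :: "(real \<Rightarrow> 'm) \<Rightarrow> real \<Rightarrow> real^'n" where
  "curve \<omega> t = x0 + primitive (\<Xi> \<omega>) t"

definition cost :: "(real \<Rightarrow> 'm) \<Rightarrow> real \<Rightarrow> real" where
  "cost \<omega> s = lagrangian H (\<omega> s) (to_torus (curve \<omega> s)) (- \<Xi> \<omega> s) + \<alpha>"

lemma measurable_control: "\<Xi> \<in> measurable P (path_algebra euclidean {0..})"
  using control by (simp add: control_def measurable_cong_sets[OF sets_P refl])

lemma control_cadlag: "\<omega> \<in> index_paths \<Longrightarrow> \<Xi> \<omega> \<in> cadlag_paths euclidean"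
  using measurable_space[OF measurable_control] by simp

lemma control_nonanticipating:
  assumes "\<omega> \<in> index_paths" "\<omega>' \<in> index_paths" "0 < t" "\<And>s. s \<in> {0..t} \<Longrightarrow> \<omega> s = \<omega>' s" "s \<in> {0..t}"
  shows "\<Xi> \<omega> s = \<Xi> \<omega>' s"
proof -
  have "\<forall>t>0. \<forall>\<omega>1\<in>index_paths. \<forall>\<omega>2\<in>index_paths. (\<forall>s\<in>{0..t}. \<omega>1 s = \<omega>2 s) \<longrightarrow> (\<forall>s\<in>{0..t}. \<Xi> \<omega>1 s = \<Xi> \<omega>2 s)"
    using control unfolding control_def by blast
  then show ?thesis using assms by meson
qed

lemma control_bounded:
  assumes "0 < T"
  obtains R where "0 < R" "AE \<omega> in P. \<forall>s\<in>{0..T}. norm (\<Xi> \<omega> s) \<le> R"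
proof -
  obtain R where R: "R > 0" "almost_surely \<Lambda> (\<lambda>\<omega>. (SUP s\<in>{0..T}. norm (\<Xi> \<omega> s)) < R)"
    using control assms unfolding control_def by blast
  have "AE \<omega> in P. \<forall>s\<in>{0..T}. norm (\<Xi> \<omega> s) \<le> R"
    using almost_surely_AE[OF R(2)] AE_space
  proof eventually_elim
    case (elim \<omega>)
    show ?case
    proof
      fix s assume s: "s \<in> {0..T}"
      obtain B where "\<And>s. s \<in> {0..T} \<Longrightarrow> norm (\<Xi> \<omega> s) \<le> B"
        using cadlag_bounded[OF control_cadlag, of \<omega> T] elim(2) assms by auto
      then have "norm (\<Xi> \<omega> s) \<le> (SUP s\<in>{0..T}. norm (\<Xi> \<omega> s))"
        using s by (intro cSUP_upper bdd_aboveI2[where M=B])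
      then show "norm (\<Xi> \<omega> s) \<le> R" using elim(1) by simp
    qed
  qed
  then show thesis using R(1) that by blast
qed

lemma measurable_control_joint: "(\<lambda>(\<omega>, s). \<Xi> \<omega> s) \<in> borel_measurable (P \<Otimes>\<^sub>M borel)"
proof -
  have "(\<lambda>z. (\<Xi> (fst z), snd z)) \<in> measurable (P \<Otimes>\<^sub>M borel) (path_algebra euclidean {0..} \<Otimes>\<^sub>M borel)"
    by (intro measurable_Pair measurable_compose[OF measurable_fst measurable_control] measurable_snd)
  from measurable_compose[OF this measurable_cadlag_eval_joint] show ?thesis by (simp add: case_prod_unfold)
qed

text \<open>Up to time \<open>t\<close> the curve depends only on the path frozen at time \<open>t\<close>; in this way the
  pathwise nonanticipation of the control yields adaptedness.\<close>

lemma measurable_curve: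
  assumes t: "0 \<le> t"
  shows "(\<lambda>\<omega>. curve \<omega> t) \<in> borel_measurable (index_algebra {0..t})"
proof -
  have "(\<lambda>(\<omega>, s). indicator {0..t} s *\<^sub>R \<Xi> \<omega> s) \<in> borel_measurable (P \<Otimes>\<^sub>M lborel)"
  proof -
    have "(\<lambda>z. indicator {0..t} (snd z) *\<^sub>R (case z of (\<omega>, s) \<Rightarrow> \<Xi> \<omega> s)) \<in> borel_measurable (P \<Otimes>\<^sub>M borel)"
      by (intro borel_measurable_scaleR measurable_control_joint) measurable
    then show ?thesis by (simp add: case_prod_unfold cong: measurable_cong_sets sets_pair_measure_cong)
  qed
  from lborel.borel_measurable_lebesgue_integral[OF this]
  have "(\<lambda>\<omega>. primitive (\<Xi> \<omega>) t) \<in> borel_measurable P"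
    by (simp add: primitive_def set_lebesgue_integral_def)
  then have "(\<lambda>\<omega>. primitive (\<Xi> \<omega>) t) \<in> borel_measurable (index_algebra {0..})"
    by (simp cong: measurable_cong_sets)
  from measurable_compose[OF measurable_frozen_at[OF t] this]
  have "(\<lambda>\<omega>. x0 + primitive (\<Xi> (frozen_at t \<omega>)) t) \<in> borel_measurable (index_algebra {0..t})" by simp
  then show ?thesis
  proof (rule measurable_cong[THEN iffD1, rotated])
    fix \<omega> :: "real \<Rightarrow> 'm" assume "\<omega> \<in> space (index_algebra {0..t})"
    then have \<omega>: "\<omega> \<in> index_paths" by simp
    note f = frozen_at_cadlag[OF \<omega> t]
    have "primitive (\<Xi> (frozen_at t \<omega>)) t = primitive (\<Xi> \<omega>) t"
    proof (cases "t = 0")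
      case True
      show ?thesis unfolding True
        by (simp add: primitive_0[OF control_cadlag[OF f[unfolded True]]] primitive_0[OF control_cadlag[OF \<omega>]])
    next
      case False
      have "\<Xi> (frozen_at t \<omega>) s = \<Xi> \<omega> s" if "s \<in> {0..t}" for s
        using False t that by (intro control_nonanticipating[OF f \<omega>, of t]) (auto simp: frozen_at_def)
      then show ?thesis unfolding primitive_def by (intro set_lebesgue_integral_cong) auto
    qed
    then show "x0 + primitive (\<Xi> (frozen_at t \<omega>)) t = curve \<omega> t" by (simp add: curve_def)
  qed
qed

lemma curve_continuous: "\<omega> \<in> index_paths \<Longrightarrow> continuous_on {0..t} (curve \<omega>)"
  unfolding curve_def by (intro continuous_intros primitive_continuous control_cadlag)

lemma measurable_curve_joint: "(\<lambda>(\<omega>, s). curve \<omega> s) \<in> borel_measurable (P \<Otimes>\<^sub>M borel)"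
proof (rule right_continuous_joint_measurable[where c=x0])
  fix s :: real assume s: "0 \<le> s"
  show "(\<lambda>\<omega>. curve \<omega> s) \<in> borel_measurable P"
    using measurable_path_algebra_mono[OF _ measurable_curve[OF s], of "{0..}"]
    by (simp cong: measurable_cong_sets)
next
  fix \<omega> and s :: real assume \<omega>: "\<omega> \<in> space P" and s: "0 \<le> s"
  then have "(curve \<omega> \<longlongrightarrow> curve \<omega> s) (at s within {0..s+1})"
    using curve_continuous[of \<omega> "s+1"] by (simp add: continuous_on_def)
  then have "(curve \<omega> \<longlongrightarrow> curve \<omega> s) (at s within {s..s+1})" by (rule tendsto_within_subset) (use s in auto)
  then show "(curve \<omega> \<longlongrightarrow> curve \<omega> s) (at_right s)" by (simp add: at_within_Icc_at_right)
qed (simp add: curve_def primitive_def set_lebesgue_integral_def)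

lemma measurable_index_joint: "(\<lambda>(\<omega>, s). \<omega> s) \<in> measurable (P \<Otimes>\<^sub>M borel) (count_space UNIV)"
  using measurable_index_eval_joint[where 'm='m]
  by (simp cong: measurable_cong_sets sets_pair_measure_cong)

text \<open>The running cost has this form.  Finiteness of the state space reduces its measurability to
  that of one continuous function for each state.\<close>

lemma measurable_state_dependent:
  fixes g :: "'m \<Rightarrow> (real^'n) \<times> (real^'n) \<Rightarrow> real"
  assumes "\<And>i. continuous_on UNIV (g i)"
  shows "(\<lambda>(\<omega>, s). g (\<omega> s) (curve \<omega> s, \<Xi> \<omega> s)) \<in> borel_measurable (P \<Otimes>\<^sub>M borel)"
proof -
  have "(\<lambda>z. (case z of (\<omega>, s) \<Rightarrow> curve \<omega> s, case z of (\<omega>, s) \<Rightarrow> \<Xi> \<omega> s)) \<in> measurable (P \<Otimes>\<^sub>M borel) (borel \<Otimes>\<^sub>M borel)"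
    by (intro measurable_Pair measurable_curve_joint measurable_control_joint)
  then have pair: "(\<lambda>z. (curve (fst z) (snd z), \<Xi> (fst z) (snd z))) \<in> borel_measurable (P \<Otimes>\<^sub>M borel)"
    by (simp add: case_prod_unfold borel_prod)
  have g: "(\<lambda>z. g i (curve (fst z) (snd z), \<Xi> (fst z) (snd z))) \<in> borel_measurable (P \<Otimes>\<^sub>M borel)" for i
    by (rule measurable_compose[OF pair borel_measurable_continuous_onI[OF assms]])
  have "(\<lambda>z. g (case z of (\<omega>, s) \<Rightarrow> \<omega> s) (curve (fst z) (snd z), \<Xi> (fst z) (snd z))) \<in> borel_measurable (P \<Otimes>\<^sub>M borel)"
    by (rule measurable_compose_countable[OF g measurable_index_joint])
  then show ?thesis by (simp add: case_prod_unfold)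
qed

lemma time_away_integrable:
  fixes \<omega> :: "real \<Rightarrow> 'm" and i :: 'm
  assumes "\<omega> \<in> index_paths"
  shows "set_integrable lborel {r..t} (\<lambda>s. of_bool (\<omega> s \<noteq> i) :: real)"
  unfolding set_integrable_def
proof (rule integrableI_bounded_set_indicator[where B=1])
  have "(\<lambda>s. \<omega> s) \<in> measurable borel (count_space UNIV)"
    using measurable_compose[OF measurable_Pair1' measurable_index_joint, of \<omega>] assms by simp
  then have "(\<lambda>s. if \<omega> s \<noteq> i then 1 else 0 :: real) \<in> borel_measurable lborel" by measurable
  then show "(\<lambda>s. of_bool (\<omega> s \<noteq> i) :: real) \<in> borel_measurable lborel" by (simp add: of_bool_def)
qed (auto simp: emeasure_lborel_Icc_eq)

lemma measurable_cost_joint: "(\<lambda>(\<omega>, s). cost \<omega> s) \<in> borel_measurable (P \<Otimes>\<^sub>M borel)"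
proof -
  have "continuous_on UNIV (\<lambda>z. lagrangian H i (to_torus (fst z)) (- snd z) + \<alpha>)" for i
    by (intro continuous_intros
        continuous_on_compose2[OF lagrangian_continuous[unfolded case_prod_unfold],
          where f="\<lambda>z. (fst z, - snd z)", simplified])
  from measurable_state_dependent[of "\<lambda>i z. lagrangian H i (to_torus (fst z)) (- snd z) + \<alpha>", OF this]
  show ?thesis by (simp add: cost_def)
qed

lemma measurable_cost_integral:
  assumes [measurable]: "\<sigma> \<in> borel_measurable P" "\<tau> \<in> borel_measurable P"
  shows "(\<lambda>\<omega>. LBINT s:{\<sigma> \<omega>..\<tau> \<omega>}. cost \<omega> s) \<in> borel_measurable P"
proof -
  have "(\<lambda>z. if \<sigma> (fst z) \<le> snd z \<and> snd z \<le> \<tau> (fst z) then 1 else 0 :: real) \<in> borel_measurable (P \<Otimes>\<^sub>M borel)"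
    by measurable
  from borel_measurable_times[OF this measurable_cost_joint]
  have "(\<lambda>(\<omega>, s). indicator {\<sigma> \<omega>..\<tau> \<omega>} s *\<^sub>R cost \<omega> s) \<in> borel_measurable (P \<Otimes>\<^sub>M lborel)"
    by (simp add: case_prod_unfold indicator_def of_bool_def cong: measurable_cong_sets sets_pair_measure_cong)
  from lborel.borel_measurable_lebesgue_integral[OF this] show ?thesis
    by (simp add: set_lebesgue_integral_def)
qed

lemma measurable_cost: "\<omega> \<in> index_paths \<Longrightarrow> cost \<omega> \<in> borel_measurable borel"
  using measurable_compose[OF measurable_Pair1' measurable_cost_joint, of \<omega>] by simp

text \<open>Almost surely the velocity, hence the running cost, is bounded up to a given time.\<close>

definition tame :: "real \<Rightarrow> real \<Rightarrow> real \<Rightarrow> (real \<Rightarrow> 'm) \<Rightarrow> bool" where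
  "tame T R C \<omega> \<longleftrightarrow> \<omega> \<in> index_paths \<and> (\<forall>s\<in>{0..T}. norm (\<Xi> \<omega> s) \<le> R \<and> \<bar>cost \<omega> s\<bar> \<le> C
      \<and> (\<forall>i. \<bar>lagrangian H i (to_torus (curve \<omega> s)) (- \<Xi> \<omega> s)\<bar> \<le> C))"

lemma AE_tame:
  assumes "0 < T"
  obtains R C where "0 < R" "0 \<le> C" "AE \<omega> in P. tame T R C \<omega>"
proof -
  obtain R where R: "0 < R" "AE \<omega> in P. \<forall>s\<in>{0..T}. norm (\<Xi> \<omega> s) \<le> R"
    using control_bounded[OF assms] by blast
  obtain C where C: "\<And>i z q. norm q \<le> R \<Longrightarrow> \<bar>lagrangian H i z q\<bar> \<le> C"
    using lagrangian_bounded[of R] by blast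
  have "0 \<le> C" using C[of 0 undefined undefined] R(1) by (metis abs_ge_zero norm_zero order_trans less_imp_le)
  moreover have "AE \<omega> in P. tame T R (C + \<bar>\<alpha>\<bar>) \<omega>"
    using R(2) AE_space
  proof eventually_elim
    case (elim \<omega>)
    have "\<bar>lagrangian H i (to_torus (curve \<omega> s)) (- \<Xi> \<omega> s)\<bar> \<le> C" if "s \<in> {0..T}" for s i
      using elim that by (intro C) simp
    note L = this
    have "\<bar>lagrangian H i (to_torus (curve \<omega> s)) (- \<Xi> \<omega> s)\<bar> \<le> C + \<bar>\<alpha>\<bar>" if "s \<in> {0..T}" for s i
      using L[OF that, of i] by linarith
    moreover have "\<bar>cost \<omega> s\<bar> \<le> C + \<bar>\<alpha>\<bar>" if "s \<in> {0..T}" for s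
      using L[OF that, of "\<omega> s"] unfolding cost_def by linarith
    ultimately show ?case using elim by (simp add: tame_def)
  qed
  ultimately show thesis using R(1) by (intro that[of R "C + \<bar>\<alpha>\<bar>"]) auto
qed

context
  fixes T R C \<omega>
  assumes tame: "tame T R C \<omega>"
begin

lemma tame_path: "\<omega> \<in> index_paths" using tame by (simp add: tame_def)

lemma tame_integrable: "0 \<le> r \<Longrightarrow> t \<le> T \<Longrightarrow> set_integrable lborel {r..t} (cost \<omega>)"
  unfolding set_integrable_def using measurable_cost[OF tame_path] tame
  by (intro integrableI_bounded_set_indicator[where B=C]) (auto simp: emeasure_lborel_Icc_eq tame_def)

lemma tame_integral_add:
  "0 \<le> r \<Longrightarrow> r \<le> s \<Longrightarrow> s \<le> t \<Longrightarrow> t \<le> T \<Longrightarrow>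
    (LBINT s:{r..t}. cost \<omega> s) = (LBINT s:{r..s}. cost \<omega> s) + (LBINT s:{s..t}. cost \<omega> s)"
  using tame_integrable[of r s] tame_integrable[of s t] tame_integrable[of r t]
  by (simp add: set_borel_integral_eq_integral Henstock_Kurzweil_Integration.integral_combine)

lemma tame_integral_bound:
  assumes "0 \<le> r" "r \<le> t" "t \<le> T"
  shows "\<bar>LBINT s:{r..t}. cost \<omega> s\<bar> \<le> C * (t - r)"
proof -
  have "\<bar>cost \<omega> r\<bar> \<le> C" using tame assms by (simp add: tame_def)
  then have "0 \<le> C" by linarith
  then have "norm (integral {r..t} (cost \<omega>)) \<le> C * measure lborel (cbox r t)"
    using integrable_bound[of C "cost \<omega>" r t] tame assms tame_integrable[of r t]
    by (simp add: tame_def set_borel_integral_eq_integral)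
  then show ?thesis using tame_integrable[of r t] assms by (simp add: set_borel_integral_eq_integral)
qed

end

end

locale controlled_subsolution = controlled H \<Lambda> a \<Xi> x0 \<alpha>
  for H :: "'m::finite \<Rightarrow> 'n::finite torus \<Rightarrow> real^'n \<Rightarrow> real" and \<Lambda> :: "real^'m^'m" and a :: "real^'m"
    and \<Xi> :: "(real \<Rightarrow> 'm) \<Rightarrow> real \<Rightarrow> real^'n" and x0 :: "real^'n" and \<alpha> :: real +
  fixes u :: "'n torus \<Rightarrow> real^'m"
  assumes sub: "subsolution H \<Lambda> \<alpha> u"
begin

definition val :: "'m \<Rightarrow> real^'n \<Rightarrow> real" where
  "val j v = u (to_torus v) $ j"

lemma val_continuous: "continuous_on S (val j)"
proof -
  have "continuous_on UNIV (\<lambda>y. u (to_torus y))"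
    using sub unfolding subsolution_def continuous_torus_iff by blast
  then have "continuous_on UNIV (val j)" unfolding val_def by (intro continuous_intros)
  then show ?thesis by (rule continuous_on_subset) simp
qed

lemma val_bounded:
  obtains B where "0 \<le> B" "\<And>j v. \<bar>val j v\<bar> \<le> B"
proof -
  have "\<exists>B. \<forall>v. \<bar>val j v\<bar> \<le> B" for j
  proof -
    have "continuous_on UNIV (\<lambda>(v, q :: real). u (to_torus v) $ j)"
      using val_continuous[of UNIV j] unfolding val_def case_prod_unfold
      by (rule continuous_on_compose2) (auto intro!: continuous_intros)
    from bounded_periodic[where f="\<lambda>z q. u z $ j", OF this compact_sing[of 0]] show ?thesis
      unfolding val_def by (metis singletonI)
  qed
  then obtain B where B: "\<And>j v. \<bar>val j v\<bar> \<le> B j" by metis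
  have "\<bar>val j v\<bar> \<le> (\<Sum>j\<in>UNIV. \<bar>B j\<bar>)" for j v
  proof -
    have "\<bar>B j\<bar> \<le> (\<Sum>j\<in>UNIV. \<bar>B j\<bar>)" by (intro member_le_sum) auto
    then show ?thesis using B[of j v] by linarith
  qed
  then show thesis by (intro that[of "\<Sum>j\<in>UNIV. \<bar>B j\<bar>"]) (auto intro: sum_nonneg)
qed

lemma measurable_val_at:
  assumes [measurable]: "\<sigma> \<in> borel_measurable P"
  shows "(\<lambda>\<omega>. val (\<omega> (\<sigma> \<omega>)) (curve \<omega> (\<sigma> \<omega>))) \<in> borel_measurable P"
proof -
  have j: "(\<lambda>(\<omega>, s). val (\<omega> s) (fst (curve \<omega> s, \<Xi> \<omega> s))) \<in> borel_measurable (P \<Otimes>\<^sub>M borel)"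
    by (rule measurable_state_dependent) (rule continuous_on_compose2[OF val_continuous[of UNIV]], auto intro!: continuous_intros)
  have "(\<lambda>\<omega>. (\<omega>, \<sigma> \<omega>)) \<in> measurable P (P \<Otimes>\<^sub>M borel)" by measurable
  from measurable_compose[OF this j] show ?thesis by simp
qed

text \<open>One time step.  The deterministic inequality is used with the state frozen at its value at
  time \<open>t\<close>; the change of state is then accounted for by the Markov property, and what is left is
  \<open>o(h)\<close>: the chain moves with probability \<open>O(h)\<close> and the curve moves by \<open>O(h)\<close>.\<close>

lemma step:
  assumes tame: "AE \<omega> in P. tame T R C \<omega>" and RC: "0 \<le> R" "0 \<le> C"
    and t: "0 \<le> t" "0 < h" "t + h \<le> T" and A: "A \<in> sets (index_algebra {0..t})"
    and B: "0 \<le> B" "\<And>j v. \<bar>val j v\<bar> \<le> B"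
    and K': "prob {\<omega> \<in> index_paths. \<omega> (t + h) \<noteq> \<omega> t} \<le> K' * h"
      "integrable P (\<lambda>\<omega>. LBINT s:{t..t+h}. of_bool (\<omega> s \<noteq> \<omega> t) :: real)"
      "expectation (\<lambda>\<omega>. LBINT s:{t..t+h}. of_bool (\<omega> s \<noteq> \<omega> t)) \<le> K' * h * h"
    and e: "0 \<le> e"
    and E: "\<And>i j. \<bar>transition h i j - mat 1 $ i $ j + h * \<Lambda> $ i $ j\<bar> \<le> e * h"
    and modulus: "\<And>j v w. v \<in> cball x0 (R * T) \<Longrightarrow> w \<in> cball x0 (R * T) \<Longrightarrow> dist v w \<le> R * h \<Longrightarrow> \<bar>val j v - val j w\<bar> \<le> e"
    and K: "\<And>i. (\<Sum>j\<in>UNIV. \<bar>\<Lambda> $ i $ j\<bar>) \<le> K"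
  shows "integrable P (\<lambda>\<omega>. indicator A \<omega> * (val (\<omega> t) (curve \<omega> t) - val (\<omega> (t + h)) (curve \<omega> (t + h))))"
    and "integrable P (\<lambda>\<omega>. indicator A \<omega> * (LBINT s:{t..t+h}. cost \<omega> s))"
    and "expectation (\<lambda>\<omega>. indicator A \<omega> * (val (\<omega> t) (curve \<omega> t) - val (\<omega> (t + h)) (curve \<omega> (t + h))))
    \<le> expectation (\<lambda>\<omega>. indicator A \<omega> * (LBINT s:{t..t+h}. cost \<omega> s))
      + h * ((K + 2 * K' + real CARD('m) * B) * e + 2 * C * K' * h)"
proof -
  have AP: "A \<in> sets P" using path_algebra_mono[of "{0..t}" "{0..}"] A t by auto
  have A_meas [measurable]: "(indicator A :: _ \<Rightarrow> real) \<in> borel_measurable P" using AP by simp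
  define Y where "Y j \<omega> = indicator A \<omega> * val j (curve \<omega> t)" for j \<omega>
  have Ym: "Y j \<in> borel_measurable (index_algebra {0..t})" for j
    unfolding Y_def[abs_def]
    by (intro borel_measurable_times measurable_compose[OF measurable_curve[OF t(1)]]
        borel_measurable_continuous_onI[OF val_continuous]) (use A in simp)
  have Yb: "\<bar>Y j \<omega>\<bar> \<le> B" for j \<omega> using B by (simp add: Y_def indicator_def)
  note M = markov_expectation[OF t(1,2), of Y B, OF Ym Yb]
  have YP: "Y j \<in> borel_measurable P" for j
    using measurable_path_algebra_mono[OF _ Ym, of "{0..}" j] by (simp cong: measurable_cong_sets)
  \<comment> \<open>The first-order approximation of the transition matrix.\<close>
  define c where "c i j = mat 1 $ i $ j - h * \<Lambda> $ i $ j" for i j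
  define D1 where "D1 \<omega> = (\<Sum>j\<in>UNIV. c (\<omega> t) j * Y j \<omega>)" for \<omega>
  \<comment> \<open>The value predicted at time \<open>t\<close> minus the value in the state that is reached; by the Markov
     property its expectation is of order \<open>e * h\<close>.\<close>
  define D where "D \<omega> = D1 \<omega> - Y (\<omega> (t + h)) \<omega>" for \<omega>
  have D1: "integrable P D1"
    unfolding D1_def[abs_def]
  proof (intro Bochner_Integration.integrable_sum)
    fix j
    show "integrable P (\<lambda>\<omega>. c (\<omega> t) j * Y j \<omega>)"
    proof (rule integrable_const_bound[where B="(\<Sum>i\<in>UNIV. \<bar>c i j\<bar>) * B"])
      show "AE \<omega> in P. norm (c (\<omega> t) j * Y j \<omega>) \<le> (\<Sum>i\<in>UNIV. \<bar>c i j\<bar>) * B"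
        unfolding real_norm_def abs_mult
        by (intro AE_I2 mult_mono Yb member_le_sum sum_nonneg) auto
      have "(\<lambda>\<omega>. c (\<omega> t) j) \<in> borel_measurable P"
        by (rule measurable_compose[OF measurable_eval[OF t(1)]]) simp
      then show "(\<lambda>\<omega>. c (\<omega> t) j * Y j \<omega>) \<in> borel_measurable P" using YP by (intro borel_measurable_times)
    qed
  qed
  have D: "integrable P D" unfolding D_def[abs_def] by (intro Bochner_Integration.integrable_diff D1 M)
  have ED: "expectation D \<le> real CARD('m) * B * e * h"
  proof -
    have "expectation D = expectation (\<lambda>\<omega>. D1 \<omega> - (\<Sum>j\<in>UNIV. transition h (\<omega> t) j * Y j \<omega>))"
      unfolding D_def[abs_def] using D1 M by simp
    also have "\<dots> \<le> expectation (\<lambda>_. real CARD('m) * B * e * h)"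
    proof (rule integral_mono)
      fix \<omega>
      have "D1 \<omega> - (\<Sum>j\<in>UNIV. transition h (\<omega> t) j * Y j \<omega>) =
          (\<Sum>j\<in>UNIV. (c (\<omega> t) j - transition h (\<omega> t) j) * Y j \<omega>)"
        by (simp add: D1_def sum_subtractf left_diff_distrib)
      also have "\<dots> \<le> (\<Sum>j\<in>(UNIV::'m set). (e * h) * B)"
      proof (rule sum_mono)
        fix j
        have "\<bar>c (\<omega> t) j - transition h (\<omega> t) j\<bar> * \<bar>Y j \<omega>\<bar> \<le> (e * h) * B"
          using E[of "\<omega> t" j] Yb[of j \<omega>] e t by (intro mult_mono) (auto simp: c_def)
        moreover have "(c (\<omega> t) j - transition h (\<omega> t) j) * Y j \<omega> \<le> \<bar>c (\<omega> t) j - transition h (\<omega> t) j\<bar> * \<bar>Y j \<omega>\<bar>"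
          unfolding abs_mult[symmetric] by (rule abs_ge_self)
        ultimately show "(c (\<omega> t) j - transition h (\<omega> t) j) * Y j \<omega> \<le> (e * h) * B" by linarith
      qed
      finally show "D1 \<omega> - (\<Sum>j\<in>UNIV. transition h (\<omega> t) j * Y j \<omega>) \<le> real CARD('m) * B * e * h"
        by (simp add: mult_ac)
    qed (use D1 M in auto)
    finally show ?thesis by (simp add: prob_space)
  qed
  define J where "J \<omega> = (LBINT s:{t..t+h}. of_bool (\<omega> s \<noteq> \<omega> t) :: real)" for \<omega> :: "real \<Rightarrow> 'm"
  define I where "I \<omega> = (indicator {\<omega> \<in> index_paths. \<omega> (t + h) \<noteq> \<omega> t} \<omega> :: real)" for \<omega> :: "real \<Rightarrow> 'm"
  have moved: "{\<omega> \<in> index_paths. \<omega> (t + h) \<noteq> \<omega> t} \<in> sets P"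
  proof -
    have "{\<omega> \<in> index_paths. \<omega> (t + h) \<noteq> \<omega> t} =
        (\<Union>j\<in>(UNIV :: 'm set). {\<omega> \<in> index_paths. \<omega> t = j} - {\<omega> \<in> index_paths. \<omega> (t + h) = j})"
      by auto
    also have "\<dots> \<in> sets (index_algebra {0..})"
      using t by (intro sets.finite_UN sets.Diff index_event) auto
    finally show ?thesis by simp
  qed
  have I: "integrable P I" "expectation I \<le> K' * h"
  proof -
    show "integrable P I" unfolding I_def[abs_def] using moved by (intro integrable_real_indicator) (auto simp: emeasure_eq_measure)
    have "expectation I = prob ({\<omega> \<in> index_paths. \<omega> (t + h) \<noteq> \<omega> t} \<inter> space P)"
      unfolding I_def[abs_def] by (rule Bochner_Integration.integral_indicator)
    also have "{\<omega> \<in> index_paths. \<omega> (t + h) \<noteq> \<omega> t} \<inter> space P = {\<omega> \<in> index_paths. \<omega> (t + h) \<noteq> \<omega> t}" by auto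
    finally show "expectation I \<le> K' * h" using K'(1) by simp
  qed
  have J: "integrable P J" "expectation J \<le> K' * h * h" using K'(2,3) by (simp_all add: J_def[abs_def])
  define cst where "cst \<omega> = indicator A \<omega> * (LBINT s:{t..t+h}. cost \<omega> s)" for \<omega>
  have cst: "integrable P cst"
  proof (rule integrable_const_bound[where B="C * h"])
    show "AE \<omega> in P. norm (cst \<omega>) \<le> C * h"
      using tame
    proof eventually_elim
      case (elim \<omega>)
      have "\<bar>LBINT s:{t..t+h}. cost \<omega> s\<bar> \<le> C * h" using tame_integral_bound[OF elim, of t "t+h"] t by simp
      then show ?case using RC t by (simp add: cst_def indicator_def)
    qed
    show "cst \<in> borel_measurable P"
      unfolding cst_def[abs_def] by (intro borel_measurable_times A_meas measurable_cost_integral) simp_all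
  qed
  define lhs where "lhs \<omega> = indicator A \<omega> * (val (\<omega> t) (curve \<omega> t) - val (\<omega> (t + h)) (curve \<omega> (t + h)))" for \<omega>
  have lhs: "integrable P lhs"
  proof (rule integrable_const_bound[where B="2 * B"])
    show "AE \<omega> in P. norm (lhs \<omega>) \<le> 2 * B"
    proof (rule AE_I2)
      fix \<omega>
      have "\<bar>val (\<omega> t) (curve \<omega> t) - val (\<omega> (t + h)) (curve \<omega> (t + h))\<bar> \<le> 2 * B"
        using B(2)[of "\<omega> t" "curve \<omega> t"] B(2)[of "\<omega> (t + h)" "curve \<omega> (t + h)"] by linarith
      then show "norm (lhs \<omega>) \<le> 2 * B" using B(1) by (simp add: lhs_def indicator_def)
    qed
    show "lhs \<in> borel_measurable P"
      unfolding lhs_def[abs_def] by (intro borel_measurable_times A_meas borel_measurable_diff measurable_val_at) simp_all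
  qed
  have "AE \<omega> in P. lhs \<omega> \<le> cst \<omega> + D \<omega> + 2 * C * J \<omega> + 2 * e * I \<omega> + h * (K * e)"
    using tame
  proof eventually_elim
    case (elim \<omega>)
    have \<omega>: "\<omega> \<in> index_paths" using elim by (rule tame_path)
    note \<Xi> = control_cadlag[OF \<omega>]
    have norm_\<Xi>: "norm (\<Xi> \<omega> s) \<le> R" if "s \<in> {0..T}" for s using elim that by (simp add: tame_def)
    have K0: "0 \<le> K" using K[of undefined] by (rule order_trans[rotated]) (auto intro: sum_nonneg)
    have J0: "0 \<le> J \<omega>" unfolding J_def set_lebesgue_integral_def by (intro Bochner_Integration.integral_nonneg) auto
    have I0: "0 \<le> I \<omega>" by (simp add: I_def)
    show ?case
    proof (cases "\<omega> \<in> A")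
      case False
      then have "lhs \<omega> = 0" "cst \<omega> = 0" "D \<omega> = 0" by (simp_all add: lhs_def cst_def D_def D1_def Y_def)
      then show ?thesis using J0 I0 RC e t K0 by (simp add: add_nonneg_nonneg)
    next
      case True
      define i where "i = \<omega> t"
      define \<gamma> where "\<gamma> = curve \<omega>"
      define S where "S = (\<Sum>j\<in>UNIV. \<Lambda> $ i $ j * val j (\<gamma> t))"
      have \<gamma>_lip: "dist (\<gamma> s) (\<gamma> r) \<le> R * (s - r)" if "0 \<le> r" "r \<le> s" "s \<le> T" for r s
        using primitive_lipschitz[OF \<Xi> that(1,2), of R] norm_\<Xi> that by (simp add: \<gamma>_def curve_def dist_norm)
      have \<gamma>_0: "\<gamma> 0 = x0" by (simp add: \<gamma>_def curve_def primitive_0[OF \<Xi>])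
      have ball: "\<gamma> s \<in> cball x0 (R * T)" if "0 \<le> s" "s \<le> T" for s
      proof -
        have "dist (\<gamma> s) (\<gamma> 0) \<le> R * s" using \<gamma>_lip[of 0 s] that by simp
        also have "\<dots> \<le> R * T" using that RC by (intro mult_left_mono) auto
        finally show ?thesis by (simp add: \<gamma>_0 dist_commute)
      qed
      have near: "\<bar>val j (\<gamma> s) - val j (\<gamma> t)\<bar> \<le> e" if "s \<in> {t..t+h}" for s j
      proof (rule modulus)
        have "dist (\<gamma> s) (\<gamma> t) \<le> R * (s - t)" using that t by (intro \<gamma>_lip) auto
        also have "\<dots> \<le> R * h" using that RC by (intro mult_left_mono) auto
        finally show "dist (\<gamma> s) (\<gamma> t) \<le> R * h" .
      qed (use that t in \<open>auto intro!: ball simp del: mem_cball\<close>)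
      define F where "F s = lagrangian H i (to_torus (\<gamma> s)) (- \<Xi> \<omega> s) + (\<alpha> - \<Lambda> $ i \<bullet> u (to_torus (\<gamma> s)))" for s
      have Fint: "set_integrable lborel {t..t+h} F" and 1: "val i (\<gamma> t) - val i (\<gamma> (t + h)) \<le> (LBINT s:{t..t+h}. F s)"
        using subsolution_along_curve[OF sub \<Xi>, where ?t0.0=t and ?t1.0="t+h" and i=i and ?x0.0=x0] t
        by (simp_all add: F_def[abs_def] val_def \<gamma>_def curve_def)
      \<comment> \<open>The cost in the state \<open>i\<close> differs from the cost in the actual state only while the chain
         is away from \<open>i\<close>, and the coupling term is replaced by its value at time \<open>t\<close>.\<close>
      define Z where "Z s = cost \<omega> s + (2 * C * of_bool (\<omega> s \<noteq> i) + (K * e - S))" for s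
      note away = time_away_integrable[OF \<omega>, of t "t + h" i]
      have ci: "set_integrable lborel {t..t+h} (cost \<omega>)" using tame_integrable[OF elim] t by simp
      have const: "set_integrable lborel {t..t+h} (\<lambda>_. K * e - S)"
        unfolding set_integrable_def by (intro integrable_scaleR_left integrable_real_indicator) (auto simp: emeasure_lborel_Icc_eq)
      have Zint: "set_integrable lborel {t..t+h} Z"
        unfolding Z_def[abs_def] by (intro set_integral_add(1) ci const set_integrable_mult_right away)
      have FZ: "F s \<le> Z s" if s: "s \<in> {t..t+h}" for s
      proof -
        have sT: "s \<in> {0..T}" using s t by auto
        have L: "lagrangian H i (to_torus (\<gamma> s)) (- \<Xi> \<omega> s) \<le> lagrangian H (\<omega> s) (to_torus (\<gamma> s)) (- \<Xi> \<omega> s) + 2 * C * of_bool (\<omega> s \<noteq> i)"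
        proof (cases "\<omega> s = i")
          case False
          have "\<bar>lagrangian H j (to_torus (\<gamma> s)) (- \<Xi> \<omega> s)\<bar> \<le> C" for j
            using elim sT by (simp add: tame_def \<gamma>_def)
          from this[of i] this[of "\<omega> s"] show ?thesis using False by simp
        qed simp
        have inner: "\<Lambda> $ i \<bullet> u (to_torus (\<gamma> s)) = (\<Sum>j\<in>UNIV. \<Lambda> $ i $ j * val j (\<gamma> s))"
          by (simp add: inner_vec_def val_def)
        have "S - (\<Sum>j\<in>UNIV. \<Lambda> $ i $ j * val j (\<gamma> s)) = (\<Sum>j\<in>UNIV. \<Lambda> $ i $ j * (val j (\<gamma> t) - val j (\<gamma> s)))"
          by (simp add: S_def sum_subtractf right_diff_distrib)
        also have "\<dots> \<le> (\<Sum>j\<in>UNIV. \<bar>\<Lambda> $ i $ j\<bar> * e)"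
        proof (rule sum_mono)
          fix j
          have "\<bar>\<Lambda> $ i $ j\<bar> * \<bar>val j (\<gamma> t) - val j (\<gamma> s)\<bar> \<le> \<bar>\<Lambda> $ i $ j\<bar> * e"
            using near[OF s, of j] by (intro mult_left_mono) (auto simp: abs_minus_commute)
          moreover have "\<Lambda> $ i $ j * (val j (\<gamma> t) - val j (\<gamma> s)) \<le> \<bar>\<Lambda> $ i $ j\<bar> * \<bar>val j (\<gamma> t) - val j (\<gamma> s)\<bar>"
            unfolding abs_mult[symmetric] by (rule abs_ge_self)
          ultimately show "\<Lambda> $ i $ j * (val j (\<gamma> t) - val j (\<gamma> s)) \<le> \<bar>\<Lambda> $ i $ j\<bar> * e" by linarith
        qed
        also have "\<dots> \<le> K * e" unfolding sum_distrib_right[symmetric] by (intro mult_right_mono K e)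
        finally have "S - (\<Sum>j\<in>UNIV. \<Lambda> $ i $ j * val j (\<gamma> s)) \<le> K * e" .
        moreover have "cost \<omega> s = lagrangian H (\<omega> s) (to_torus (\<gamma> s)) (- \<Xi> \<omega> s) + \<alpha>"
          by (simp add: cost_def \<gamma>_def)
        ultimately show ?thesis using L unfolding F_def Z_def inner by linarith
      qed
      have "(LBINT s:{t..t+h}. F s) \<le> (LBINT s:{t..t+h}. Z s)"
        by (rule set_integral_mono[OF Fint Zint FZ])
      also have "\<dots> = (LBINT s:{t..t+h}. cost \<omega> s) + (2 * C * J \<omega> + h * (K * e - S))"
        unfolding Z_def J_def
        using ci away const t
        by (simp add: set_integral_add set_integrable_mult_right i_def set_integral_mult_right)
           (simp add: set_lebesgue_integral_def)
      finally have 2: "(LBINT s:{t..t+h}. F s) \<le> (LBINT s:{t..t+h}. cost \<omega> s) + (2 * C * J \<omega> + h * (K * e - S))" .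
      \<comment> \<open>Moving the curve matters for this difference only if the state has changed.\<close>
      have 3: "val i (\<gamma> (t + h)) - val (\<omega> (t + h)) (\<gamma> (t + h)) \<le> val i (\<gamma> t) - val (\<omega> (t + h)) (\<gamma> t) + 2 * e * I \<omega>"
      proof (cases "\<omega> (t + h) = i")
        case False
        then have "I \<omega> = 1" using \<omega> by (simp add: I_def i_def)
        then show ?thesis
          using near[of "t + h" i] near[of "t + h" "\<omega> (t + h)"] t by simp
      qed (use I0 e in simp)
      have "D \<omega> = val i (\<gamma> t) - h * S - val (\<omega> (t + h)) (\<gamma> t)"
      proof -
        have "D1 \<omega> = (\<Sum>j\<in>UNIV. mat 1 $ i $ j * val j (\<gamma> t)) - h * S"
          using True by (simp add: D1_def c_def Y_def S_def i_def \<gamma>_def left_diff_distrib sum_subtractf sum_distrib_left mult.assoc)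
        also have "(\<Sum>j\<in>UNIV. mat 1 $ i $ j * val j (\<gamma> t)) = val i (\<gamma> t)"
          by (simp add: mat_def if_distrib[of "\<lambda>x. x * _"] cong: if_cong)
        finally show ?thesis using True by (simp add: D_def Y_def \<gamma>_def)
      qed
      moreover have "lhs \<omega> = val i (\<gamma> t) - val (\<omega> (t + h)) (\<gamma> (t + h))" "cst \<omega> = (LBINT s:{t..t+h}. cost \<omega> s)"
        using True by (simp_all add: lhs_def cst_def i_def \<gamma>_def)
      ultimately show ?thesis using 1 2 3 by (simp add: algebra_simps)
    qed
  qed
  then have "expectation lhs \<le> expectation (\<lambda>\<omega>. cst \<omega> + D \<omega> + 2 * C * J \<omega> + 2 * e * I \<omega> + h * (K * e))"
    using lhs cst D J I by (intro integral_mono_AE) auto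
  also have "\<dots> = expectation cst + expectation D + 2 * C * expectation J + 2 * e * expectation I + h * (K * e)"
    using cst D J I by (simp add: prob_space)
  also have "\<dots> \<le> expectation cst + real CARD('m) * B * e * h + 2 * C * (K' * h * h) + 2 * e * (K' * h) + h * (K * e)"
  proof -
    have "2 * C * expectation J \<le> 2 * C * (K' * h * h)" using J(2) RC by (intro mult_left_mono) auto
    moreover have "2 * e * expectation I \<le> 2 * e * (K' * h)" using I(2) e by (intro mult_left_mono) auto
    ultimately show ?thesis using ED by linarith
  qed
  finally show "expectation (\<lambda>\<omega>. indicator A \<omega> * (val (\<omega> t) (curve \<omega> t) - val (\<omega> (t + h)) (curve \<omega> (t + h))))
    \<le> expectation (\<lambda>\<omega>. indicator A \<omega> * (LBINT s:{t..t+h}. cost \<omega> s))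
      + h * ((K + 2 * K' + real CARD('m) * B) * e + 2 * C * K' * h)"
    by (simp add: lhs_def[abs_def] cst_def[abs_def] algebra_simps)
  show "integrable P (\<lambda>\<omega>. indicator A \<omega> * (val (\<omega> t) (curve \<omega> t) - val (\<omega> (t + h)) (curve \<omega> (t + h))))"
    and "integrable P (\<lambda>\<omega>. indicator A \<omega> * (LBINT s:{t..t+h}. cost \<omega> s))"
    using lhs cst by (simp_all add: lhs_def[abs_def] cst_def[abs_def])
qed

end

context controlled_subsolution
begin

text \<open>The stopping time is approximated from above by times of a grid of mesh \<open>h\<close>; the event that it
  exceeds a grid point is known at that point, so the steps can be added up.\<close>

lemma subsolution_inequality:
  assumes \<tau>: "bounded_stopping_time \<tau>"
  shows "expectation (\<lambda>\<omega>. val (\<omega> 0) x0 - val (\<omega> (\<tau> \<omega>)) (curve \<omega> (\<tau> \<omega>)))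
    \<le> expectation (\<lambda>\<omega>. LBINT s:{0..\<tau> \<omega>}. cost \<omega> s)"
proof -
  obtain T0 where T0: "\<And>\<omega>. \<omega> \<in> index_paths \<Longrightarrow> \<tau> \<omega> \<le> T0" using \<tau> unfolding bounded_stopping_time_def by blast
  define T where "T = max T0 1"
  have T: "0 < T" "\<And>\<omega>. \<omega> \<in> index_paths \<Longrightarrow> \<tau> \<omega> \<le> T" using T0 by (auto simp: T_def le_max_iff_disj)
  have \<tau>0: "\<And>\<omega>. \<omega> \<in> index_paths \<Longrightarrow> 0 \<le> \<tau> \<omega>" using \<tau> by (simp add: bounded_stopping_time_def)
  have \<tau>m [measurable]: "\<tau> \<in> borel_measurable P"
    using \<tau> by (simp add: bounded_stopping_time_def cong: measurable_cong_sets)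
  obtain R C where RC: "0 < R" "0 \<le> C" and tame: "AE \<omega> in P. tame T R C \<omega>" using AE_tame[OF T(1)] by blast
  obtain B where B: "0 \<le> B" "\<And>j v. \<bar>val j v\<bar> \<le> B" using val_bounded by blast
  define K where "K = (\<Sum>i\<in>UNIV. \<Sum>j\<in>UNIV. \<bar>\<Lambda> $ i $ j\<bar>)"
  have K: "(\<Sum>j\<in>UNIV. \<bar>\<Lambda> $ i $ j\<bar>) \<le> K" for i
    unfolding K_def by (intro member_le_sum) (auto intro: sum_nonneg)
  have K0: "0 \<le> K" unfolding K_def by (intro sum_nonneg) auto
  obtain K' where K': "0 \<le> K'"
    "\<And>t h. 0 \<le> t \<Longrightarrow> 0 \<le> h \<Longrightarrow> prob {\<omega> \<in> index_paths. \<omega> (t + h) \<noteq> \<omega> t} \<le> K' * h"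
    "\<And>t h. 0 \<le> t \<Longrightarrow> 0 \<le> h \<Longrightarrow> integrable P (\<lambda>\<omega>. LBINT s:{t..t+h}. of_bool (\<omega> s \<noteq> \<omega> t) :: real)"
    "\<And>t h. 0 \<le> t \<Longrightarrow> 0 \<le> h \<Longrightarrow> expectation (\<lambda>\<omega>. LBINT s:{t..t+h}. of_bool (\<omega> s \<noteq> \<omega> t)) \<le> K' * h * h"
    using expected_time_away by blast
  define M where "M = K + 2 * K' + real CARD('m) * B"
  have M0: "0 \<le> M" using K0 K'(1) B(1) by (simp add: M_def)
  define V where "V \<sigma> \<omega> = val (\<omega> \<sigma>) (curve \<omega> \<sigma>)" for \<sigma> and \<omega> :: "real \<Rightarrow> 'm"
  have Vb: "\<bar>V \<sigma> \<omega>\<bar> \<le> B" for \<sigma> \<omega> using B by (simp add: V_def)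
  have Vm: "(\<lambda>\<omega>. V (\<sigma> \<omega>) \<omega>) \<in> borel_measurable P" if "\<sigma> \<in> borel_measurable P" for \<sigma>
    using measurable_val_at[OF that] by (simp add: V_def)
  have cost_int: "integrable P (\<lambda>\<omega>. LBINT s:{0..\<tau> \<omega>}. cost \<omega> s)"
  proof (rule integrable_const_bound[where B="C * T"])
    show "AE \<omega> in P. norm (LBINT s:{0..\<tau> \<omega>}. cost \<omega> s) \<le> C * T"
      using tame
    proof eventually_elim
      case (elim \<omega>)
      note \<omega> = tame_path[OF elim]
      have "\<bar>LBINT s:{0..\<tau> \<omega>}. cost \<omega> s\<bar> \<le> C * (\<tau> \<omega> - 0)"
        by (rule tame_integral_bound[OF elim]) (use T(2)[OF \<omega>] \<tau>0[OF \<omega>] in auto)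
      also have "\<dots> \<le> C * T" using RC T(2)[OF \<omega>] by (intro mult_left_mono) auto
      finally show ?case by simp
    qed
  qed (intro measurable_cost_integral, simp_all)
  define E\<^sub>c where "E\<^sub>c = expectation (\<lambda>\<omega>. LBINT s:{0..\<tau> \<omega>}. cost \<omega> s)"
  define h where "h n = T / real (Suc n)" for n
  have h0: "0 < h n" for n using T by (simp add: h_def)
  have hT: "real (Suc n) * h n = T" for n by (simp add: h_def)
  have hlim: "h \<longlonglongrightarrow> 0"
    using tendsto_mult[OF tendsto_const LIMSEQ_inverse_real_of_nat, of T] by (simp add: h_def[abs_def] divide_inverse)
  \<comment> \<open>The number of grid points strictly before \<open>\<tau> \<omega>\<close>; step \<open>k\<close> is carried out if \<open>k\<close> is below it.\<close>
  define \<kappa> where "\<kappa> n \<omega> = nat \<lceil>\<tau> \<omega> / h n\<rceil>" for n \<omega>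
  define \<sigma> where "\<sigma> n \<omega> = real (\<kappa> n \<omega>) * h n" for n \<omega>
  have \<sigma>m: "\<sigma> n \<in> borel_measurable P" for n
    unfolding \<sigma>_def[abs_def] \<kappa>_def[abs_def] by measurable
  have \<kappa>_iff: "k < \<kappa> n \<omega> \<longleftrightarrow> real k * h n < \<tau> \<omega>" for k n \<omega>
  proof -
    have "k < \<kappa> n \<omega> \<longleftrightarrow> real k < \<tau> \<omega> / h n" unfolding \<kappa>_def zless_nat_eq_int_zless less_ceiling_iff by simp
    then show ?thesis using h0[of n] by (simp add: pos_less_divide_eq)
  qed
  have \<sigma>: "\<tau> \<omega> \<le> \<sigma> n \<omega>" "\<sigma> n \<omega> \<le> \<tau> \<omega> + h n" "\<kappa> n \<omega> \<le> Suc n" "\<sigma> n \<omega> \<le> T" if \<omega>: "\<omega> \<in> index_paths" for n \<omega>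
  proof -
    show "\<tau> \<omega> \<le> \<sigma> n \<omega>" using \<kappa>_iff[of "\<kappa> n \<omega>" n \<omega>] by (simp add: \<sigma>_def)
    show "\<sigma> n \<omega> \<le> \<tau> \<omega> + h n"
    proof (cases "\<kappa> n \<omega>")
      case 0 then show ?thesis using \<tau>0[OF \<omega>] h0[of n] by (simp add: \<sigma>_def)
    next
      case (Suc k)
      then have "real k * h n < \<tau> \<omega>" using \<kappa>_iff[of k n \<omega>] by simp
      then show ?thesis using Suc by (simp add: \<sigma>_def algebra_simps)
    qed
    have "\<not> Suc n < \<kappa> n \<omega>" using \<kappa>_iff[of "Suc n" n \<omega>] hT[of n] T(2)[OF \<omega>] by simp
    then show k: "\<kappa> n \<omega> \<le> Suc n" by simp
    have "\<sigma> n \<omega> \<le> real (Suc n) * h n" unfolding \<sigma>_def using k h0[of n] by (intro mult_right_mono) auto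
    then show "\<sigma> n \<omega> \<le> T" by (simp only: hT)
  qed
  have main: "expectation (\<lambda>\<omega>. V 0 \<omega> - V (\<tau> \<omega>) \<omega>) \<le> E\<^sub>c + T * (M * e)" if e: "0 < e" for e
  proof -
    obtain d1 where d1: "0 < d1" "\<And>h i j. 0 \<le> h \<Longrightarrow> h \<le> d1 \<Longrightarrow>
        \<bar>transition h i j - mat 1 $ i $ j + h * \<Lambda> $ i $ j\<bar> \<le> e * h"
      using chain_semigroup_expansion[OF e, of \<Lambda>] by blast
    have "\<exists>d>0. \<forall>v\<in>cball x0 (R * T). \<forall>w\<in>cball x0 (R * T). dist w v < d \<longrightarrow> dist (val j w) (val j v) < e" for j
      using compact_uniformly_continuous[OF val_continuous compact_cball, of x0 "R * T" j] e
      unfolding uniformly_continuous_on_def by blast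
    then obtain d2 where d2: "\<And>j. 0 < d2 j"
      "\<And>j v w. v \<in> cball x0 (R * T) \<Longrightarrow> w \<in> cball x0 (R * T) \<Longrightarrow> dist w v < d2 j \<Longrightarrow> dist (val j w) (val j v) < e"
      by metis
    define d where "d = Min (range d2)"
    have d: "0 < d" "\<And>j. d \<le> d2 j" unfolding d_def using d2(1) by (auto intro: Min_le)
    have ev1: "eventually (\<lambda>n. h n < d1) sequentially" using order_tendstoD(2)[OF hlim d1(1)] .
    have "(\<lambda>n. R * h n) \<longlonglongrightarrow> R * 0" by (intro tendsto_intros hlim)
    then have ev2: "eventually (\<lambda>n. R * h n < d) sequentially" using order_tendstoD(2)[of "\<lambda>n. R * h n" 0] d(1) by simp
    have grid: "expectation (\<lambda>\<omega>. V 0 \<omega> - V (\<sigma> n \<omega>) \<omega>) \<le> E\<^sub>c + C * h n + T * (M * e + 2 * C * K' * h n)"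
      if n: "h n < d1" "R * h n < d" for n
    proof -
      define A where "A k = {\<omega> \<in> index_paths. real k * h n < \<tau> \<omega>}" for k
      define t where "t k = real k * h n" for k
      have t0: "0 \<le> t k" "t (Suc k) = t k + h n" for k using h0[of n] by (simp_all add: t_def algebra_simps)
      have tT: "t k + h n \<le> T" if "k < Suc n" for k
      proof -
        have "t (Suc k) \<le> real (Suc n) * h n" unfolding t_def using that h0[of n] by (intro mult_right_mono) auto
        then show ?thesis by (simp only: t0 hT)
      qed
      have AF: "A k \<in> sets (index_algebra {0..t k})" for k
      proof -
        have "Measurable.pred (index_algebra {0..t k}) (\<lambda>\<omega>. \<tau> \<omega> \<le> t k)"
          using \<tau> unfolding bounded_stopping_time_def stopping_time_def by blast
        then have "{\<omega> \<in> index_paths. \<tau> \<omega> \<le> t k} \<in> sets (index_algebra {0..t k})"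
          unfolding pred_def by simp
        then have "space (index_algebra {0..t k}) - {\<omega> \<in> index_paths. \<tau> \<omega> \<le> t k} \<in> sets (index_algebra {0..t k})"
          by (rule sets.compl_sets)
        moreover have "space (index_algebra {0..t k}) - {\<omega> \<in> index_paths. \<tau> \<omega> \<le> t k} = A k"
          by (auto simp: A_def t_def)
        ultimately show ?thesis by simp
      qed
      have S: "integrable P (\<lambda>\<omega>. indicator (A k) \<omega> * (V (t k) \<omega> - V (t (Suc k)) \<omega>))"
          "integrable P (\<lambda>\<omega>. indicator (A k) \<omega> * (LBINT s:{t k..t (Suc k)}. cost \<omega> s))"
          "expectation (\<lambda>\<omega>. indicator (A k) \<omega> * (V (t k) \<omega> - V (t (Suc k)) \<omega>))
          \<le> expectation (\<lambda>\<omega>. indicator (A k) \<omega> * (LBINT s:{t k..t (Suc k)}. cost \<omega> s)) + h n * (M * e + 2 * C * K' * h n)"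
        if k: "k < Suc n" for k
      proof -
        have modulus: "\<bar>val j v - val j w\<bar> \<le> e"
          if "v \<in> cball x0 (R * T)" "w \<in> cball x0 (R * T)" "dist v w \<le> R * h n" for j v w
        proof -
          have "dist v w < d2 j" using that(3) n(2) d(2)[of j] by linarith
          then show ?thesis using d2(2)[OF that(2,1), of j] by (simp add: dist_real_def)
        qed
        note st = step[OF tame less_imp_le[OF RC(1)] RC(2) t0(1)[of k] h0[of n] tT[OF k] AF[of k] B
            K'(2)[OF t0(1) less_imp_le[OF h0]] K'(3)[OF t0(1) less_imp_le[OF h0]] K'(4)[OF t0(1) less_imp_le[OF h0]]
            less_imp_le[OF e] d1(2)[OF less_imp_le[OF h0] less_imp_le[OF n(1)]] modulus K]
        show "integrable P (\<lambda>\<omega>. indicator (A k) \<omega> * (V (t k) \<omega> - V (t (Suc k)) \<omega>))"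
          using st(1) by (simp only: V_def t0(2))
        show "integrable P (\<lambda>\<omega>. indicator (A k) \<omega> * (LBINT s:{t k..t (Suc k)}. cost \<omega> s))"
          using st(2) by (simp only: t0(2))
        show "expectation (\<lambda>\<omega>. indicator (A k) \<omega> * (V (t k) \<omega> - V (t (Suc k)) \<omega>))
          \<le> expectation (\<lambda>\<omega>. indicator (A k) \<omega> * (LBINT s:{t k..t (Suc k)}. cost \<omega> s)) + h n * (M * e + 2 * C * K' * h n)"
          using st(3) by (simp only: V_def t0(2) M_def)
      qed
      \<comment> \<open>Summing over the events \<open>A k\<close> selects the steps before the stopping time.\<close>
      have pick: "(\<Sum>k<Suc n. indicator (A k) \<omega> * f k) = (\<Sum>k<\<kappa> n \<omega>. f k)" if \<omega>: "\<omega> \<in> index_paths" for f :: "nat \<Rightarrow> real" and \<omega>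
      proof -
        have "(\<Sum>k<Suc n. indicator (A k) \<omega> * f k) = (\<Sum>k<Suc n. if k \<in> {..<\<kappa> n \<omega>} then f k else 0)"
          using \<omega> by (intro sum.cong refl) (auto simp: A_def \<kappa>_iff indicator_def)
        also have "\<dots> = sum f ({..<Suc n} \<inter> {..<\<kappa> n \<omega>})" by (rule sum.inter_restrict[symmetric]) simp
        also have "{..<Suc n} \<inter> {..<\<kappa> n \<omega>} = {..<\<kappa> n \<omega>}" using \<sigma>(3)[OF \<omega>, of n] by auto
        finally show ?thesis .
      qed
      have V_sum: "(\<Sum>k<Suc n. indicator (A k) \<omega> * (V (t k) \<omega> - V (t (Suc k)) \<omega>)) = V 0 \<omega> - V (\<sigma> n \<omega>) \<omega>" if "\<omega> \<in> index_paths" for \<omega>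
        unfolding pick[OF that] using sum_lessThan_telescope'[of "\<lambda>k. V (t k) \<omega>" "\<kappa> n \<omega>"] by (simp add: t_def \<sigma>_def)
      have c_sum: "(\<Sum>k<Suc n. indicator (A k) \<omega> * (LBINT s:{t k..t (Suc k)}. cost \<omega> s)) \<le> (LBINT s:{0..\<tau> \<omega>}. cost \<omega> s) + C * h n"
        if tm: "tame T R C \<omega>" for \<omega>
      proof -
        note \<omega> = tame_path[OF tm]
        have "(\<Sum>k<m. LBINT s:{t k..t (Suc k)}. cost \<omega> s) = (LBINT s:{0..t m}. cost \<omega> s)" if "m \<le> Suc n" for m
          using that
        proof (induction m)
          case 0
          have "AE s in lborel. s \<notin> {0::real}" using AE_lborel_singleton[of "0::real"] by simp
          then have "(LBINT s:{0..0}. cost \<omega> s) = 0"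
            unfolding set_lebesgue_integral_def by (intro integral_eq_zero_AE) (auto elim!: eventually_mono)
          then show ?case by (simp add: t_def)
        next
          case (Suc m)
          have "t (Suc m) \<le> T" using tT[of m] Suc.prems by (simp add: t0)
          then have "(LBINT s:{0..t (Suc m)}. cost \<omega> s) = (LBINT s:{0..t m}. cost \<omega> s) + (LBINT s:{t m..t (Suc m)}. cost \<omega> s)"
            using t0[of m] h0[of n] by (intro tame_integral_add[OF tm]) auto
          then show ?case using Suc by simp
        qed
        from this[OF \<sigma>(3)[OF \<omega>]] have "(\<Sum>k<Suc n. indicator (A k) \<omega> * (LBINT s:{t k..t (Suc k)}. cost \<omega> s)) = (LBINT s:{0..\<sigma> n \<omega>}. cost \<omega> s)"
          unfolding pick[OF \<omega>] by (simp add: t_def \<sigma>_def)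
        also have "\<dots> = (LBINT s:{0..\<tau> \<omega>}. cost \<omega> s) + (LBINT s:{\<tau> \<omega>..\<sigma> n \<omega>}. cost \<omega> s)"
          by (rule tame_integral_add[OF tm]) (use \<sigma>[OF \<omega>, of n] \<tau>0[OF \<omega>] in auto)
        also have "(LBINT s:{\<tau> \<omega>..\<sigma> n \<omega>}. cost \<omega> s) \<le> C * (\<sigma> n \<omega> - \<tau> \<omega>)"
          using tame_integral_bound[OF tm \<tau>0[OF \<omega>] \<sigma>(1)[OF \<omega>, of n] \<sigma>(4)[OF \<omega>, of n]] by linarith
        also have "C * (\<sigma> n \<omega> - \<tau> \<omega>) \<le> C * h n" using \<sigma>(2)[OF \<omega>, of n] RC by (intro mult_left_mono) auto
        finally show ?thesis by simp
      qed
      have "expectation (\<lambda>\<omega>. V 0 \<omega> - V (\<sigma> n \<omega>) \<omega>) = expectation (\<lambda>\<omega>. \<Sum>k<Suc n. indicator (A k) \<omega> * (V (t k) \<omega> - V (t (Suc k)) \<omega>))"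
        by (intro Bochner_Integration.integral_cong refl V_sum[symmetric]) simp
      also have "\<dots> = (\<Sum>k<Suc n. expectation (\<lambda>\<omega>. indicator (A k) \<omega> * (V (t k) \<omega> - V (t (Suc k)) \<omega>)))"
        by (rule Bochner_Integration.integral_sum) (use S(1) in auto)
      also have "\<dots> \<le> (\<Sum>k<Suc n. expectation (\<lambda>\<omega>. indicator (A k) \<omega> * (LBINT s:{t k..t (Suc k)}. cost \<omega> s)) + h n * (M * e + 2 * C * K' * h n))"
        by (rule sum_mono) (use S(3) in auto)
      also have "\<dots> = (\<Sum>k<Suc n. expectation (\<lambda>\<omega>. indicator (A k) \<omega> * (LBINT s:{t k..t (Suc k)}. cost \<omega> s))) + real (Suc n) * (h n * (M * e + 2 * C * K' * h n))"
        by (simp only: sum.distrib sum_constant card_lessThan)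
      also have "real (Suc n) * (h n * (M * e + 2 * C * K' * h n)) = T * (M * e + 2 * C * K' * h n)"
        by (simp only: mult.assoc[symmetric] hT)
      also have "(\<Sum>k<Suc n. expectation (\<lambda>\<omega>. indicator (A k) \<omega> * (LBINT s:{t k..t (Suc k)}. cost \<omega> s))) =
          expectation (\<lambda>\<omega>. \<Sum>k<Suc n. indicator (A k) \<omega> * (LBINT s:{t k..t (Suc k)}. cost \<omega> s))"
        by (rule Bochner_Integration.integral_sum[symmetric]) (use S(2) in auto)
      also have "\<dots> \<le> expectation (\<lambda>\<omega>. (LBINT s:{0..\<tau> \<omega>}. cost \<omega> s) + C * h n)"
      proof (rule integral_mono_AE)
        show "integrable P (\<lambda>\<omega>. \<Sum>k<Suc n. indicator (A k) \<omega> * (LBINT s:{t k..t (Suc k)}. cost \<omega> s))"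
          by (rule Bochner_Integration.integrable_sum) (use S(2) in auto)
        show "integrable P (\<lambda>\<omega>. (LBINT s:{0..\<tau> \<omega>}. cost \<omega> s) + C * h n)" using cost_int by simp
        show "AE \<omega> in P. (\<Sum>k<Suc n. indicator (A k) \<omega> * (LBINT s:{t k..t (Suc k)}. cost \<omega> s)) \<le> (LBINT s:{0..\<tau> \<omega>}. cost \<omega> s) + C * h n"
          using tame by (rule eventually_mono) (rule c_sum)
      qed
      also have "\<dots> = E\<^sub>c + C * h n" using cost_int by (simp add: E\<^sub>c_def prob_space)
      finally show ?thesis by simp
    qed
    have conv: "(\<lambda>n. expectation (\<lambda>\<omega>. V 0 \<omega> - V (\<sigma> n \<omega>) \<omega>)) \<longlonglongrightarrow> expectation (\<lambda>\<omega>. V 0 \<omega> - V (\<tau> \<omega>) \<omega>)"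
    proof (rule integral_dominated_convergence[where w="\<lambda>_. 2 * B"])
      show "(\<lambda>\<omega>. V 0 \<omega> - V (\<tau> \<omega>) \<omega>) \<in> borel_measurable P" by (intro borel_measurable_diff Vm) simp_all
      show "(\<lambda>\<omega>. V 0 \<omega> - V (\<sigma> n \<omega>) \<omega>) \<in> borel_measurable P" for n by (intro borel_measurable_diff Vm \<sigma>m) simp_all
      show "AE \<omega> in P. norm (V 0 \<omega> - V (\<sigma> n \<omega>) \<omega>) \<le> 2 * B" for n
      proof (rule AE_I2)
        fix \<omega> show "norm (V 0 \<omega> - V (\<sigma> n \<omega>) \<omega>) \<le> 2 * B"
          using Vb[of 0 \<omega>] Vb[of "\<sigma> n \<omega>" \<omega>] unfolding real_norm_def by linarith
      qed
      show "AE \<omega> in P. (\<lambda>n. V 0 \<omega> - V (\<sigma> n \<omega>) \<omega>) \<longlonglongrightarrow> V 0 \<omega> - V (\<tau> \<omega>) \<omega>"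
      proof (rule AE_I2)
        fix \<omega> assume "\<omega> \<in> space P"
        then have \<omega>: "\<omega> \<in> index_paths" by simp
        have "(\<lambda>n. \<tau> \<omega> + h n) \<longlonglongrightarrow> \<tau> \<omega> + 0" by (intro tendsto_intros hlim)
        then have \<sigma>lim: "(\<lambda>n. \<sigma> n \<omega>) \<longlonglongrightarrow> \<tau> \<omega>"
          by (intro tendsto_sandwich[of "\<lambda>_. \<tau> \<omega>" "\<lambda>n. \<sigma> n \<omega>" sequentially "\<lambda>n. \<tau> \<omega> + h n"])
             (auto intro!: always_eventually \<sigma>[OF \<omega>])
        \<comment> \<open>The grid times approach \<open>\<tau> \<omega>\<close> from the right, where the state is eventually constant.\<close>
        obtain b where b: "b > \<tau> \<omega>" "\<And>y. \<tau> \<omega> < y \<Longrightarrow> y < b \<Longrightarrow> \<omega> y = \<omega> (\<tau> \<omega>)"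
          using index_path_right_constant[OF \<omega> \<tau>0[OF \<omega>]] unfolding eventually_at_right_field by blast
        have ev: "eventually (\<lambda>n. \<omega> (\<sigma> n \<omega>) = \<omega> (\<tau> \<omega>)) sequentially"
          using order_tendstoD(2)[OF \<sigma>lim b(1)]
        proof eventually_elim
          case (elim n)
          then show ?case using b(2)[of "\<sigma> n \<omega>"] \<sigma>(1)[OF \<omega>, of n] by (cases "\<sigma> n \<omega> = \<tau> \<omega>") auto
        qed
        have "(\<lambda>n. curve \<omega> (\<sigma> n \<omega>)) \<longlonglongrightarrow> curve \<omega> (\<tau> \<omega>)"
          by (rule continuous_on_tendsto_compose[OF curve_continuous[OF \<omega>, of T] \<sigma>lim])
             (use T(2)[OF \<omega>] \<tau>0[OF \<omega>] \<sigma>[OF \<omega>] in \<open>auto intro!: always_eventually intro: order_trans\<close>)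
        from continuous_on_tendsto_compose[OF val_continuous[of UNIV "\<omega> (\<tau> \<omega>)"] this]
        have "(\<lambda>n. val (\<omega> (\<tau> \<omega>)) (curve \<omega> (\<sigma> n \<omega>))) \<longlonglongrightarrow> V (\<tau> \<omega>) \<omega>" by (simp add: V_def)
        then have "(\<lambda>n. V (\<sigma> n \<omega>) \<omega>) \<longlonglongrightarrow> V (\<tau> \<omega>) \<omega>"
          by (rule Lim_transform_eventually) (use ev in \<open>auto simp: V_def elim!: eventually_mono\<close>)
        then show "(\<lambda>n. V 0 \<omega> - V (\<sigma> n \<omega>) \<omega>) \<longlonglongrightarrow> V 0 \<omega> - V (\<tau> \<omega>) \<omega>" by (intro tendsto_intros)
      qed
    qed simp
    have "(\<lambda>n. E\<^sub>c + C * h n + T * (M * e + 2 * C * K' * h n)) \<longlonglongrightarrow> E\<^sub>c + C * 0 + T * (M * e + 2 * C * K' * 0)"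
      by (intro tendsto_intros hlim)
    then have rlim: "(\<lambda>n. E\<^sub>c + C * h n + T * (M * e + 2 * C * K' * h n)) \<longlonglongrightarrow> E\<^sub>c + T * (M * e)" by simp
    show ?thesis
    proof (rule tendsto_le[OF _ rlim conv])
      show "eventually (\<lambda>n. expectation (\<lambda>\<omega>. V 0 \<omega> - V (\<sigma> n \<omega>) \<omega>) \<le> E\<^sub>c + C * h n + T * (M * e + 2 * C * K' * h n)) sequentially"
        using ev1 ev2 by eventually_elim (rule grid)
    qed simp
  qed
  have "expectation (\<lambda>\<omega>. V 0 \<omega> - V (\<tau> \<omega>) \<omega>) \<le> E\<^sub>c"
  proof (rule field_le_epsilon)
    fix e :: real assume e: "0 < e"
    \<comment> \<open>The summand \<open>1\<close> keeps the denominator positive when \<open>T * M = 0\<close>.\<close>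
    define e' where "e' = e / (T * M + 1)"
    have TM: "0 \<le> T * M" using T(1) M0 by simp
    have "0 < e'" "T * M * e' \<le> e" using e TM by (auto simp: e'_def field_simps)
    then show "expectation (\<lambda>\<omega>. V 0 \<omega> - V (\<tau> \<omega>) \<omega>) \<le> E\<^sub>c + e" using main[of e'] by (simp add: mult.assoc)
  qed
  moreover have "expectation (\<lambda>\<omega>. V 0 \<omega> - V (\<tau> \<omega>) \<omega>) = expectation (\<lambda>\<omega>. val (\<omega> 0) x0 - val (\<omega> (\<tau> \<omega>)) (curve \<omega> (\<tau> \<omega>)))"
    by (intro Bochner_Integration.integral_cong refl)
       (simp add: V_def curve_def primitive_0[OF control_cadlag])
  ultimately show ?thesis by (simp add: E\<^sub>c_def)
qed

end

section \<open>The converse: constant controls\<close>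

lemma const_path_cadlag: "restrict (\<lambda>_. q) {0..} \<in> cadlag_paths (euclidean :: 'a::topological_space topology)"
proof -
  have "((restrict (\<lambda>_. q) {0..}) \<longlongrightarrow> q) (at_right t)" if "0 \<le> t" for t :: real
    by (rule tendsto_eventually)
       (use that in \<open>auto simp: eventually_at_right_field intro!: exI[of _ "t + 1"]\<close>)
  moreover have "((restrict (\<lambda>_. q) {0..}) \<longlongrightarrow> q) (at_left t)" if "0 < t" for t :: real
    by (rule tendsto_eventually)
       (use that in \<open>auto simp: eventually_at_left_field intro!: exI[of _ 0]\<close>)
  moreover have "restrict (\<lambda>_. q) {0..} t = q" if "0 \<le> t" for t :: real using that by simp
  moreover have "restrict (\<lambda>_. q) {0..} \<in> extensional {0 :: real..}" by simp
  ultimately show ?thesis unfolding cadlag_paths_def limitin_canonical_iff by (smt (verit, best) mem_Collect_eq)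
qed

lemma primitive_const: "0 \<le> t \<Longrightarrow> primitive (restrict (\<lambda>_. q) {0..}) t = t *\<^sub>R q"
proof -
  assume t: "0 \<le> t"
  have "primitive (restrict (\<lambda>_. q) {0..}) t = (LBINT s:{0..t}. q)"
    unfolding primitive_def by (intro set_lebesgue_integral_cong) auto
  also have "\<dots> = t *\<^sub>R q" using t by (simp add: set_lebesgue_integral_def)
  finally show ?thesis .
qed

lemma control_const:
  fixes \<Lambda> :: "real^'m::finite^'m" and q :: "real^'n::finite"
  shows "control \<Lambda> (\<lambda>_. restrict (\<lambda>_. q) {0..})"
  unfolding control_def
proof (intro conjI allI impI)
  show "(\<lambda>_. restrict (\<lambda>_. q) {0..}) \<in> measurable (index_algebra {0..}) (path_algebra euclidean {0..})"
    by (rule measurable_const) (simp add: const_path_cadlag)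
  fix t :: real assume t: "0 < t"
  have "(SUP s\<in>{0..t}. norm (restrict (\<lambda>_. q) {0..} s)) = norm q"
    using t by (intro cSup_eq_maximum) (auto intro!: image_eqI[of _ _ 0])
  then have "almost_surely \<Lambda> (\<lambda>\<omega>. (SUP s\<in>{0..t}. norm (restrict (\<lambda>_. q) {0..} s)) < norm q + 1)"
    by (simp add: almost_surely_def)
  then show "\<exists>R>0. almost_surely \<Lambda> (\<lambda>\<omega>. (SUP s\<in>{0..t}. norm (restrict (\<lambda>_. q) {0..} s)) < R)"
    by (intro exI[of _ "norm q + 1"]) (auto intro: add_nonneg_pos)
qed auto

lemma bounded_stopping_time_const: "0 \<le> t \<Longrightarrow> bounded_stopping_time (\<lambda>_. t)"
  by (auto simp: bounded_stopping_time_def stopping_time_def)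

lemma axis_in_simplex: "axis i 1 \<in> prob_simplex"
  by (auto simp: prob_simplex_def axis_def)

lemma (in coupling) path_law_axis: "path_law \<Lambda> (axis i 1) = law_from i"
proof -
  interpret chain \<Lambda> "axis i 1" by unfold_locales (rule axis_in_simplex)
  interpret L: prob_space "law_from i" by (rule prob_law_from)
  show ?thesis
  proof (rule measure_eqI)
    fix X assume "X \<in> sets P"
    then have X: "X \<in> sets (index_algebra {0..})" by simp
    have "prob X = (\<Sum>k\<in>UNIV. axis i 1 $ k * measure (law_from k) X)"
      unfolding path_law_eq[OF axis_in_simplex] by (rule measure_mixture_law[OF axis_in_simplex X])
    also have "\<dots> = measure (law_from i) X"
      by (simp add: axis_def if_distrib[of "\<lambda>x. x * _"] cong: if_cong)
    finally show "emeasure P X = emeasure (law_from i) X"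
      by (simp add: emeasure_eq_measure L.emeasure_eq_measure)
  qed simp
qed

locale stochastic_inequality = hamiltonian H + coupling \<Lambda>
  for H :: "'m::finite \<Rightarrow> 'n::finite torus \<Rightarrow> real^'n \<Rightarrow> real" and \<Lambda> :: "real^'m^'m" +
  fixes \<alpha> :: real and u :: "'n torus \<Rightarrow> real^'m"
  assumes inequality: "\<And>x y a \<tau> \<Xi>. a \<in> prob_simplex \<Longrightarrow> bounded_stopping_time \<tau> \<Longrightarrow> \<Xi> \<in> controls_to \<Lambda> \<tau> (y - x) \<Longrightarrow>
        prob_space.expectation (path_law \<Lambda> a) (\<lambda>\<omega>. u x $ \<omega> 0 - u y $ \<omega> (\<tau> \<omega>))
        \<le> prob_space.expectation (path_law \<Lambda> a) (\<lambda>\<omega>.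
            LBINT s:{0..\<tau> \<omega>}.
              (lagrangian H (\<omega> s) (x + torus_integral (\<Xi> \<omega>) s) (- \<Xi> \<omega> s) + \<alpha>))"
begin

definition val :: "'m \<Rightarrow> real^'n \<Rightarrow> real" where
  "val j v = u (to_torus v) $ j"

text \<open>The inequality for the chain started in \<open>i\<close> and the constant velocity \<open>q\<close>; one constant \<open>K\<close>
  serves all positions, velocities and times.\<close>

definition constant_control_bound :: "'m \<Rightarrow> real \<Rightarrow> bool" where
  "constant_control_bound i K \<longleftrightarrow> 0 \<le> K \<and> (\<forall>x0 q t c C. 0 < t \<and>
      (\<forall>s\<in>{0..t}. lagrangian H i (to_torus (x0 + s *\<^sub>R q)) (- q) + \<alpha> \<le> c) \<and>
      (\<forall>j z. \<bar>lagrangian H j z (- q)\<bar> \<le> C) \<longrightarrow>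
      val i x0 - (\<Sum>j\<in>UNIV. transition t i j * val j (x0 + t *\<^sub>R q)) \<le> t * c + 2 * C * K * t * t)"

lemma constant_control_boundD:
  assumes "constant_control_bound i K"
  shows "0 \<le> K"
    and "0 < t \<Longrightarrow> (\<And>s. s \<in> {0..t} \<Longrightarrow> lagrangian H i (to_torus (x0 + s *\<^sub>R q)) (- q) + \<alpha> \<le> c) \<Longrightarrow>
      (\<And>j z. \<bar>lagrangian H j z (- q)\<bar> \<le> C) \<Longrightarrow>
      val i x0 - (\<Sum>j\<in>UNIV. transition t i j * val j (x0 + t *\<^sub>R q)) \<le> t * c + 2 * C * K * t * t"
  using assms unfolding constant_control_bound_def by blast+

text \<open>The cost is that of the state \<open>i\<close> except while the chain is away from \<open>i\<close>, and the expected
  time away is quadratic in \<open>t\<close>.\<close>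

lemma constant_control_inequality:
  obtains K where "constant_control_bound i K"
proof -
  have "chain \<Lambda> (axis i 1)" by (intro chain.intro coupling_axioms chain_axioms.intro axis_in_simplex)
  then interpret ch: chain \<Lambda> "axis i 1" .
  have start: "AE \<omega> in ch.P. \<omega> 0 = i" unfolding path_law_axis by (rule law_from_start)
  obtain K where K: "0 \<le> K"
    "\<And>t h. 0 \<le> t \<Longrightarrow> 0 \<le> h \<Longrightarrow> ch.prob {\<omega> \<in> index_paths. \<omega> (t + h) \<noteq> \<omega> t} \<le> K * h"
    "\<And>t h. 0 \<le> t \<Longrightarrow> 0 \<le> h \<Longrightarrow> integrable ch.P (\<lambda>\<omega>. LBINT s:{t..t+h}. of_bool (\<omega> s \<noteq> \<omega> t) :: real)"
    "\<And>t h. 0 \<le> t \<Longrightarrow> 0 \<le> h \<Longrightarrow> ch.expectation (\<lambda>\<omega>. LBINT s:{t..t+h}. of_bool (\<omega> s \<noteq> \<omega> t)) \<le> K * h * h"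
    using ch.expected_time_away by blast
  have "constant_control_bound i K"
    unfolding constant_control_bound_def
  proof (intro conjI K(1) allI impI; elim conjE)
    fix x0 q :: "real^'n" and t c C :: real
    assume t: "0 < t" and "\<forall>s\<in>{0..t}. lagrangian H i (to_torus (x0 + s *\<^sub>R q)) (- q) + \<alpha> \<le> c"
      and "\<forall>j z. \<bar>lagrangian H j z (- q)\<bar> \<le> C"
    then have c: "\<And>s. s \<in> {0..t} \<Longrightarrow> lagrangian H i (to_torus (x0 + s *\<^sub>R q)) (- q) + \<alpha> \<le> c"
      and C: "\<And>j z. \<bar>lagrangian H j z (- q)\<bar> \<le> C" by auto
    define \<Xi> where "\<Xi> = (\<lambda>_ :: real \<Rightarrow> 'm. restrict (\<lambda>_. q) {0 :: real..})"
    interpret co: controlled H \<Lambda> "axis i 1" \<Xi> x0 \<alpha>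
      by unfold_locales (simp add: \<Xi>_def control_const)
    have prim: "primitive (\<Xi> \<omega>) s = s *\<^sub>R q" if "0 \<le> s" for s \<omega>
      using primitive_const[OF that] by (simp add: \<Xi>_def)
    define y where "y = to_torus (x0 + t *\<^sub>R q)"
    have "\<Xi> \<in> controls_to \<Lambda> (\<lambda>_. t) (y - to_torus x0)"
      unfolding controls_to_def almost_surely_def torus_integral_def primitive_def[symmetric]
      using co.control t by (simp add: prim y_def to_torus_add)
    from inequality[OF axis_in_simplex bounded_stopping_time_const this, of i] t
    have ineq: "ch.expectation (\<lambda>\<omega>. u (to_torus x0) $ \<omega> 0 - u y $ \<omega> t) \<le>
        ch.expectation (\<lambda>\<omega>. LBINT s:{0..t}. co.cost \<omega> s)"
      by (simp add: co.cost_def[abs_def] co.curve_def torus_integral_def primitive_def[symmetric] to_torus_add)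
    have m: "(\<lambda>\<omega>. f (\<omega> s)) \<in> borel_measurable ch.P" if "0 \<le> s" for f :: "'m \<Rightarrow> real" and s
      by (rule measurable_compose[OF ch.measurable_eval[OF that]]) simp
    have lhs: "ch.expectation (\<lambda>\<omega>. u (to_torus x0) $ \<omega> 0 - u y $ \<omega> t) =
        val i x0 - (\<Sum>j\<in>UNIV. transition t i j * val j (x0 + t *\<^sub>R q))"
    proof -
      have bnd: "\<bar>u y $ j\<bar> \<le> (\<Sum>j\<in>UNIV. \<bar>u y $ j\<bar>)" for j by (intro member_le_sum) auto
      note M = ch.markov_expectation[of 0 t "\<lambda>j _. u y $ j" "\<Sum>j\<in>UNIV. \<bar>u y $ j\<bar>", OF order_refl t, simplified, OF bnd]
      have 0: "ch.expectation (\<lambda>\<omega>. u (to_torus x0) $ \<omega> 0) = val i x0"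
      proof -
        have "ch.expectation (\<lambda>\<omega>. u (to_torus x0) $ \<omega> 0) = ch.expectation (\<lambda>\<omega>. val i x0)"
          using start by (intro integral_cong_AE m) (auto simp: val_def elim: eventually_mono)
        then show ?thesis by (simp add: ch.prob_space)
      qed
      have i0: "integrable ch.P (\<lambda>\<omega>. u (to_torus x0) $ \<omega> 0)"
        by (rule ch.integrable_const_bound[where B="\<Sum>j\<in>UNIV. \<bar>u (to_torus x0) $ j\<bar>"])
           (auto intro!: m member_le_sum)
      have "ch.expectation (\<lambda>\<omega>. u y $ \<omega> t) = ch.expectation (\<lambda>\<omega>. \<Sum>j\<in>UNIV. transition t (\<omega> 0) j * u y $ j)"
        by (rule M(3))
      also have "\<dots> = ch.expectation (\<lambda>\<omega>. \<Sum>j\<in>UNIV. transition t i j * u y $ j)"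
      proof (rule integral_cong_AE)
        show "(\<lambda>\<omega>. \<Sum>j\<in>UNIV. transition t (\<omega> 0) j * u y $ j) \<in> borel_measurable ch.P"
          by (rule measurable_compose[OF ch.measurable_eval[OF order_refl]]) simp
      qed (use start in \<open>auto elim: eventually_mono\<close>)
      finally have "ch.expectation (\<lambda>\<omega>. u y $ \<omega> t) = (\<Sum>j\<in>UNIV. transition t i j * u y $ j)"
        by (simp add: ch.prob_space)
      then show ?thesis using i0 M(1) 0 by (simp add: val_def y_def)
    qed
    have "ch.expectation (\<lambda>\<omega>. LBINT s:{0..t}. co.cost \<omega> s) \<le>
        ch.expectation (\<lambda>\<omega>. t * c + 2 * C * (LBINT s:{0..0+t}. of_bool (\<omega> s \<noteq> \<omega> 0)))"
    proof (rule integral_mono_AE)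
      obtain R C' where tame: "AE \<omega> in ch.P. co.tame t R C' \<omega>" using co.AE_tame[OF t] by blast
      show "integrable ch.P (\<lambda>\<omega>. LBINT s:{0..t}. co.cost \<omega> s)"
      proof (rule ch.integrable_const_bound[where B="C' * t"])
        show "AE \<omega> in ch.P. norm (LBINT s:{0..t}. co.cost \<omega> s) \<le> C' * t"
          using tame
        proof eventually_elim
          case (elim \<omega>)
          show ?case using co.tame_integral_bound[OF elim, of 0 t] t by simp
        qed
      qed (intro co.measurable_cost_integral, simp_all)
      show "integrable ch.P (\<lambda>\<omega>. t * c + 2 * C * (LBINT s:{0..0+t}. of_bool (\<omega> s \<noteq> \<omega> 0)))"
        using K(3)[of 0 t] t by simp
      show "AE \<omega> in ch.P. (LBINT s:{0..t}. co.cost \<omega> s) \<le> t * c + 2 * C * (LBINT s:{0..0+t}. of_bool (\<omega> s \<noteq> \<omega> 0))"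
        using tame start
      proof eventually_elim
        case (elim \<omega>)
        have \<omega>: "\<omega> \<in> index_paths" using elim(1) by (rule co.tame_path)
        note away = co.time_away_integrable[OF \<omega>, of 0 t "\<omega> 0"]
        have const: "set_integrable lborel {0..t} (\<lambda>_. c)"
          unfolding set_integrable_def by (intro integrable_scaleR_left integrable_real_indicator) (auto simp: emeasure_lborel_Icc_eq)
        have "(LBINT s:{0..t}. co.cost \<omega> s) \<le> (LBINT s:{0..t}. c + 2 * C * of_bool (\<omega> s \<noteq> \<omega> 0))"
        proof (rule set_integral_mono)
          show "set_integrable lborel {0..t} (co.cost \<omega>)" using co.tame_integrable[OF elim(1), of 0 t] by simp
          show "set_integrable lborel {0..t} (\<lambda>s. c + 2 * C * of_bool (\<omega> s \<noteq> \<omega> 0))"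
            by (intro set_integral_add(1) const set_integrable_mult_right away)
          fix s assume s: "s \<in> {0..t}"
          have cost: "co.cost \<omega> s = lagrangian H (\<omega> s) (to_torus (x0 + s *\<^sub>R q)) (- q) + \<alpha>"
            using s by (simp add: co.cost_def co.curve_def prim) (simp add: \<Xi>_def)
          show "co.cost \<omega> s \<le> c + 2 * C * of_bool (\<omega> s \<noteq> \<omega> 0)"
          proof (cases "\<omega> s = \<omega> 0")
            case True
            then show ?thesis using c[OF s] elim(2) by (simp add: cost)
          next
            case False
            then show ?thesis
              using c[OF s] C[of i "to_torus (x0 + s *\<^sub>R q)"] C[of "\<omega> s" "to_torus (x0 + s *\<^sub>R q)"]
              by (simp add: cost)
          qed
        qed
        also have "\<dots> = t * c + 2 * C * (LBINT s:{0..t}. of_bool (\<omega> s \<noteq> \<omega> 0))"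
          using const away t
          by (simp add: set_integral_add set_integrable_mult_right set_integral_mult_right)
             (simp add: set_lebesgue_integral_def)
        finally show ?case by simp
      qed
    qed
    also have "\<dots> = t * c + 2 * C * ch.expectation (\<lambda>\<omega>. LBINT s:{0..0+t}. of_bool (\<omega> s \<noteq> \<omega> 0))"
      using K(3)[of 0 t] t by (simp add: ch.prob_space)
    also have "\<dots> \<le> t * c + 2 * C * (K * t * t)"
    proof -
      have "0 \<le> C" using C[of i "to_torus x0"] by linarith
      then show ?thesis using K(4)[of 0 t] t by (intro add_left_mono mult_left_mono) auto
    qed
    finally show "val i x0 - (\<Sum>j\<in>UNIV. transition t i j * val j (x0 + t *\<^sub>R q)) \<le> t * c + 2 * C * K * t * t"
      using ineq lhs by (simp add: mult.assoc)
  qed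
  then show thesis by (rule that)
qed

end

context stochastic_inequality
begin

text \<open>Any two points are joined in a fixed short time at bounded speed, which gives an upper bound
  first and then, since the chain stays put with probability at least one half, a lower bound.\<close>

lemma val_bounded:
  obtains B where "0 \<le> B" "\<And>j v. \<bar>val j v\<bar> \<le> B"
proof -
  obtain d where d: "0 < d" "\<And>h i j. 0 \<le> h \<Longrightarrow> h \<le> d \<Longrightarrow>
     \<bar>transition h i j - mat 1 $ i $ j + h * \<Lambda> $ i $ j\<bar> \<le> 1 * h"
    using chain_semigroup_expansion[of 1 \<Lambda>] by auto
  \<comment> \<open>Short enough for the diagonal of the transition matrix to be at least \<open>1 / 2\<close>.\<close>
  define t where "t = min d (1 / (2 * (1 + rate)))"
  have t: "0 < t" "t \<le> d" "t * (1 + rate) \<le> 1 / 2"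
  proof -
    show "0 < t" "t \<le> d" using d(1) rate_pos by (auto simp: t_def)
    have "t \<le> 1 / (2 * (1 + rate))" by (simp add: t_def)
    then show "t * (1 + rate) \<le> 1 / 2" using rate_pos by (simp add: field_simps)
  qed
  define E where "E = chain_semigroup \<Lambda> t"
  have E: "0 \<le> E $ i $ j" "(\<Sum>j\<in>UNIV. E $ i $ j) = 1" for i j
    unfolding E_def 
    using chain_semigroup_nonneg[OF less_imp_le[OF t(1)]] chain_semigroup_row_sum[OF less_imp_le[OF t(1)]] by auto
  have diag: "1 / 2 \<le> E $ i $ i" for i
  proof -
    have "\<bar>E $ i $ i - 1 + t * \<Lambda> $ i $ i\<bar> \<le> t"
      using d(2)[of t i i] t by (simp add: E_def mat_def)
    moreover have "t * \<Lambda> $ i $ i \<le> t * rate" using t rate_diag[of i] by (intro mult_left_mono) auto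
    ultimately show ?thesis using t(3) by (simp add: algebra_simps abs_le_iff)
  qed
  have "bounded (cbox 0 (1 :: real^'n))" by (rule bounded_cbox)
  then obtain R where R: "\<And>v :: real^'n. v \<in> cbox 0 1 \<Longrightarrow> norm v \<le> R" unfolding bounded_iff by blast
  obtain C where C: "\<And>i z q. norm q \<le> 2 * R / t \<Longrightarrow> \<bar>lagrangian H i z q\<bar> \<le> C"
    using lagrangian_bounded[of "2 * R / t"] by blast
  have "\<exists>G. \<forall>v\<in>cbox 0 1. \<forall>w\<in>cbox 0 1. val i v - (\<Sum>j\<in>UNIV. E $ i $ j * val j w) \<le> G" for i
  proof -
    obtain K where "constant_control_bound i K" by (rule constant_control_inequality)
    note K = constant_control_boundD[OF this]
    have "val i v - (\<Sum>j\<in>UNIV. E $ i $ j * val j w) \<le> t * (C + \<alpha>) + 2 * C * K * t * t"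
      if vw: "v \<in> cbox 0 1" "w \<in> cbox 0 1" for v w
    proof -
      define q where "q = (1 / t) *\<^sub>R (w - v)"
      have "norm (w - v) \<le> 2 * R" using norm_triangle_ineq4[of w v] R[OF vw(1)] R[OF vw(2)] by linarith
      then have q: "norm (- q) \<le> 2 * R / t" using t(1) by (simp add: q_def divide_right_mono)
      have L: "\<bar>lagrangian H j z (- q)\<bar> \<le> C" for j z by (rule C[OF q])
      have "v + t *\<^sub>R q = w" using t(1) by (simp add: q_def)
      moreover have "lagrangian H i z (- q) + \<alpha> \<le> C + \<alpha>" for z using L[of i z] by linarith
      ultimately show ?thesis using K(2)[OF t(1), of v q "C + \<alpha>" C, OF _ L] by (simp add: E_def)
    qed
    then show ?thesis by blast
  qed
  then obtain G where G: "\<And>i v w. v \<in> cbox 0 1 \<Longrightarrow> w \<in> cbox 0 1 \<Longrightarrow> val i v - (\<Sum>j\<in>UNIV. E $ i $ j * val j w) \<le> G i"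
    by metis
  have 0: "(0 :: real^'n) \<in> cbox 0 1" by (auto simp: mem_box_cart)
  define U where "U = (\<Sum>i\<in>UNIV. \<bar>G i\<bar>) + (\<Sum>j\<in>UNIV. \<bar>val j 0\<bar>)"
  have Gi: "\<bar>G i\<bar> \<le> (\<Sum>i\<in>UNIV. \<bar>G i\<bar>)" and v0: "\<bar>val j 0\<bar> \<le> (\<Sum>j\<in>UNIV. \<bar>val j 0\<bar>)" for i j
    by (intro member_le_sum; simp)+
  have U0: "0 \<le> U" unfolding U_def by (intro add_nonneg_nonneg sum_nonneg) auto
  \<comment> \<open>Travelling to the fixed point \<open>0\<close> bounds the values from above.\<close>
  have upper: "val i v \<le> U" if "v \<in> cbox 0 1" for i v
  proof -
    have "(\<Sum>j\<in>UNIV. E $ i $ j * val j 0) \<le> (\<Sum>j\<in>UNIV. E $ i $ j * (\<Sum>j\<in>UNIV. \<bar>val j 0\<bar>))"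
    proof (intro sum_mono mult_left_mono E)
      fix j show "val j 0 \<le> (\<Sum>j\<in>UNIV. \<bar>val j 0\<bar>)" using v0[of j] by linarith
    qed
    also have "\<dots> = (\<Sum>j\<in>UNIV. \<bar>val j 0\<bar>)" by (simp add: sum_distrib_right[symmetric] E)
    finally show ?thesis using G[OF that 0, of i] Gi[of i] unfolding U_def by linarith
  qed
  \<comment> \<open>Travelling from \<open>0\<close> to \<open>w\<close>: a very negative value at \<open>w\<close> enters with weight at least
     \<open>1 / 2\<close> and would force the value at \<open>0\<close> down, while the other states contribute at most
     \<open>U\<close>.\<close>
  have lower: "val i w \<ge> - (4 * U)" if w: "w \<in> cbox 0 1" for i w
  proof (rule ccontr)
    assume "\<not> val i w \<ge> - (4 * U)"
    then have neg: "val i w < - (4 * U)" by simp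
    have "(\<Sum>j\<in>UNIV. E $ i $ j * val j w) = E $ i $ i * val i w + (\<Sum>j\<in>UNIV - {i}. E $ i $ j * val j w)"
      by (simp add: sum.remove[of UNIV i])
    also have "(\<Sum>j\<in>UNIV - {i}. E $ i $ j * val j w) \<le> (\<Sum>j\<in>UNIV - {i}. E $ i $ j * U)"
      by (intro sum_mono mult_left_mono upper w E)
    also have "\<dots> \<le> (\<Sum>j\<in>UNIV. E $ i $ j * U)"
      using E U0 by (intro sum_mono2) auto
    also have "\<dots> = U" by (simp add: sum_distrib_right[symmetric] E)
    finally have 1: "(\<Sum>j\<in>UNIV. E $ i $ j * val j w) \<le> E $ i $ i * val i w + U" by simp
    have "E $ i $ i * val i w \<le> (1 / 2) * val i w"
      using diag[of i] neg U0 by (intro mult_right_mono_neg) auto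
    then have "val i 0 \<le> val i w / 2 + U + G i" using G[OF 0 w, of i] 1 by linarith
    moreover have "- U \<le> val i 0 - G i" using Gi[of i] v0[of i] unfolding U_def by linarith
    ultimately show False using neg by linarith
  qed
  have "\<bar>val j v\<bar> \<le> 4 * U" for j v
  proof -
    obtain w where "w \<in> cbox 0 1" "to_torus w = to_torus v" by (rule torus_lift_in_cube)
    then have "\<bar>val j w\<bar> \<le> 4 * U" "val j w = val j v"
      using upper[of w j] lower[of w j] U0 by (auto simp: val_def)
    then show ?thesis by simp
  qed
  then show thesis using U0 by (intro that[of "4 * U"]) auto
qed

text \<open>Travelling from \<open>v\<close> to \<open>w\<close> at unit speed takes the time \<open>norm (w - v)\<close>; the running cost and
  the probability of changing the state are of this order.\<close>

lemma val_lipschitz_locally: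
  obtains d K where "0 < d" "0 \<le> K" "\<And>i v w. norm (w - v) \<le> d \<Longrightarrow> val i v - val i w \<le> K * norm (w - v)"
proof -
  obtain B where B: "0 \<le> B" "\<And>j v. \<bar>val j v\<bar> \<le> B" using val_bounded by blast
  obtain d0 where d0: "0 < d0" "\<And>h i j. 0 \<le> h \<Longrightarrow> h \<le> d0 \<Longrightarrow>
     \<bar>transition h i j - mat 1 $ i $ j + h * \<Lambda> $ i $ j\<bar> \<le> 1 * h"
    using chain_semigroup_expansion[of 1 \<Lambda>] by auto
  define d where "d = min d0 1"
  obtain C where C: "\<And>i z q. norm q \<le> 1 \<Longrightarrow> \<bar>lagrangian H i z q\<bar> \<le> C"
    using lagrangian_bounded[of 1] by blast
  have C0: "0 \<le> C" using C[of 0 undefined undefined] by simp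
  have "\<exists>K\<ge>0. \<forall>v w. norm (w - v) \<le> d \<longrightarrow> val i v - val i w \<le> K * norm (w - v)" for i
  proof -
    obtain K where "constant_control_bound i K" by (rule constant_control_inequality)
    note K = constant_control_boundD[OF this]
    define K1 where "K1 = C + \<bar>\<alpha>\<bar> + 2 * C * K + (\<Sum>j\<in>UNIV. (\<bar>\<Lambda> $ i $ j\<bar> + 1) * B)"
    have S0: "0 \<le> (\<Sum>j\<in>UNIV. (\<bar>\<Lambda> $ i $ j\<bar> + 1) * B)" using B by (intro sum_nonneg mult_nonneg_nonneg) auto
    have "val i v - val i w \<le> K1 * norm (w - v)" if vw: "norm (w - v) \<le> d" for v w
    proof (cases "v = w")
      case False
      define t where "t = norm (w - v)"
      define q where "q = (1 / t) *\<^sub>R (w - v)"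
      have t: "0 < t" "t \<le> d0" "t \<le> 1" using False vw by (auto simp: t_def d_def)
      have q: "norm (- q) \<le> 1" using t(1) by (simp add: q_def t_def)
      have L: "\<bar>lagrangian H j z (- q)\<bar> \<le> C" for j z by (rule C[OF q])
      have L': "lagrangian H i z (- q) + \<alpha> \<le> C + \<bar>\<alpha>\<bar>" for z using L[of i z] by linarith
      have "v + t *\<^sub>R q = w" using t(1) by (simp add: q_def)
      then have 1: "val i v - (\<Sum>j\<in>UNIV. transition t i j * val j w) \<le> t * (C + \<bar>\<alpha>\<bar>) + 2 * C * K * t * t"
        using K(2)[OF t(1), of v q "C + \<bar>\<alpha>\<bar>" C, OF _ L] L' by simp
      have "(\<Sum>j\<in>UNIV. transition t i j * val j w) - val i w =
         (\<Sum>j\<in>UNIV. (transition t i j - mat 1 $ i $ j) * val j w)"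
        by (simp add: left_diff_distrib sum_subtractf mat_def if_distrib[of "\<lambda>x. x * _"] cong: if_cong)
      also have "\<dots> \<le> (\<Sum>j\<in>UNIV. (t * (\<bar>\<Lambda> $ i $ j\<bar> + 1)) * B)"
      proof (rule sum_mono)
        fix j
        have "\<bar>transition t i j - mat 1 $ i $ j\<bar> \<le> t * (\<bar>\<Lambda> $ i $ j\<bar> + 1)"
        proof -
          have "\<bar>t * \<Lambda> $ i $ j\<bar> = t * \<bar>\<Lambda> $ i $ j\<bar>" using t by (simp add: abs_mult)
          then show ?thesis using d0(2)[of t i j] t by (simp add: distrib_left)
        qed
        then have "\<bar>transition t i j - mat 1 $ i $ j\<bar> * \<bar>val j w\<bar> \<le> (t * (\<bar>\<Lambda> $ i $ j\<bar> + 1)) * B"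
          using B t by (intro mult_mono) auto
        moreover have "(transition t i j - mat 1 $ i $ j) * val j w \<le> \<bar>transition t i j - mat 1 $ i $ j\<bar> * \<bar>val j w\<bar>"
          unfolding abs_mult[symmetric] by (rule abs_ge_self)
        ultimately show "(transition t i j - mat 1 $ i $ j) * val j w \<le> (t * (\<bar>\<Lambda> $ i $ j\<bar> + 1)) * B"
          by linarith
      qed
      also have "\<dots> = t * (\<Sum>j\<in>UNIV. (\<bar>\<Lambda> $ i $ j\<bar> + 1) * B)" by (simp add: sum_distrib_left mult.assoc)
      finally have 2: "(\<Sum>j\<in>UNIV. transition t i j * val j w) - val i w \<le> t * (\<Sum>j\<in>UNIV. (\<bar>\<Lambda> $ i $ j\<bar> + 1) * B)" .
      have "2 * C * K * t * t \<le> 2 * C * K * t * 1" using t C0 K(1) by (intro mult_left_mono) auto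
      with 1 2 have "val i v - val i w \<le> t * (C + \<bar>\<alpha>\<bar>) + 2 * C * K * t + t * (\<Sum>j\<in>UNIV. (\<bar>\<Lambda> $ i $ j\<bar> + 1) * B)" by linarith
      also have "\<dots> = K1 * t" unfolding K1_def by (simp add: algebra_simps)
      finally show ?thesis by (simp add: t_def)
    qed simp
    moreover have "0 \<le> K1" unfolding K1_def using C0 K(1) S0 by (intro add_nonneg_nonneg) auto
    ultimately show ?thesis by blast
  qed
  then obtain K where K: "\<And>i. 0 \<le> K i" "\<And>i v w. norm (w - v) \<le> d \<Longrightarrow> val i v - val i w \<le> K i * norm (w - v)"
    by metis
  define L where "L = (\<Sum>i\<in>UNIV. K i)"
  have "val i v - val i w \<le> L * norm (w - v)" if "norm (w - v) \<le> d" for i v w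
  proof -
    have "K i \<le> L" unfolding L_def using K(1) by (intro member_le_sum) auto
    then have "K i * norm (w - v) \<le> L * norm (w - v)" by (intro mult_right_mono) auto
    then show ?thesis using K(2)[OF that, of i] by linarith
  qed
  moreover have "0 < d" "0 \<le> L" using d0(1) K(1) by (auto simp: d_def L_def intro: sum_nonneg)
  ultimately show thesis by (rule that[rotated 2])
qed

lemma val_continuous: "continuous_on UNIV (val i)"
proof -
  obtain d K where dK: "0 < d" "0 \<le> K" "\<And>i v w. norm (w - v) \<le> d \<Longrightarrow> val i v - val i w \<le> K * norm (w - v)"
    using val_lipschitz_locally by blast
  show ?thesis
    unfolding continuous_on_iff
  proof (intro ballI allI impI)
    fix v :: "real^'n" and e :: real assume e: "0 < e"
    define r where "r = min d (e / (K + 1))"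
    have r: "0 < r" "r \<le> d" "K * r < e"
    proof -
      show "0 < r" "r \<le> d" using dK e by (auto simp: r_def)
      have "K * r \<le> K * (e / (K + 1))" using dK by (intro mult_left_mono) (auto simp: r_def)
      also have "\<dots> < e" using dK e by (simp add: field_simps)
      finally show "K * r < e" .
    qed
    show "\<exists>r>0. \<forall>w\<in>UNIV. dist w v < r \<longrightarrow> dist (val i w) (val i v) < e"
    proof (intro exI conjI ballI impI)
      fix w assume w: "dist w v < r"
      have "K * norm (w - v) \<le> K * r" using w dK by (intro mult_left_mono) (auto simp: dist_norm)
      moreover have "norm (w - v) \<le> d" "norm (v - w) \<le> d" using w r by (auto simp: dist_norm norm_minus_commute)
      ultimately show "dist (val i w) (val i v) < e"
        using dK(3)[of w v i] dK(3)[of v w i] r(3) by (simp add: dist_real_def norm_minus_commute abs_less_iff)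
    qed (rule r(1))
  qed
qed

text \<open>At a touching point, let \<open>q\<close> be a velocity for which Fenchel's inequality is an equality.
  The constant control \<open>- q\<close> yields an inequality between functions of time that agree at \<open>0\<close>;
  differentiating it there gives the viscosity inequality.\<close>

lemma viscosity_inequality:
  assumes \<psi>: "C1_torus \<psi> g" and max: "\<And>y. u y $ i - \<psi> y \<le> u x $ i - \<psi> x"
  shows "H i x (g x) + \<Lambda> $ i \<bullet> u x \<le> \<alpha>"
proof (rule field_le_epsilon)
  fix e :: real assume e: "0 < e"
  obtain x0 where x0: "to_torus x0 = x" using to_torus_rep by blast
  obtain q where q: "lagrangian H i x q = g x \<bullet> q - H i x (g x)" using fenchel_attained by blast
  obtain C where C: "\<And>i z p. norm p \<le> norm q \<Longrightarrow> \<bar>lagrangian H i z p\<bar> \<le> C"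
    using lagrangian_bounded[of "norm q"] by blast
  obtain K where "constant_control_bound i K" by (rule constant_control_inequality)
  note K = constant_control_boundD[OF this]
  define c where "c = lagrangian H i x q + \<alpha> + e"
  define \<gamma> where "\<gamma> t = x0 + t *\<^sub>R (- q)" for t
  have \<gamma>: "(\<gamma> \<longlongrightarrow> x0) (at_right 0)"
  proof -
    have "(\<gamma> \<longlongrightarrow> x0 + 0 *\<^sub>R (- q)) (at_right 0)" unfolding \<gamma>_def by (intro tendsto_intros)
    then show ?thesis by simp
  qed
  have "((\<lambda>s. lagrangian H i (to_torus (fst (\<gamma> s, q))) (snd (\<gamma> s, q))) \<longlongrightarrow> lagrangian H i (to_torus (fst (x0, q))) (snd (x0, q))) (at_right 0)"
    by (rule continuous_on_tendsto_compose[OF lagrangian_continuous[unfolded case_prod_unfold]])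
       (auto intro!: tendsto_intros \<gamma>)
  then have "eventually (\<lambda>s. lagrangian H i (to_torus (\<gamma> s)) q < lagrangian H i x q + e) (at_right 0)"
    using order_tendstoD(2)[of _ "lagrangian H i x q" "at_right 0" "lagrangian H i x q + e"] e by (simp add: x0)
  then obtain b where b: "0 < b" "\<And>s. 0 < s \<Longrightarrow> s < b \<Longrightarrow> lagrangian H i (to_torus (\<gamma> s)) q < lagrangian H i x q + e"
    unfolding eventually_at_right_field by auto
  have cost: "lagrangian H i (to_torus (\<gamma> s)) q + \<alpha> \<le> c" if "0 \<le> s" "s < b" for s
  proof (cases "s = 0")
    case True then show ?thesis using e by (simp add: \<gamma>_def x0 c_def)
  next
    case False then show ?thesis using b(2)[of s] that by (simp add: c_def)
  qed
  define \<Psi> where "\<Psi> v = \<psi> (to_torus v)" for v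
  \<comment> \<open>The inequality along the segment, divided by \<open>t\<close>, with the test function in place of
     the \<open>i\<close>-th component of \<open>u\<close>.\<close>
  have quot: "(\<Psi> x0 - \<Psi> (\<gamma> t)) / t - (\<Sum>j\<in>UNIV. (transition t i j - mat 1 $ i $ j) / t * val j (\<gamma> t)) \<le> c + 2 * C * K * t"
    if t: "0 < t" "t < b" for t
  proof -
    have "val i x0 - (\<Sum>j\<in>UNIV. transition t i j * val j (\<gamma> t)) \<le> t * c + 2 * C * K * t * t"
      unfolding \<gamma>_def
    proof (rule K(2)[OF t(1)])
      show "lagrangian H i (to_torus (x0 + s *\<^sub>R - q)) (- (- q)) + \<alpha> \<le> c" if "s \<in> {0..t}" for s
        using cost[of s] that t by (simp add: \<gamma>_def)
      show "\<bar>lagrangian H j z (- (- q))\<bar> \<le> C" for j z by (rule C) simp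
    qed
    moreover have "(\<Sum>j\<in>UNIV. transition t i j * val j (\<gamma> t)) =
        val i (\<gamma> t) + (\<Sum>j\<in>UNIV. (transition t i j - mat 1 $ i $ j) * val j (\<gamma> t))"
      by (simp add: left_diff_distrib sum_subtractf mat_def if_distrib[of "\<lambda>x. x * _"] cong: if_cong)
    moreover have "\<Psi> x0 - \<Psi> (\<gamma> t) \<le> val i x0 - val i (\<gamma> t)"
      using max[of "to_torus (\<gamma> t)"] by (simp add: \<Psi>_def val_def x0)
    ultimately have "\<Psi> x0 - \<Psi> (\<gamma> t) - (\<Sum>j\<in>UNIV. (transition t i j - mat 1 $ i $ j) * val j (\<gamma> t)) \<le> t * c + 2 * C * K * t * t"
      by linarith
    then have "(\<Psi> x0 - \<Psi> (\<gamma> t) - (\<Sum>j\<in>UNIV. (transition t i j - mat 1 $ i $ j) * val j (\<gamma> t))) / t \<le> (t * c + 2 * C * K * t * t) / t"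
      using t(1) by (intro divide_right_mono) auto
    also have "(t * c + 2 * C * K * t * t) / t = c + 2 * C * K * t" using t(1) by (simp add: field_simps)
    finally show ?thesis
      by (simp only: diff_divide_distrib[of "\<Psi> x0 - \<Psi> (\<gamma> t)"] sum_divide_distrib times_divide_eq_left)
  qed
  have lim1: "((\<lambda>t. (\<Psi> x0 - \<Psi> (\<gamma> t)) / t) \<longlongrightarrow> q \<bullet> g x) (at_right 0)"
  proof -
    have "(\<Psi> has_derivative (\<lambda>h. h \<bullet> g x)) (at x0)"
      using \<psi> x0 unfolding C1_torus_def gderiv_def \<Psi>_def by metis
    then have D: "(\<Psi> has_derivative (\<lambda>h. h \<bullet> g x)) (at (\<gamma> 0))" by (simp add: \<gamma>_def)
    have "(\<gamma> has_derivative (\<lambda>t. t *\<^sub>R (- q))) (at 0)" unfolding \<gamma>_def by (auto intro!: derivative_eq_intros)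
    from has_derivative_compose[OF this D]
    have "((\<lambda>t. \<Psi> (\<gamma> t)) has_derivative (\<lambda>t. (t *\<^sub>R (- q)) \<bullet> g x)) (at 0)" .
    then have "((\<lambda>t. \<Psi> (\<gamma> t)) has_real_derivative - (q \<bullet> g x)) (at 0)"
      unfolding has_field_derivative_def by (rule has_derivative_eq_rhs) (simp add: fun_eq_iff)
    then have "((\<lambda>t. (\<Psi> (\<gamma> t) - \<Psi> x0) / t) \<longlongrightarrow> - (q \<bullet> g x)) (at 0)"
      by (simp add: has_field_derivative_iff \<gamma>_def)
    then have "((\<lambda>t. - ((\<Psi> (\<gamma> t) - \<Psi> x0) / t)) \<longlongrightarrow> - (- (q \<bullet> g x))) (at 0)" by (rule tendsto_minus)
    then have "((\<lambda>t. (\<Psi> x0 - \<Psi> (\<gamma> t)) / t) \<longlongrightarrow> q \<bullet> g x) (at 0)"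
      by (simp add: minus_divide_left)
    then show ?thesis by (rule tendsto_within_subset) simp
  qed
  have lim2: "((\<lambda>t. (transition t i j - mat 1 $ i $ j) / t) \<longlongrightarrow> - \<Lambda> $ i $ j) (at_right 0)" for j
  proof -
    have "((\<lambda>t. (transition t i j - mat 1 $ i $ j) / t) \<longlongrightarrow> - \<Lambda> $ i $ j) (at 0)"
      using chain_semigroup_deriv[of \<Lambda> i j 0] by (simp add: has_field_derivative_iff)
    then show ?thesis by (rule tendsto_within_subset) simp
  qed
  have lim3: "((\<lambda>t. val j (\<gamma> t)) \<longlongrightarrow> val j x0) (at_right 0)" for j
    by (rule continuous_on_tendsto_compose[OF val_continuous \<gamma>]) auto
  have "((\<lambda>t. (\<Psi> x0 - \<Psi> (\<gamma> t)) / t - (\<Sum>j\<in>UNIV. (transition t i j - mat 1 $ i $ j) / t * val j (\<gamma> t)))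
     \<longlongrightarrow> q \<bullet> g x - (\<Sum>j\<in>UNIV. - \<Lambda> $ i $ j * val j x0)) (at_right 0)"
    by (intro tendsto_diff tendsto_sum tendsto_mult lim1 lim2 lim3)
  moreover have "((\<lambda>t. c + 2 * C * K * t) \<longlongrightarrow> c + 2 * C * K * 0) (at_right 0)" by (intro tendsto_intros)
  moreover have "eventually (\<lambda>t. (\<Psi> x0 - \<Psi> (\<gamma> t)) / t - (\<Sum>j\<in>UNIV. (transition t i j - mat 1 $ i $ j) / t * val j (\<gamma> t)) \<le> c + 2 * C * K * t) (at_right 0)"
    unfolding eventually_at_right_field using b(1) quot by blast
  ultimately have "q \<bullet> g x - (\<Sum>j\<in>UNIV. - \<Lambda> $ i $ j * val j x0) \<le> c + 2 * C * K * 0"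
    by (intro tendsto_le[OF trivial_limit_at_right_real])
  moreover have "(\<Sum>j\<in>UNIV. - \<Lambda> $ i $ j * val j x0) = - (\<Lambda> $ i \<bullet> u x)"
    by (simp add: inner_vec_def val_def x0 sum_negf)
  ultimately show "H i x (g x) + \<Lambda> $ i \<bullet> u x \<le> \<alpha> + e"
    by (simp add: c_def q inner_commute)
qed

lemma subsolution: "subsolution H \<Lambda> \<alpha> u"
proof -
  have "continuous_on UNIV (\<lambda>v. \<chi> i. val i v)" by (intro continuous_intros val_continuous)
  moreover have "(\<lambda>v. \<chi> i. val i v) = (\<lambda>v. u (to_torus v))" by (simp add: val_def vec_eq_iff fun_eq_iff)
  ultimately have "continuous_on UNIV (\<lambda>v. u (to_torus v))" by (simp only:)
  then have "continuous_on UNIV u" by (simp only: continuous_torus_iff)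
  then show ?thesis unfolding subsolution_def using viscosity_inequality by blast
qed

end

section \<open>The characterisation\<close>

theorem theorem5p7:
  fixes H :: "'m::finite \<Rightarrow> 'n::finite torus \<Rightarrow> real^'n \<Rightarrow> real"
    and \<Lambda> :: "real^'m^'m"
    and \<alpha> :: real
    and u :: "'n torus \<Rightarrow> real^'m"
  assumes "\<And>i. continuous_on UNIV (\<lambda>(x, p). H i x p)"
    and "\<And>i x. convex_on UNIV (H i x)"
    and "\<And>i x. superlinear (H i x)"
    and "coupling_matrix \<Lambda>"
    and "\<alpha> \<ge> critical_value H \<Lambda>"
  shows "subsolution H \<Lambda> \<alpha> u \<longleftrightarrow>
    (\<forall>x y. \<forall>a\<in>prob_simplex. \<forall>\<tau>. bounded_stopping_time \<tau> \<longrightarrow>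
      (\<forall>\<Xi>\<in>controls_to \<Lambda> \<tau> (y - x).
        prob_space.expectation (path_law \<Lambda> a) (\<lambda>\<omega>. u x $ \<omega> 0 - u y $ \<omega> (\<tau> \<omega>))
        \<le> prob_space.expectation (path_law \<Lambda> a) (\<lambda>\<omega>.
            LBINT s:{0..\<tau> \<omega>}.
              (lagrangian H (\<omega> s) (x + torus_integral (\<Xi> \<omega>) s) (- \<Xi> \<omega> s) + \<alpha>))))"
    (is "_ \<longleftrightarrow> ?inequality")
proof
  have ham: "hamiltonian H" using assms(1-3) by (rule hamiltonian.intro)
  have coup: "coupling \<Lambda>" using assms(4) by (rule coupling.intro)
  {
    assume sub: "subsolution H \<Lambda> \<alpha> u"
    show ?inequality
    proof (intro allI ballI impI)
      fix x y :: "'n torus" and a :: "real^'m" and \<tau> :: "(real \<Rightarrow> 'm) \<Rightarrow> real" and \<Xi> :: "(real \<Rightarrow> 'm) \<Rightarrow> real \<Rightarrow> real^'n"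
      assume a: "a \<in> prob_simplex" and \<tau>: "bounded_stopping_time \<tau>" and \<Xi>: "\<Xi> \<in> controls_to \<Lambda> \<tau> (y - x)"
      obtain x0 where x0: "to_torus x0 = x" using to_torus_rep by blast
      have "controlled_subsolution H \<Lambda> a \<Xi> \<alpha> u"
        using \<Xi> ham coup a sub
        by (intro controlled_subsolution.intro controlled.intro chain.intro chain_axioms.intro
            controlled_axioms.intro controlled_subsolution_axioms.intro) (auto simp: controls_to_def)
      then interpret co: controlled_subsolution H \<Lambda> a \<Xi> x0 \<alpha> u .
      have \<tau>m: "\<tau> \<in> borel_measurable co.P"
        using \<tau> by (simp add: bounded_stopping_time_def cong: measurable_cong_sets)
      have end_state: "(\<lambda>\<omega>. \<omega> (\<tau> \<omega>)) \<in> measurable co.P (count_space UNIV)"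
      proof -
        have "(\<lambda>\<omega>. (\<omega>, \<tau> \<omega>)) \<in> measurable co.P (co.P \<Otimes>\<^sub>M borel)" using \<tau>m by measurable
        from measurable_compose[OF this co.measurable_index_joint] show ?thesis by simp
      qed
      have m: "(\<lambda>\<omega>. u x $ \<omega> 0) \<in> borel_measurable co.P" "(\<lambda>\<omega>. u y $ \<omega> (\<tau> \<omega>)) \<in> borel_measurable co.P"
        by (rule measurable_compose[OF co.measurable_eval[OF order_refl]], simp)
           (rule measurable_compose[OF end_state], simp)
      have "almost_surely \<Lambda> (\<lambda>\<omega>. torus_integral (\<Xi> \<omega>) (\<tau> \<omega>) = y - x)"
        using \<Xi> by (simp add: controls_to_def)
      from co.almost_surely_AE[OF this]
      have arrive: "AE \<omega> in co.P. to_torus (co.curve \<omega> (\<tau> \<omega>)) = y"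
        by eventually_elim (simp add: co.curve_def to_torus_add x0 torus_integral_def primitive_def)
      have "co.expectation (\<lambda>\<omega>. u x $ \<omega> 0 - u y $ \<omega> (\<tau> \<omega>)) =
          co.expectation (\<lambda>\<omega>. co.val (\<omega> 0) x0 - co.val (\<omega> (\<tau> \<omega>)) (co.curve \<omega> (\<tau> \<omega>)))"
      proof (rule integral_cong_AE)
        show "AE \<omega> in co.P. u x $ \<omega> 0 - u y $ \<omega> (\<tau> \<omega>) = co.val (\<omega> 0) x0 - co.val (\<omega> (\<tau> \<omega>)) (co.curve \<omega> (\<tau> \<omega>))"
          using arrive by eventually_elim (simp add: co.val_def x0)
        have "(\<lambda>\<omega>. co.val (\<omega> 0) x0) \<in> borel_measurable co.P" using m(1) by (simp add: co.val_def x0)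
        then show "(\<lambda>\<omega>. co.val (\<omega> 0) x0 - co.val (\<omega> (\<tau> \<omega>)) (co.curve \<omega> (\<tau> \<omega>))) \<in> borel_measurable co.P"
          by (intro borel_measurable_diff co.measurable_val_at \<tau>m)
      qed (intro borel_measurable_diff m)
      also have "\<dots> \<le> co.expectation (\<lambda>\<omega>. LBINT s:{0..\<tau> \<omega>}. co.cost \<omega> s)"
        by (rule co.subsolution_inequality[OF \<tau>])
      finally show "co.expectation (\<lambda>\<omega>. u x $ \<omega> 0 - u y $ \<omega> (\<tau> \<omega>)) \<le> co.expectation (\<lambda>\<omega>. LBINT s:{0..\<tau> \<omega>}.
              (lagrangian H (\<omega> s) (x + torus_integral (\<Xi> \<omega>) s) (- \<Xi> \<omega> s) + \<alpha>))"
        by (simp add: co.cost_def[abs_def] co.curve_def to_torus_add x0 torus_integral_def primitive_def)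
    qed
  next
    assume ineq: ?inequality
    have "stochastic_inequality H \<Lambda> \<alpha> u"
      by (intro stochastic_inequality.intro stochastic_inequality_axioms.intro ham coup) (use ineq in blast)
    then show "subsolution H \<Lambda> \<alpha> u" by (rule stochastic_inequality.subsolution)
  }
qed

end
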